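(* Fix $\lambda\ge 1$, $\mu\in\mathbb{R}$ and $\sigma>0$, and let $X_1,X_2,\ldots$ be i.i.d. with the $\mathrm{EPD}_\lambda(\mu,\sigma)$ distribution (the null hypothesis). Let $Z^*(S_\lambda)$ and $Z^*(K_\lambda)$ be the statistics computed from $X_1,\ldots,X_n$ as defined in the context. Then, as $n\to\infty$, $$\begin{pmatrix} Z^*(S_\lambda)\\ Z^*(K_\lambda)\end{pmatrix}\xrightarrow{\ \mathcal{D}\ }\mathcal{N}_2\left(\begin{pmatrix}0\\0\end{pmatrix},\begin{pmatrix}1&0\\0&1\end{pmatrix}\right)\quad\text{and}\quad \big(Z^*(S_\lambda)\big)^2+\big(Z^*(K_\lambda)\big)^2\xrightarrow{\ \mathcal{D}\ }\chi^2_2 .$$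
   Context: $\mathrm{EPD}_\lambda(\mu,\sigma)$ is the distribution on $\mathbb{R}$ with density $g_\lambda(x\mid\mu,\sigma)=\frac{1}{2\sigma\lambda^{1/\lambda}\Gamma(1+1/\lambda)}\exp\left(-\frac1\lambda\left|\frac{x-\mu}{\sigma}\right|^\lambda\right)$. Estimators (computed from $X_1,\dots,X_n$): $\hat\mu_\lambda$ is the sample median if $\lambda=1$ (central order statistic if $n$ is odd, arithmetic mean of the two central order statistics if $n$ is even), and for $\lambda>1$ it is the unique solution $m$ of $\sum_{i=1}^n|X_i-m|^{\lambda-1}\mathrm{sign}(X_i-m)=0$ (the sample mean when $\lambda=2$). $\hat\sigma_\lambda=\left(\frac1n\sum_{i=1}^n|X_i-\hat\mu_\lambda|^\lambda\right)^{1/\lambda}$. With $\hat Y_i=\hat\sigma_\lambda^{-1}(X_i-\hat\mu_\lambda)$ and the convention $|y|^\lambda\log|y|=0$ at $y=0$: $S_\lambda=\frac1n\sum_{i=1}^n|\hat Y_i|^\lambda\mathrm{sign}(\hat Y_i)$ and $K_\lambda=\frac1n\sum_{i=1}^n|\hat Y_i|^\lambda\log|\hat Y_i|$. $\psi=(\log\Gamma)'$ is the digamma function and $\psi_1=\psi'$ the trigamma function. Put $V_S=1+\lambda-\frac{\lambda^2}{\Gamma(2-1/\lambda)\Gamma(1/\lambda)}$, $E_K=\frac{\lambda+\log\lambda+\psi(1/\lambda)}{\lambda}$, $V_K=\frac{(1+1/\lambda)\psi_1(1+1/\lambda)-1}{\lambda}$. Then $Z^*(S_\lambda)=\sqrt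 n\,V_S^{-1/2}S_\lambda$ and $Z^*(K_\lambda)=\sqrt n\,V_K^{-1/2}(K_\lambda-E_K)$. $\chi_2^2$ is the chi-square distribution with 2 degrees of freedom; $\xrightarrow{\mathcal D}$ is convergence in distribution. *)

theory Defs
  imports "HOL-Probability.Probability"
begin

section \<open>Distributions\<close>

definition epd_density :: "real \<Rightarrow> real \<Rightarrow> real \<Rightarrow> real \<Rightarrow> real" where
  "epd_density lam \<mu> \<sigma> x =
     1 / (2 * \<sigma> * lam powr (1 / lam) * Gamma (1 + 1 / lam)) *
     exp (- (1 / lam) * \<bar>(x - \<mu>) / \<sigma>\<bar> powr lam)"

text \<open>The normal distribution with mean vector \<open>m\<close> and positive definite covariance matrix \<open>C\<close>.\<close>

definition multivariate_normal :: "real ^ 'n \<Rightarrow> real ^ 'n ^ 'n \<Rightarrow> (real ^ 'n) measure" where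
  "multivariate_normal m C = density lborel (\<lambda>x. ennreal
     (1 / sqrt ((2 * pi) ^ CARD('n) * det C) *
      exp (- (1 / 2) * ((x - m) \<bullet> (matrix_inv C *v (x - m))))))"

definition chi_square_density :: "nat \<Rightarrow> real \<Rightarrow> real" where
  "chi_square_density k x =
     (if x > 0
      then x powr (real k / 2 - 1) * exp (- x / 2) / (2 powr (real k / 2) * Gamma (real k / 2))
      else 0)"

definition chi_square :: "nat \<Rightarrow> real measure" where
  "chi_square k = density lborel (\<lambda>x. ennreal (chi_square_density k x))"

text \<open>
  Weak convergence of Borel measures on an arbitrary topological space; the library's
  \<^const>\<open>weak_conv_m\<close> is confined to the real line. A sequence of random variables
  converges in distribution if its laws \<open>distr M borel (Z n)\<close> converge weakly. Measurability of
  \<open>Z n\<close> for large \<open>n\<close> is implied: on a probability space \<open>M\<close>, \<^const>\<open>distr\<close> yields the null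
  measure for a non-measurable map, which the constant test function 1 excludes when the limit
  is a probability measure.
\<close>

definition weak_conv_borel :: "(nat \<Rightarrow> 'b::topological_space measure) \<Rightarrow> 'b measure \<Rightarrow> bool" where
  "weak_conv_borel L L' \<longleftrightarrow>
     (\<forall>f::'b \<Rightarrow> real. continuous_on UNIV f \<and> bounded (range f) \<longrightarrow>
        (\<lambda>n. \<integral>x. f x \<partial>L n) \<longlonglongrightarrow> (\<integral>x. f x \<partial>L'))"

section \<open>Estimators and test statistics\<close>

text \<open>A sample of size \<open>n\<close> is \<open>x 0, \<dots>, x (n - 1)\<close>.\<close>

definition sample_median :: "nat \<Rightarrow> (nat \<Rightarrow> real) \<Rightarrow> real" where
  "sample_median n x =
     (let s = sort (map x [0..<n])
      in if odd n then s ! (n div 2) else (s ! (n div 2 - 1) + s ! (n div 2)) / 2)"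

definition mu_hat :: "real \<Rightarrow> nat \<Rightarrow> (nat \<Rightarrow> real) \<Rightarrow> real" where
  "mu_hat lam n x =
     (if lam = 1 then sample_median n x
      else (THE m. (\<Sum>i<n. \<bar>x i - m\<bar> powr (lam - 1) * sgn (x i - m)) = 0))"

definition sigma_hat :: "real \<Rightarrow> nat \<Rightarrow> (nat \<Rightarrow> real) \<Rightarrow> real" where
  "sigma_hat lam n x = ((1 / real n) * (\<Sum>i<n. \<bar>x i - mu_hat lam n x\<bar> powr lam)) powr (1 / lam)"

definition Y_hat :: "real \<Rightarrow> nat \<Rightarrow> (nat \<Rightarrow> real) \<Rightarrow> nat \<Rightarrow> real" where
  "Y_hat lam n x i = (x i - mu_hat lam n x) / sigma_hat lam n x"

definition S_stat :: "real \<Rightarrow> nat \<Rightarrow> (nat \<Rightarrow> real) \<Rightarrow> real" where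
  "S_stat lam n x = (1 / real n) * (\<Sum>i<n. \<bar>Y_hat lam n x i\<bar> powr lam * sgn (Y_hat lam n x i))"

text \<open>Since \<open>0 powr lam = 0\<close>, the summand vanishes where \<^const>\<open>Y_hat\<close> does.\<close>

definition K_stat :: "real \<Rightarrow> nat \<Rightarrow> (nat \<Rightarrow> real) \<Rightarrow> real" where
  "K_stat lam n x = (1 / real n) * (\<Sum>i<n. \<bar>Y_hat lam n x i\<bar> powr lam * ln \<bar>Y_hat lam n x i\<bar>)"

definition V_S :: "real \<Rightarrow> real" where
  "V_S lam = 1 + lam - lam\<^sup>2 / (Gamma (2 - 1 / lam) * Gamma (1 / lam))"

definition E_K :: "real \<Rightarrow> real" where
  "E_K lam = (lam + ln lam + Digamma (1 / lam)) / lam"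

definition V_K :: "real \<Rightarrow> real" where
  "V_K lam = ((1 + 1 / lam) * Polygamma 1 (1 + 1 / lam) - 1) / lam"

definition Z_S :: "real \<Rightarrow> nat \<Rightarrow> (nat \<Rightarrow> real) \<Rightarrow> real" where
  "Z_S lam n x = sqrt (real n) * V_S lam powr (- 1 / 2) * S_stat lam n x"

definition Z_K :: "real \<Rightarrow> nat \<Rightarrow> (nat \<Rightarrow> real) \<Rightarrow> real" where
  "Z_K lam n x = sqrt (real n) * V_K lam powr (- 1 / 2) * (K_stat lam n x - E_K lam)"

end

theory Submission
  imports Defs
begin

text \<open>
  By invariance one may take \<open>\<mu> = 0\<close>, \<open>\<sigma> = 1\<close>. The density \<open>g\<close> then satisfies \<open>g' = - \<psi> g\<close> with
  \<open>\<psi> y = \<bar>y\<bar> powr (\<lambda> - 1) * sgn y\<close>. For monotone \<open>h\<close> the process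
  \<open>t \<mapsto> (\<Sum>i<n. h (Y i - t / \<surd>n) - h (Y i)) / \<surd>n\<close> is monotone and converges in probability to
  \<open>- t E[h \<psi>]\<close> for each \<open>t\<close>, hence locally uniformly, and a tight random \<open>t\<close> may be plugged in. For \<open>h = \<psi>\<close>
  this linearises the location estimator, for every \<open>\<lambda> \<ge> 1\<close>, the median included. Plugging
  \<open>t = \<surd>n \<mu>_hat\<close> into the sums of \<open>\<bar>y\<bar>^\<lambda> sgn y\<close>, \<open>\<bar>y\<bar>^\<lambda>\<close> and \<open>\<bar>y\<bar>^\<lambda> ln \<bar>y\<bar>\<close> shows that the two statistics are
  normalised sums of \<open>\<xi> (Y i)\<close> and \<open>\<eta> (Y i)\<close> up to terms vanishing in probability. Here \<open>\<xi>\<close> is the residual of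
  \<open>\<bar>y\<bar>^\<lambda> sgn y\<close> after projection onto \<open>\<psi>\<close>; it is odd while \<open>\<eta>\<close> is even, so they are uncorrelated. Their variances
  come from derivatives of the Gamma function, as \<open>\<bar>Y\<bar>^\<lambda> / \<lambda>\<close> has the Gamma distribution with shape \<open>1 / \<lambda>\<close>. The one-dimensional
  central limit theorem gives the limit of the joint characteristic function, and Levy's theorem on the line together
  with the Stone-Weierstrass theorem turns this into weak convergence on the plane.
\<close>

text \<open>The obstacle is that \<open>psi\<close> need not be smooth: at \<open>lam = 1\<close> it
  is the sign function, and for \<open>1 < lam < 2\<close> its derivative is unbounded near 0. So
  the estimating equation is not expanded sample by sample; only its mean is, with the shift moved
  to the density, which is differentiable off 0 and has an exponentially decaying Lipschitz bound.
  Plugging in a random shift would ordinarily call for a uniform bound over a class of functions.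
  Monotonicity replaces it, and summands that are not monotone are written as combinations of
  monotone ones. The number \<open>J\<close> plays two parts: it is the variance of
  \<open>psi\<close> and, because the density has derivative \<open>- psi * dens\<close>, also the
  slope of the shifted mean of \<open>psi\<close>. Hence the location error behaves like the mean of
  \<open>psi (Y i)\<close> divided by \<open>J\<close>. The two statistics feel the estimators
  differently. The odd sum in S is centred, so to first order it sees the location error and not the
  scale error. The even sums in K have slope 0, so to first order they see only the scale error,
  which enters both as a factor and through a logarithm.\<close>

section \<open>Weak convergence on the plane\<close>

text \<open>The normalised weight \<open>w n\<close> is a density of a probability measure with respect to \<open>M\<close>.\<close>

lemma (in prob_space) weighted_levy_continuity:
  fixes w Y :: "nat \<Rightarrow> 'a \<Rightarrow> real" and f :: "real \<Rightarrow> real"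
  assumes w_meas[measurable]: "\<And>n. w n \<in> borel_measurable M"
    and Y_meas[measurable]: "\<And>n. Y n \<in> borel_measurable M"
    and w_bounds: "\<And>n \<omega>. a \<le> w n \<omega>" "\<And>n \<omega>. w n \<omega> \<le> b" "0 < a"
    and N: "real_distribution N"
    and W: "(\<lambda>n. expectation (w n)) \<longlonglongrightarrow> W"
    and char: "\<And>t. (\<lambda>n. CLINT \<omega>|M. w n \<omega> *\<^sub>R iexp (t * Y n \<omega>)) \<longlonglongrightarrow> W *\<^sub>R char N t"
    and f: "continuous_on UNIV f" "\<And>x. \<bar>f x\<bar> \<le> B"
  shows "(\<lambda>n. expectation (\<lambda>\<omega>. w n \<omega> * f (Y n \<omega>))) \<longlonglongrightarrow> W * (\<integral>x. f x \<partial>N)"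
proof -
  have [measurable]: "f \<in> borel_measurable borel"
    using f(1) by (rule borel_measurable_continuous_onI)
  have w_int: "integrable M (w n)" for n
  proof (rule integrable_const_bound[of _ b])
    show "AE \<omega> in M. norm (w n \<omega>) \<le> b"
    proof (rule AE_I2)
      show "norm (w n \<omega>) \<le> b" for \<omega>
        using w_bounds(1,2)[of n \<omega>] w_bounds(3) by (simp add: abs_le_iff)
    qed
  qed simp
  define c where "c n = expectation (w n)" for n
  have c_ge: "a \<le> c n" for n
    unfolding c_def using integral_mono[of M "\<lambda>_. a" "w n"] w_int w_bounds by (simp add: prob_space)
  have c_pos: "c n > 0" for n
    using c_ge[of n] w_bounds by linarith
  have W_pos: "W > 0"
    using LIMSEQ_le_const[OF W, of a] c_ge w_bounds(3) by (force simp: c_def)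
  have w_pos: "0 \<le> w n \<omega>" for n \<omega>
    using w_bounds(1)[of n \<omega>] w_bounds(3) by linarith
  define P where "P n = density M (\<lambda>\<omega>. ennreal (w n \<omega> / c n))" for n
  have P_prob: "prob_space (P n)" for n
  proof
    have "emeasure (P n) (space (P n)) = (\<integral>\<^sup>+\<omega>. ennreal (w n \<omega> / c n) \<partial>M)"
      unfolding P_def by (simp add: emeasure_density cong: nn_integral_cong_simp)
    also have "\<dots> = ennreal (\<integral>\<omega>. w n \<omega> / c n \<partial>M)"
      using w_int w_pos c_pos by (intro nn_integral_eq_integral) (auto simp: less_imp_le)
    also have "\<dots> = 1"
      using c_pos[of n] by (simp add: c_def)
    finally show "emeasure (P n) (space (P n)) = 1" .
  qed
  have Y_P[measurable]: "Y n \<in> borel_measurable (P n)" for n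
    unfolding P_def by simp
  define L where "L n = distr (P n) borel (Y n)" for n
  have L: "real_distribution (L n)" for n
    unfolding L_def by (rule prob_space.real_distribution_distr[OF P_prob Y_P])
  \<comment> \<open>Stated for Banach-valued integrands, to serve the complex characteristic
    function and the real test function alike.\<close>
  have int_L: "integral\<^sup>L (L n) h = (1 / c n) *\<^sub>R (\<integral>\<omega>. w n \<omega> *\<^sub>R h (Y n \<omega>) \<partial>M)"
    if [measurable]: "h \<in> borel_measurable borel" for n and h :: "real \<Rightarrow> 'c::{banach, second_countable_topology}"
  proof -
    have "integral\<^sup>L (L n) h = (\<integral>\<omega>. (w n \<omega> / c n) *\<^sub>R h (Y n \<omega>) \<partial>M)"
      unfolding L_def using w_pos c_pos
      by (subst integral_distr) (auto simp: P_def integral_density less_imp_le)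
    also have "\<dots> = (\<integral>\<omega>. (1 / c n) *\<^sub>R (w n \<omega> *\<^sub>R h (Y n \<omega>)) \<partial>M)"
      by simp
    finally show ?thesis
      by (simp only: integral_scaleR_right)
  qed
  have c_lim: "(\<lambda>n. 1 / c n) \<longlonglongrightarrow> 1 / W"
    using W W_pos unfolding c_def by (intro tendsto_intros) auto
  have "weak_conv_m L N"
  proof (rule levy_continuity[OF L N])
    fix t
    have "char (L n) t = (1 / c n) *\<^sub>R (CLINT \<omega>|M. w n \<omega> *\<^sub>R iexp (t * Y n \<omega>))" for n
      unfolding char_def by (rule int_L) simp
    moreover have "(\<lambda>n. (1 / c n) *\<^sub>R (CLINT \<omega>|M. w n \<omega> *\<^sub>R iexp (t * Y n \<omega>)))
        \<longlonglongrightarrow> (1 / W) *\<^sub>R (W *\<^sub>R char N t)"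
      by (intro tendsto_scaleR c_lim char)
    ultimately show "(\<lambda>n. char (L n) t) \<longlonglongrightarrow> char N t"
      using W_pos by simp
  qed
  hence "(\<lambda>n. integral\<^sup>L (L n) f) \<longlonglongrightarrow> integral\<^sup>L N f"
    using L N f by (intro weak_conv_imp_integral_bdd_continuous_conv)
      (auto simp: continuous_on_eq_continuous_at)
  hence "(\<lambda>n. c n * integral\<^sup>L (L n) f) \<longlonglongrightarrow> W * integral\<^sup>L N f"
    using W unfolding c_def by (intro tendsto_mult)
  moreover have "c n * integral\<^sup>L (L n) f = expectation (\<lambda>\<omega>. w n \<omega> * f (Y n \<omega>))" for n
    using c_pos[of n] by (simp add: int_L)
  ultimately show ?thesis
    by simp
qed

lemma cnj_char: "cnj (char N t) = char N (- t)"
  proof -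
  have "cnj (char N t) = (CLINT x|N. cnj (iexp (t * x)))"
    unfolding char_def by (rule Bochner_Integration.integral_cnj[symmetric])
  thus ?thesis by (simp add: char_def exp_cnj)
qed

text \<open>
  The weighted continuity theorem is applied twice: to \<open>V\<close> with the weights \<open>2 + cos (s U + c)\<close>,
  then to \<open>U\<close> with the weight \<open>g V\<close>, shifted by a constant to make it positive.
\<close>

lemma (in prob_space) char_conv_imp_product_conv:
  fixes U V :: "nat \<Rightarrow> 'a \<Rightarrow> real" and f g :: "real \<Rightarrow> real"
  assumes U[measurable]: "\<And>n. U n \<in> borel_measurable M"
    and V[measurable]: "\<And>n. V n \<in> borel_measurable M"
    and N: "real_distribution N" and N': "real_distribution N'"
    and char: "\<And>s t. (\<lambda>n. CLINT \<omega>|M. iexp (s * U n \<omega> + t * V n \<omega>)) \<longlonglongrightarrow> char N s * char N' t"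
    and f: "continuous_on UNIV f" "\<And>x. \<bar>f x\<bar> \<le> B"
    and g: "continuous_on UNIV g" "\<And>x. \<bar>g x\<bar> \<le> B"
  shows "(\<lambda>n. expectation (\<lambda>\<omega>. f (U n \<omega>) * g (V n \<omega>))) \<longlonglongrightarrow> (\<integral>x. f x \<partial>N) * (\<integral>x. g x \<partial>N')"
proof -
  interpret N: real_distribution N by (rule N)
  interpret N': real_distribution N' by (rule N')
  have [measurable]: "f \<in> borel_measurable borel" "g \<in> borel_measurable borel"
    using f(1) g(1) by (auto intro: borel_measurable_continuous_onI)
  have B: "0 \<le> B" using f(2)[of 0] by linarith
  have iexp_int: "integrable M (\<lambda>\<omega>. iexp (r n \<omega>))" if "r n \<in> borel_measurable M" for r :: "nat \<Rightarrow> 'a \<Rightarrow> real" and n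
    using that by (intro integrable_const_bound[of _ 1]) auto
  define E where "E s t n = (CLINT \<omega>|M. iexp (s * U n \<omega> + t * V n \<omega>))" for s t n
  note char = char[folded E_def]
  \<comment> \<open>A weight has to be real and positive, so \<open>iexp (s * U n \<omega>)\<close>
    enters through its cosine. Adding 2 keeps the weight in [1, 3], and the phase \<open>c\<close>
    recovers the sine later.\<close>
  have cos_weight: "(\<lambda>n. expectation (\<lambda>\<omega>. (2 + cos (s * U n \<omega> + c)) * g (V n \<omega>)))
      \<longlonglongrightarrow> (2 + Re (cis c * char N s)) * (\<integral>x. g x \<partial>N')" (is "?C s c") for s c
  proof -
    define W where "W = 2 + Re (cis c * char N s)"
    have W_eq: "complex_of_real W = 2 + (iexp c * char N s + iexp (- c) * char N (- s)) / 2"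
      unfolding cis_conv_exp[symmetric] cnj_char[symmetric] W_def by (simp add: complex_eq_iff)
    have *: "(\<lambda>n. CLINT \<omega>|M. (2 + cos (s * U n \<omega> + c)) *\<^sub>R iexp (t * V n \<omega>)) \<longlonglongrightarrow> W *\<^sub>R char N' t" for t
    proof -
      \<comment> \<open>Euler's formula for the cosine; the dummy term \<open>0 * z\<close> gives
        the constant part the shape of \<open>E 0 t n\<close>.\<close>
      have pt: "(2 + cos (x + c)) *\<^sub>R iexp y = 2 * iexp (0 * z + y)
          + (iexp c / 2) * iexp (x + y) + (iexp (- c) / 2) * iexp (- x + y)" for x y z :: real
        unfolding cis_conv_exp[symmetric] by (simp add: complex_eq_iff cos_add sin_add cos_diff sin_diff field_simps)
      have "(CLINT \<omega>|M. (2 + cos (s * U n \<omega> + c)) *\<^sub>R iexp (t * V n \<omega>))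
        = 2 * E 0 t n
          + (iexp c / 2) * E s t n
          + (iexp (- c) / 2) * E (- s) t n" for n
      proof -
        have i: "integrable M (\<lambda>\<omega>. iexp (0 * U n \<omega> + t * V n \<omega>))"
          "integrable M (\<lambda>\<omega>. iexp (s * U n \<omega> + t * V n \<omega>))"
          "integrable M (\<lambda>\<omega>. iexp ((-s) * U n \<omega> + t * V n \<omega>))"
          by (intro integrable_const_bound[of _ 1]; simp)+
        have "(2 + cos (s * U n \<omega> + c)) *\<^sub>R iexp (t * V n \<omega>) = 2 * iexp (0 * U n \<omega> + t * V n \<omega>)
          + (iexp c / 2) * iexp (s * U n \<omega> + t * V n \<omega>) + (iexp (- c) / 2) * iexp ((-s) * U n \<omega> + t * V n \<omega>)" for \<omega>
          using pt[of "s * U n \<omega>" "t * V n \<omega>" "U n \<omega>"] by simp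
        thus ?thesis
          unfolding E_def using i by (simp only: Bochner_Integration.integral_add Bochner_Integration.integral_mult_right_zero
            Bochner_Integration.integrable_add integrable_mult_right)
      qed
      moreover have "(\<lambda>n. 2 * E 0 t n
          + (iexp c / 2) * E s t n
          + (iexp (- c) / 2) * E (- s) t n)
        \<longlonglongrightarrow> 2 * (char N 0 * char N' t) + (iexp c / 2) * (char N s * char N' t)
          + (iexp (- c) / 2) * (char N (- s) * char N' t)"
        by (intro tendsto_intros char)
      moreover have "2 * (char N 0 * char N' t) + (iexp c / 2) * (char N s * char N' t)
          + (iexp (- c) / 2) * (char N (- s) * char N' t) = W *\<^sub>R char N' t"
        unfolding scaleR_conv_of_real W_eq by (simp add: N.char_zero field_simps)
      ultimately show ?thesis by simp
    qed
    show ?thesis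
      unfolding W_def[symmetric]
    proof (rule weighted_levy_continuity[where a=1 and b=3, OF _ V _ _ _ N' _ * g])
      show "1 \<le> 2 + cos (s * U n \<omega> + c)" "2 + cos (s * U n \<omega> + c) \<le> 3" for n \<omega>
        using cos_ge_minus_one[of "s * U n \<omega> + c"] cos_le_one[of "s * U n \<omega> + c"] by linarith+
      have "(CLINT \<omega>|M. (2 + cos (s * U n \<omega> + c)) *\<^sub>R iexp (0 * V n \<omega>)) =
         complex_of_real (expectation (\<lambda>\<omega>. 2 + cos (s * U n \<omega> + c)))" for n
        by (simp flip: integral_complex_of_real add: scaleR_conv_of_real)
      with *[of 0] have "(\<lambda>n. complex_of_real (expectation (\<lambda>\<omega>. 2 + cos (s * U n \<omega> + c)))) \<longlonglongrightarrow> complex_of_real W"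
        by (simp add: N'.char_zero scaleR_conv_of_real)
      thus "(\<lambda>n. expectation (\<lambda>\<omega>. 2 + cos (s * U n \<omega> + c))) \<longlonglongrightarrow> W"
        by (simp only: tendsto_of_real_iff)
    qed auto
  qed
  have g_int: "integrable M (\<lambda>\<omega>. g (V n \<omega>))" and fg_int: "integrable M (\<lambda>\<omega>. f (U n \<omega>) * g (V n \<omega>))"
    and f_int: "integrable M (\<lambda>\<omega>. f (U n \<omega>))" for n
  proof -
    show "integrable M (\<lambda>\<omega>. g (V n \<omega>))" "integrable M (\<lambda>\<omega>. f (U n \<omega>))"
      using f(2) g(2) by (intro integrable_const_bound[of _ B]; simp)+
    show "integrable M (\<lambda>\<omega>. f (U n \<omega>) * g (V n \<omega>))"
      using mult_mono[OF f(2) g(2) B]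
      by (intro integrable_const_bound[of _ "B * B"]) (simp_all add: abs_mult)
  qed
  have cg_int: "integrable M (\<lambda>\<omega>. cos (s * U n \<omega> + c) * g (V n \<omega>))" for n s c
    using g(2) mult_mono[OF abs_cos_le_one g(2)]
    by (intro integrable_const_bound[of _ B]) (auto simp: abs_mult)
  define I where "I = (\<integral>x. g x \<partial>N')"
  define I' where "I' = I + (B + 1)"
  define g' where "g' x = g x + (B + 1)" for x
  \<comment> \<open>At \<open>s = c = 0\<close> the weight is the constant 3, hence the factor
    \<open>1/3\<close>.\<close>
  have g_lim: "(\<lambda>n. expectation (\<lambda>\<omega>. g (V n \<omega>))) \<longlonglongrightarrow> I"
    using tendsto_mult[OF tendsto_const[of "1/3"] cos_weight[of 0 0]]
    by (simp add: I_def N.char_zero)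
  have g'_lim: "(\<lambda>n. expectation (\<lambda>\<omega>. g' (V n \<omega>))) \<longlonglongrightarrow> I'"
    using tendsto_add[OF g_lim tendsto_const[of "B+1"]] by (simp add: I'_def g'_def g_int prob_space)
  have cos_lim: "(\<lambda>n. expectation (\<lambda>\<omega>. cos (s * U n \<omega> + c) * g (V n \<omega>))) \<longlonglongrightarrow> Re (cis c * char N s) * I" for s c
    using tendsto_diff[OF cos_weight[of s c] tendsto_mult[OF tendsto_const[of 2] g_lim]]
    by (simp add: I_def[symmetric] distrib_right g_int cg_int)
  have iexp_lim: "(\<lambda>n. CLINT \<omega>|M. g (V n \<omega>) *\<^sub>R iexp (s * U n \<omega>)) \<longlonglongrightarrow> I *\<^sub>R char N s" for s
  proof -
    \<comment> \<open>The phase \<open>- pi/2\<close> turns the cosine into a sine.\<close>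
    have pt: "g (V n \<omega>) *\<^sub>R iexp (s * U n \<omega>) = 
      complex_of_real (cos (s * U n \<omega> + 0) * g (V n \<omega>)) + \<i> * complex_of_real (cos (s * U n \<omega> + (- pi/2)) * g (V n \<omega>))" for n \<omega>
      unfolding cis_conv_exp[symmetric] by (simp add: complex_eq_iff cos_add cos_diff)
    have eq: "(CLINT \<omega>|M. g (V n \<omega>) *\<^sub>R iexp (s * U n \<omega>)) =
      complex_of_real (expectation (\<lambda>\<omega>. cos (s * U n \<omega> + 0) * g (V n \<omega>))) + \<i> * complex_of_real (expectation (\<lambda>\<omega>. cos (s * U n \<omega> + (- pi/2)) * g (V n \<omega>)))" for n
      unfolding pt using cg_int[of s n 0] cg_int[of s n "-pi/2"]
      by (subst Bochner_Integration.integral_add) (auto simp: integral_complex_of_real simp del: of_real_mult)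
    have "(\<lambda>n. CLINT \<omega>|M. g (V n \<omega>) *\<^sub>R iexp (s * U n \<omega>)) \<longlonglongrightarrow>
       complex_of_real (Re (cis 0 * char N s) * I) + \<i> * complex_of_real (Re (cis (- pi/2) * char N s) * I)"
      unfolding eq by (intro tendsto_intros cos_lim)
    also have "complex_of_real (Re (cis 0 * char N s) * I) + \<i> * complex_of_real (Re (cis (- pi/2) * char N s) * I) = I *\<^sub>R char N s"
      unfolding cis_conv_exp[symmetric] by (simp add: complex_eq_iff)
    finally show ?thesis .
  qed
  have f_lim: "(\<lambda>n. expectation (\<lambda>\<omega>. g' (V n \<omega>) * f (U n \<omega>))) \<longlonglongrightarrow> I' * (\<integral>x. f x \<partial>N)"
  proof (rule weighted_levy_continuity[where a=1 and b="2 * B + 1", OF _ U _ _ _ N g'_lim _ f])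
    show "1 \<le> g' (V n \<omega>)" "g' (V n \<omega>) \<le> 2 * B + 1" for n \<omega>
      using g(2)[of "V n \<omega>"] by (auto simp: g'_def)
    show "(\<lambda>\<omega>. g' (V n \<omega>)) \<in> borel_measurable M" for n
      unfolding g'_def by simp
    show "(\<lambda>n. CLINT \<omega>|M. g' (V n \<omega>) *\<^sub>R iexp (t * U n \<omega>)) \<longlonglongrightarrow> I' *\<^sub>R char N t" for t
    proof -
      have gi: "integrable M (\<lambda>\<omega>. g (V n \<omega>) *\<^sub>R iexp (t * U n \<omega>))" for n
        using g(2) by (intro integrable_const_bound[of _ B]) auto
      have "(CLINT \<omega>|M. g' (V n \<omega>) *\<^sub>R iexp (t * U n \<omega>)) = (CLINT \<omega>|M. g (V n \<omega>) *\<^sub>R iexp (t * U n \<omega>))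
         + (B + 1) *\<^sub>R E t 0 n" for n
        unfolding g'_def scaleR_add_left E_def
        using gi iexp_int[of "\<lambda>n \<omega>. t * U n \<omega>" n] by (subst Bochner_Integration.integral_add) auto
      moreover have "(\<lambda>n. (CLINT \<omega>|M. g (V n \<omega>) *\<^sub>R iexp (t * U n \<omega>))
         + (B + 1) *\<^sub>R E t 0 n) \<longlonglongrightarrow> I *\<^sub>R char N t + (B + 1) *\<^sub>R (char N t * char N' 0)"
        by (intro tendsto_intros iexp_lim char)
      ultimately show ?thesis
        by (simp add: N'.char_zero I'_def algebra_simps)
    qed
  qed simp
  \<comment> \<open>The constant weight 1 gives the limit of the mean of \<open>f (U n)\<close>,
    which then undoes the shift of \<open>g\<close> by \<open>B + 1\<close>.\<close>
  have f0: "(\<lambda>n. expectation (\<lambda>\<omega>. 1 * f (U n \<omega>))) \<longlonglongrightarrow> 1 * (\<integral>x. f x \<partial>N)"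
  proof (rule weighted_levy_continuity[where a=1 and b=1, OF _ U _ _ _ N _ _ f])
    show "(\<lambda>n. CLINT \<omega>|M. 1 *\<^sub>R iexp (t * U n \<omega>)) \<longlonglongrightarrow> 1 *\<^sub>R char N t" for t
      using char[of t 0] by (simp add: E_def[abs_def] N'.char_zero)
  qed (auto simp: prob_space)
  have "(\<lambda>n. expectation (\<lambda>\<omega>. g' (V n \<omega>) * f (U n \<omega>)) - (B + 1) * expectation (\<lambda>\<omega>. 1 * f (U n \<omega>)))
     \<longlonglongrightarrow> I' * (\<integral>x. f x \<partial>N) - (B + 1) * (1 * (\<integral>x. f x \<partial>N))"
    by (intro tendsto_intros f_lim f0)
  moreover have "expectation (\<lambda>\<omega>. g' (V n \<omega>) * f (U n \<omega>)) - (B + 1) * expectation (\<lambda>\<omega>. 1 * f (U n \<omega>))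
     = expectation (\<lambda>\<omega>. f (U n \<omega>) * g (V n \<omega>))" for n
  proof -
    have "g' (V n \<omega>) * f (U n \<omega>) = f (U n \<omega>) * g (V n \<omega>) + (B + 1) * f (U n \<omega>)" for \<omega>
      by (simp add: g'_def algebra_simps)
    thus ?thesis
      using fg_int[of n] f_int[of n] by simp
  qed
  ultimately show ?thesis
    by (simp add: I'_def I_def algebra_simps)
qed

section \<open>Reduction to products of functions of one coordinate\<close>

text \<open>Scalars are absorbed into a factor, so sums of products already form an algebra
  containing the polynomials.\<close>

inductive tensor_sum :: "(real ^ 2 \<Rightarrow> real) \<Rightarrow> bool" where
  tensor: "continuous_on UNIV f \<Longrightarrow> continuous_on UNIV g \<Longrightarrow> tensor_sum (\<lambda>z. f (z $ 1) * g (z $ 2))"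
| add: "tensor_sum p \<Longrightarrow> tensor_sum q \<Longrightarrow> tensor_sum (\<lambda>z. p z + q z)"

lemma tensor_sum_mult: "tensor_sum p \<Longrightarrow> tensor_sum q \<Longrightarrow> tensor_sum (\<lambda>z. p z * q z)"
proof (induction rule: tensor_sum.induct)
  case (tensor f g)
  from tensor(3) show ?case
  proof (induction rule: tensor_sum.induct)
    case (tensor f' g')
    have "tensor_sum (\<lambda>z. (f (z$1) * f' (z$1)) * (g (z$2) * g' (z$2)))"
      using \<open>continuous_on UNIV f\<close> \<open>continuous_on UNIV g\<close> tensor
      by (intro tensor_sum.tensor) (auto intro: continuous_intros)
    thus ?case by (simp add: mult_ac)
  next
    case (add p q)
    thus ?case using tensor_sum.add by (simp add: distrib_left)
  qed
next
  case (add p q)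
  thus ?case using tensor_sum.add by (simp add: distrib_right)
qed

lemma real_polynomial_function_tensor_sum:
  "real_polynomial_function p \<Longrightarrow> tensor_sum p"
proof (induction rule: real_polynomial_function.induct)
  case (linear f)
  interpret f: bounded_linear f by (rule linear)
  have "f = (\<lambda>z. (f (axis 1 1) * z $ 1) * 1 + 1 * (f (axis 2 1) * z $ 2))"
  proof
    fix z
    have "f z = f (z $ 1 *\<^sub>R axis 1 1 + z $ 2 *\<^sub>R axis 2 1)"
      by (rule arg_cong[where f=f]) (simp add: vec_eq_iff forall_2 axis_def)
    thus "f z = (f (axis 1 1) * z $ 1) * 1 + 1 * (f (axis 2 1) * z $ 2)"
      by (simp add: f.add f.scaleR mult.commute)
  qed
  moreover have "tensor_sum (\<lambda>z. (f (axis 1 1) * z $ 1) * 1 + 1 * (f (axis 2 1) * z $ 2))"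
    using tensor_sum.add[OF tensor_sum.tensor[of "\<lambda>x. f (axis 1 1) * x" "\<lambda>_. 1"]
        tensor_sum.tensor[of "\<lambda>_. 1" "\<lambda>x. f (axis 2 1) * x"]]
    by simp
  ultimately show ?case by (rule ssubst[of f _ tensor_sum])
next
  case (const c)
  show ?case
    using tensor_sum.tensor[of "\<lambda>_. c" "\<lambda>_. 1"] by simp
next
  case (add p q)
  thus ?case by (intro tensor_sum.add)
next
  case (mult p q)
  thus ?case by (intro tensor_sum_mult)
qed

text \<open>Stone-Weierstrass needs a compact set, so \<open>F\<close> is first multiplied by a
  cutoff that is itself a product over the coordinates; a polynomial times the cutoff is then a sum
  of bounded products. Tightness is derived: convergence for the cutoff itself bounds the mass that
  \<open>L n\<close> has outside a square.\<close>

lemma weak_conv_borelI_product: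
  fixes L :: "nat \<Rightarrow> (real ^ 2) measure" and G :: "(real ^ 2) measure"
  assumes L: "\<And>n. prob_space (L n)" "\<And>n. sets (L n) = sets borel"
    and G: "prob_space G" "sets G = sets borel"
    and conv: "\<And>(f :: real \<Rightarrow> real) (g :: real \<Rightarrow> real) B. continuous_on UNIV f \<Longrightarrow> continuous_on UNIV g \<Longrightarrow>
      (\<And>x::real. \<bar>f x\<bar> \<le> B) \<Longrightarrow> (\<And>x. \<bar>g x\<bar> \<le> B) \<Longrightarrow>
      (\<lambda>n. \<integral>z. f (z $ 1) * g (z $ 2) \<partial>L n) \<longlonglongrightarrow> (\<integral>z. f (z $ 1) * g (z $ 2) \<partial>G)"
  shows "weak_conv_borel L G"
  unfolding weak_conv_borel_def
proof (intro allI impI, elim conjE)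
  fix F :: "real ^ 2 \<Rightarrow> real"
  assume F: "continuous_on UNIV F" and "bounded (range F)"
  then obtain B where B: "B > 0" "\<And>z. \<bar>F z\<bar> \<le> B"
    unfolding bounded_pos by auto
  \<comment> \<open>For \<open>R \<ge> 0\<close> a piecewise linear cutoff, equal to 1 up to
    \<open>R\<close> and to 0 from \<open>R + 1\<close> on.\<close>
  define chi :: "real \<Rightarrow> real \<Rightarrow> real" where "chi R x = max 0 (min 1 (R + 1 - \<bar>x\<bar>))" for R x
  define th :: "real \<Rightarrow> real ^ 2 \<Rightarrow> real" where "th R z = chi R (z $ 1) * chi R (z $ 2)" for R z
  have chi_cont: "continuous_on A (chi R)" for R A
    unfolding chi_def by (intro continuous_intros)
  have chi_bd: "0 \<le> chi R x" "chi R x \<le> 1" for R x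
    by (auto simp: chi_def)
  have th_bd: "0 \<le> th R z" "th R z \<le> 1" for R z
    unfolding th_def using chi_bd by (auto intro: mult_le_one)
  have th_cont: "continuous_on A (th R)" for R A
    unfolding th_def chi_def by (intro continuous_intros)
  have int: "integrable K h" if "prob_space K" "sets K = sets borel" "continuous_on UNIV h" "\<And>z. \<bar>h z\<bar> \<le> C"
    for h :: "real ^ 2 \<Rightarrow> real" and C K
  proof -
    interpret prob_space K by fact
    have "h \<in> borel_measurable K"
      using borel_measurable_continuous_onI[OF that(3)] measurable_cong_sets[OF that(2) refl] by blast
    thus ?thesis using that(4) by (intro integrable_const_bound[of _ C]) auto
  qed
  have th_int: "integrable K (th R)" if "prob_space K" "sets K = sets borel" for K R
    using th_bd th_cont by (intro int[OF that, of _ 1]) auto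
  have pconv: "(\<lambda>n. \<integral>z. p z * th R z \<partial>L n) \<longlonglongrightarrow> (\<integral>z. p z * th R z \<partial>G)"
    and pbd: "continuous_on UNIV p \<and> (\<exists>C. \<forall>z. \<bar>p z * th R z\<bar> \<le> C)" if "tensor_sum p" for p R
  proof -
    have "continuous_on UNIV p \<and> (\<exists>C. \<forall>z. \<bar>p z * th R z\<bar> \<le> C) \<and>
      (\<lambda>n. \<integral>z. p z * th R z \<partial>L n) \<longlonglongrightarrow> (\<integral>z. p z * th R z \<partial>G)"
      using that
    proof (induction rule: tensor_sum.induct)
      case (tensor f g)
      have comp: "continuous_on UNIV (\<lambda>z::real^2. h (z $ i))" if "continuous_on UNIV h" for h :: "real \<Rightarrow> real" and i
        by (intro continuous_on_compose2[OF that] continuous_intros) auto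
      have bdd: "\<exists>C. \<forall>x. \<bar>h x * chi R x\<bar> \<le> C" if h: "continuous_on UNIV h" for h :: "real \<Rightarrow> real"
      proof -
        have "compact (h ` {- (\<bar>R\<bar> + 1)..\<bar>R\<bar> + 1})"
          by (intro compact_continuous_image continuous_on_subset[OF h]) auto
        then obtain C where C: "\<And>x. \<bar>x\<bar> \<le> \<bar>R\<bar> + 1 \<Longrightarrow> \<bar>h x\<bar> \<le> C" "C > 0"
          using compact_imp_bounded bounded_pos by (metis abs_le_iff atLeastAtMost_iff imageI minus_le_iff real_norm_def)
        have "\<bar>h x * chi R x\<bar> \<le> C" for x
        proof (cases "\<bar>x\<bar> \<le> \<bar>R\<bar> + 1")
          case True
          thus ?thesis using mult_mono[OF C(1)[OF True] chi_bd(2)[of R x]] C(2) chi_bd(1)[of R x]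
            by (simp add: abs_mult)
        next
          case False
          hence "chi R x = 0" by (auto simp: chi_def)
          thus ?thesis using C(2) by simp
        qed
        thus ?thesis by blast
      qed
      from bdd[OF tensor(1)] bdd[OF tensor(2)] obtain C1 C2
        where C: "\<And>x. \<bar>f x * chi R x\<bar> \<le> C1" "\<And>x. \<bar>g x * chi R x\<bar> \<le> C2" by metis
      have eq: "f (z$1) * g (z$2) * th R z = (f (z$1) * chi R (z$1)) * (g (z$2) * chi R (z$2))" for z
        by (simp add: th_def)
      have "(\<lambda>n. \<integral>z. f (z$1) * g (z$2) * th R z \<partial>L n) \<longlonglongrightarrow> (\<integral>z. f (z$1) * g (z$2) * th R z \<partial>G)"
        unfolding eq using tensor C chi_cont
        by (intro conv[of "\<lambda>x. f x * chi R x" "\<lambda>x. g x * chi R x" "max C1 C2"])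
           (auto intro: continuous_intros simp: le_max_iff_disj)
      moreover have "\<bar>f (z$1) * g (z$2) * th R z\<bar> \<le> C1 * C2" for z
        unfolding eq by (subst abs_mult, intro mult_mono C) (auto intro: order_trans[OF _ C(1)])
      moreover have "continuous_on UNIV (\<lambda>z::real^2. f (z$1) * g (z$2))"
        by (rule continuous_on_mult[OF comp[OF tensor(1)] comp[OF tensor(2)]])
      ultimately show ?case by blast
    next
      case (add p q)
      then obtain C1 C2 where C: "\<And>z. \<bar>p z * th R z\<bar> \<le> C1" "\<And>z. \<bar>q z * th R z\<bar> \<le> C2" by auto
      have pc: "continuous_on UNIV p" "continuous_on UNIV q" using add.IH by auto
      have ii: "integrable K (\<lambda>z. p z * th R z)" "integrable K (\<lambda>z. q z * th R z)"
        if "prob_space K" "sets K = sets borel" for K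
        by (rule int[OF that continuous_on_mult[OF pc(1) th_cont] C(1)]
              int[OF that continuous_on_mult[OF pc(2) th_cont] C(2)])+
      have "\<bar>(p z + q z) * th R z\<bar> \<le> C1 + C2" for z
        using C[of z] unfolding distrib_right by linarith
      moreover have "(\<lambda>n. \<integral>z. (p z + q z) * th R z \<partial>L n) \<longlonglongrightarrow> (\<integral>z. (p z + q z) * th R z \<partial>G)"
        unfolding distrib_right Bochner_Integration.integral_add[OF ii[OF L]] Bochner_Integration.integral_add[OF ii[OF G]]
        using add.IH by (intro tendsto_add) auto
      moreover have "continuous_on UNIV (\<lambda>z. p z + q z)"
        using pc by (rule continuous_on_add)
      ultimately show ?case by blast
    qed
    thus "(\<lambda>n. \<integral>z. p z * th R z \<partial>L n) \<longlonglongrightarrow> (\<integral>z. p z * th R z \<partial>G)"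
      "continuous_on UNIV p \<and> (\<exists>C. \<forall>z. \<bar>p z * th R z\<bar> \<le> C)" by auto
  qed
  show "(\<lambda>n. \<integral>z. F z \<partial>L n) \<longlonglongrightarrow> (\<integral>z. F z \<partial>G)"
  proof (rule LIMSEQ_I)
    fix e :: real assume "e > 0"
    \<comment> \<open>The final error is \<open>3 * d + 2 * (B * d)\<close>: one approximation error
      for each law, one for the polynomial integrals, and two tails weighted by
      \<open>B\<close>.\<close>
    define d where "d = e / (4 * B + 4)"
    have d: "d > 0" using \<open>e > 0\<close> B by (simp add: d_def)
    have "(\<lambda>n. \<integral>z. th (real n) z \<partial>G) \<longlonglongrightarrow> (\<integral>z. 1 \<partial>G)"
    proof (rule integral_dominated_convergence[where w="\<lambda>_. 1"])
      interpret G: prob_space G by (rule G)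
      show "integrable G (\<lambda>_. 1::real)" by simp
      have "(\<lambda>n. chi (real n) x) \<longlonglongrightarrow> 1" for x
      proof (rule tendsto_eventually)
        have "\<forall>\<^sub>F n in sequentially. \<bar>x\<bar> \<le> real n"
          using filterlim_real_sequentially unfolding filterlim_at_top by blast
        thus "\<forall>\<^sub>F n in sequentially. chi (real n) x = 1"
          by eventually_elim (simp add: chi_def)
      qed
      hence "(\<lambda>n. th (real n) z) \<longlonglongrightarrow> 1 * 1" for z
        unfolding th_def by (intro tendsto_mult)
      thus "AE z in G. (\<lambda>n. th (real n) z) \<longlonglongrightarrow> 1" by simp
      show "th (real n) \<in> borel_measurable G" for n
        using th_int[OF G] by (rule borel_measurable_integrable)
    qed (use th_bd in auto)
    hence "\<forall>\<^sub>F n in sequentially. (\<integral>z. th (real n) z \<partial>G) > 1 - d"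
      using d prob_space.prob_space[OF G(1)] by (intro order_tendstoD(1)) auto
    then obtain R where R: "(\<integral>z. th R z \<partial>G) > 1 - d"
      by (metis eventually_sequentially order_refl)
    \<comment> \<open>The sign of \<open>R\<close> is not recorded; with
      \<open>\<bar>R\<bar>\<close> the square contains the support of the cutoff in any
      case.\<close>
    define S where "S = {z :: real ^ 2. \<forall>i. \<bar>z $ i\<bar> \<le> \<bar>R\<bar> + 1}"
    have S_eq: "S = cbox (\<chi> i. - (\<bar>R\<bar> + 1)) (\<chi> i. \<bar>R\<bar> + 1)"
    proof -
      have "\<bar>x\<bar> \<le> \<bar>R\<bar> + 1 \<longleftrightarrow> - (\<bar>R\<bar> + 1) \<le> x \<and> x \<le> \<bar>R\<bar> + 1" for x :: real
        by linarith
      thus ?thesis by (simp add: S_def set_eq_iff mem_box_cart)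
    qed
    have "compact S" unfolding S_eq by (rule compact_cbox)
    then obtain p where p: "real_polynomial_function p" "\<And>z. z \<in> S \<Longrightarrow> \<bar>F z - p z\<bar> < d"
      using Stone_Weierstrass_real_polynomial_function[OF _ continuous_on_subset[OF F subset_UNIV] d] by metis
    note p_t = real_polynomial_function_tensor_sum[OF p(1)]
    have Fp: "\<bar>F z * th R z - p z * th R z\<bar> \<le> d" for z
    proof (cases "z \<in> S")
      case True
      have "\<bar>F z * th R z - p z * th R z\<bar> = \<bar>F z - p z\<bar> * th R z"
        using th_bd(1)[of R z] by (simp add: abs_mult flip: left_diff_distrib)
      also have "\<dots> \<le> d * 1" using p(2)[OF True] th_bd[of R z] by (intro mult_mono) auto
      finally show ?thesis by simp
    next
      case False
      hence "th R z = 0" by (auto simp: S_def th_def chi_def forall_2)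
      thus ?thesis using d by simp
    qed
    have est: "\<bar>(\<integral>z. F z \<partial>K) - (\<integral>z. p z * th R z \<partial>K)\<bar> \<le> d + B * (1 - (\<integral>z. th R z \<partial>K))"
      if K: "prob_space K" "sets K = sets borel" for K
    proof -
      interpret K: prob_space K by fact
      note [simp] = th_int[OF K, of R]
      have FI: "integrable K F" using F B by (intro int[OF K])
      have pI: "integrable K (\<lambda>z. p z * th R z)"
      proof -
        obtain C where "continuous_on UNIV p" "\<And>z. \<bar>p z * th R z\<bar> \<le> C"
          using pbd[OF p_t, of R] by auto
        thus ?thesis by (intro int[OF K, of _ C] continuous_on_mult th_cont)
      qed
      have "\<bar>F z - p z * th R z\<bar> \<le> d + B * (1 - th R z)" for z
      proof -
        have "F z - p z * th R z = (F z * th R z - p z * th R z) + F z * (1 - th R z)"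
          by (simp add: algebra_simps)
        moreover have "\<bar>F z * (1 - th R z)\<bar> \<le> B * (1 - th R z)"
          using B(2)[of z] th_bd[of R z] by (simp add: abs_mult mult_right_mono)
        ultimately show ?thesis using Fp[of z] by linarith
      qed
      hence "\<bar>\<integral>z. F z - p z * th R z \<partial>K\<bar> \<le> (\<integral>z. d + B * (1 - th R z) \<partial>K)"
        using FI pI by (intro order_trans[OF integral_abs_bound] integral_mono) auto
      thus ?thesis using FI pI by (simp add: K.prob_space)
    qed
    have "\<forall>\<^sub>F n in sequentially. \<bar>(\<integral>z. p z * th R z \<partial>L n) - (\<integral>z. p z * th R z \<partial>G)\<bar> < d"
      using tendstoD[OF pconv[OF p_t, of R] d] by (simp add: dist_real_def)
    moreover have "(\<lambda>n. \<integral>z. th R z \<partial>L n) \<longlonglongrightarrow> (\<integral>z. th R z \<partial>G)"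
      unfolding th_def using chi_bd by (intro conv[of _ _ 1] chi_cont) auto
    hence "\<forall>\<^sub>F n in sequentially. (\<integral>z. th R z \<partial>L n) > 1 - d"
      using R by (intro order_tendstoD(1)) auto
    ultimately have "\<forall>\<^sub>F n in sequentially. \<bar>(\<integral>z. F z \<partial>L n) - (\<integral>z. F z \<partial>G)\<bar> < e"
    proof eventually_elim
      case (elim n)
      have "B * (1 - (\<integral>z. th R z \<partial>L n)) \<le> B * d" "B * (1 - (\<integral>z. th R z \<partial>G)) \<le> B * d"
        using elim R B by (auto intro!: mult_left_mono)
      hence "\<bar>(\<integral>z. F z \<partial>L n) - (\<integral>z. F z \<partial>G)\<bar> < 3 * d + 2 * (B * d)"
        using est[OF L, of n] est[OF G] elim(1) by linarith
      also have "\<dots> \<le> (4 * B + 4) * d" using B d by (simp add: algebra_simps)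
      also have "\<dots> = e" using B by (simp add: d_def)
      finally show ?case .
    qed
    thus "\<exists>no. \<forall>n\<ge>no. norm ((\<integral>z. F z \<partial>L n) - (\<integral>z. F z \<partial>G)) < e"
      by (simp add: eventually_sequentially)
  qed
qed

section \<open>The standard normal distribution on the plane\<close>

lemma Basis_real2: "Basis = {axis 1 1, axis 2 1 :: real ^ 2}"
  by (auto simp: Basis_vec_def UNIV_2)

lemma axis_1_neq_axis_2: "axis 1 1 \<noteq> (axis 2 1 :: real ^ 2)"
  by (simp add: axis_eq_axis)

text \<open>\<open>lborel\<close> on a Euclidean space is the image of a product measure indexed by
  \<open>Basis\<close>, so Fubini takes the form of a product over the two axes.\<close>

lemma integral_lborel_real2_product:
  fixes F G :: "real \<Rightarrow> real"
  assumes F: "integrable lborel F" and G: "integrable lborel G"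
  shows "(\<integral>z. F (z $ 1) * G (z $ 2) \<partial>(lborel :: (real ^ 2) measure)) = (\<integral>x. F x \<partial>lborel) * (\<integral>x. G x \<partial>lborel)"
proof -
  interpret product_sigma_finite "\<lambda>_::real^2. lborel :: real measure" ..
  have [measurable]: "F \<in> borel_measurable borel" "G \<in> borel_measurable borel"
    using assms by (auto dest: borel_measurable_integrable)
  define h where "h b = (if b = axis 1 1 then F else G)" for b :: "real ^ 2"
  have "(\<integral>z. F (z $ 1) * G (z $ 2) \<partial>(lborel :: (real ^ 2) measure)) =
    (\<integral>x. F ((\<Sum>b\<in>Basis. x b *\<^sub>R b) $ 1) * G ((\<Sum>b\<in>Basis. x b *\<^sub>R b :: real ^ 2) $ 2) \<partial>Pi\<^sub>M Basis (\<lambda>_. lborel))"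
    by (subst lborel_eq, subst integral_distr) auto
  also have "\<dots> = (\<integral>x. (\<Prod>b\<in>Basis. h b (x b)) \<partial>Pi\<^sub>M Basis (\<lambda>_::real^2. lborel))"
  proof -
    have "(axis 1 1 :: real ^ 2) $ 1 = 1" "(axis 1 1 :: real ^ 2) $ 2 = 0"
      "(axis 2 1 :: real ^ 2) $ 1 = 0" "(axis 2 1 :: real ^ 2) $ 2 = 1"
      by (simp_all add: axis_def)
    thus ?thesis
      using axis_1_neq_axis_2 by (simp add: Basis_real2 h_def axis_1_neq_axis_2[symmetric])
  qed
  also have "\<dots> = (\<Prod>b\<in>Basis. integral\<^sup>L lborel (h b))"
    using assms by (intro product_integral_prod) (auto simp: h_def)
  also have "\<dots> = (\<integral>x. F x \<partial>lborel) * (\<integral>x. G x \<partial>lborel)"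
    using axis_1_neq_axis_2 by (simp add: Basis_real2 h_def axis_1_neq_axis_2[symmetric])
  finally show ?thesis .
qed

abbreviation std_normal2 :: "(real ^ 2) measure" where
  "std_normal2 \<equiv> multivariate_normal (vector [0, 0]) (vector [vector [1, 0], vector [0, 1]])"

lemma std_normal2_eq: "std_normal2 = density lborel (\<lambda>z. ennreal (1 / (2 * pi) * exp (- (z \<bullet> z) / 2)))"
proof -
  have *: "vector [0, 0] = (0 :: real ^ 2)" "vector [vector [1, 0], vector [0, 1]] = (mat 1 :: real ^ 2 ^ 2)"
    by (simp_all add: vec_eq_iff forall_2 mat_def)
  have "matrix_inv (mat 1 :: real ^ 2 ^ 2) = mat 1"
    unfolding matrix_inv_def by (rule someI2[where a="mat 1"]) auto
  thus ?thesis
    unfolding multivariate_normal_def * by (simp add: power2_eq_square real_sqrt_mult)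
qed

lemma sets_std_normal2: "sets std_normal2 = sets borel"
  by (simp add: std_normal2_eq)

lemma integral_std_normal2_product:
  fixes f g :: "real \<Rightarrow> real"
  assumes f[measurable]: "f \<in> borel_measurable borel" "\<And>x. \<bar>f x\<bar> \<le> B"
    and g[measurable]: "g \<in> borel_measurable borel" "\<And>x. \<bar>g x\<bar> \<le> B"
  shows "(\<integral>z. f (z $ 1) * g (z $ 2) \<partial>std_normal2) =
    (\<integral>x. f x \<partial>std_normal_distribution) * (\<integral>x. g x \<partial>std_normal_distribution)"
proof -
  have int: "integrable lborel (\<lambda>x. std_normal_density x * h x)"
    if [measurable]: "h \<in> borel_measurable borel" and "\<And>x. \<bar>h x\<bar> \<le> B" for h :: "real \<Rightarrow> real"
  proof (rule Bochner_Integration.integrable_bound)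
    show "integrable lborel (\<lambda>x. B * std_normal_density x)"
      by (intro integrable_mult_right integrable_normal_density) simp
    show "AE x in lborel. norm (std_normal_density x * h x) \<le> norm (B * std_normal_density x)"
      using that(2) order_trans[OF abs_ge_zero that(2)]
      by (auto simp: abs_mult mult.commute intro!: mult_right_mono)
  qed simp
  have dens: "1 / (2 * pi) * exp (- (z \<bullet> z) / 2) * (f (z $ 1) * g (z $ 2)) =
      (std_normal_density (z $ 1) * f (z $ 1)) * (std_normal_density (z $ 2) * g (z $ 2))" for z :: "real ^ 2"
    by (simp add: std_normal_density_def inner_vec_def sum_2 exp_add[symmetric] power2_eq_square field_simps
        real_sqrt_mult)
  have dist: "(\<integral>x. h x \<partial>std_normal_distribution) = (\<integral>x. std_normal_density x * h x \<partial>lborel)"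
    if [measurable]: "h \<in> borel_measurable borel" for h :: "real \<Rightarrow> real"
    by (subst integral_density) auto
  have "(\<integral>z. f (z $ 1) * g (z $ 2) \<partial>std_normal2) =
     (\<integral>z. 1 / (2 * pi) * exp (- (z \<bullet> z) / 2) * (f (z $ 1) * g (z $ 2)) \<partial>(lborel :: (real ^ 2) measure))"
    unfolding std_normal2_eq by (subst integral_density) auto
  also have "\<dots> = (\<integral>x. std_normal_density x * f x \<partial>lborel) * (\<integral>x. std_normal_density x * g x \<partial>lborel)"
    unfolding dens by (rule integral_lborel_real2_product) (intro int assms)+
  finally show ?thesis by (simp add: dist)
qed

lemma prob_space_std_normal2: "prob_space std_normal2"
proof
  interpret N: prob_space std_normal_distribution
    by (rule prob_space_normal_density) simp
  have "measure std_normal2 UNIV = measure std_normal_distribution UNIV * measure std_normal_distribution UNIV"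
    using integral_std_normal2_product[of "\<lambda>_. 1" 1 "\<lambda>_. 1"] by (simp add: std_normal2_eq)
  also have "measure std_normal_distribution UNIV = 1"
    using N.prob_space by simp
  finally have "measure std_normal2 UNIV = 1" by simp
  \<comment> \<open>\<open>measure\<close> assigns 0 to infinite mass, so the value 1 rules infinity
    out.\<close>
  moreover from this have "emeasure std_normal2 UNIV \<noteq> \<infinity>"
    by (auto simp: measure_def)
  ultimately show "emeasure std_normal2 (space std_normal2) = 1"
    by (simp add: emeasure_eq_ennreal_measure std_normal2_eq)
qed

section \<open>The squared norm and the chi-square law\<close>

text \<open>The disc of squared radius \<open>x\<close> has area \<open>pi * x\<close>, linear in
  \<open>x\<close>. The rays \<open>{..x}\<close> generate the Borel sets, so this replaces a
  passage to polar coordinates.\<close>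

lemma distr_lborel_norm_square:
  "distr (lborel :: (real ^ 2) measure) borel (\<lambda>z. z \<bullet> z) = density lborel (\<lambda>u. ennreal (pi * indicator {0..} u))"
  (is "?L = ?R")
proof (rule measure_eqI_generator_eq[where E="range (\<lambda>x::real. {..x})" and \<Omega>=UNIV and A="\<lambda>i::nat. {..real i}"])
  have D: "emeasure ?L {..x} = ennreal (pi * max 0 x)" for x
  proof (cases "0 \<le> x")
    case True
    have "(\<lambda>z. z \<bullet> z) -` {..x} = cball (0 :: real ^ 2) (sqrt x)"
      by (auto simp: norm_eq_sqrt_inner)
    thus ?thesis using True
      by (subst emeasure_distr) (auto simp: emeasure_cball unit_ball_vol_2)
  next
    case False
    have "(\<lambda>z. z \<bullet> z) -` {..x} = ({} :: (real ^ 2) set)"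
      using False order_trans[OF inner_ge_zero] by auto
    thus ?thesis using False
      by (subst emeasure_distr) auto
  qed
  have "emeasure ?R {..x} = ennreal (pi * max 0 x)" for x
  proof -
    have "emeasure ?R {..x} =
      (\<integral>\<^sup>+u. ennreal pi * indicator {0..x} u \<partial>lborel)"
      by (subst emeasure_density) (auto intro!: nn_integral_cong split: split_indicator)
    also have "\<dots> = ennreal (pi * max 0 x)"
      by (simp add: nn_integral_cmult_indicator ennreal_mult max_def)
    finally show ?thesis .
  qed
  with D show "emeasure ?L X =
    emeasure ?R X" if "X \<in> range (\<lambda>x::real. {..x})" for X
    using that by auto
  show "emeasure ?L {..real i} \<noteq> \<infinity>" for i
    using D by simp
  have "sets (borel :: real measure) = sigma_sets UNIV (range (\<lambda>x. {..x}))"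
    unfolding borel_eq_atMost by (simp add: sets_measure_of)
  thus "sets ?L = sigma_sets UNIV (range (\<lambda>x::real. {..x}))"
    "sets ?R = sigma_sets UNIV (range (\<lambda>x::real. {..x}))"
    by simp_all
  show "Int_stable (range (\<lambda>x::real. {..x}))"
    by (auto simp: Int_stable_def)
  show "(\<Union>i. {..real i}) = UNIV"
    using real_arch_simple by auto
qed auto

lemma distr_std_normal2_norm_square: "distr std_normal2 borel (\<lambda>z. z \<bullet> z) = chi_square 2"
proof -
  have "distr std_normal2 borel (\<lambda>z. z \<bullet> z) =
    density (distr lborel borel (\<lambda>z::real^2. z \<bullet> z)) (\<lambda>u. ennreal (1 / (2 * pi) * exp (- u / 2)))"
    unfolding std_normal2_eq by (subst density_distr) auto
  also have "\<dots> = density lborel (\<lambda>u. ennreal (pi * indicator {0..} u) * ennreal (1 / (2 * pi) * exp (- u / 2)))"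
    unfolding distr_lborel_norm_square by (subst density_density_eq) auto
  also have "\<dots> = density lborel (\<lambda>u. ennreal (chi_square_density 2 u))"
  proof (rule density_cong)
    show "AE u in lborel. ennreal (pi * indicator {0..} u) * ennreal (1 / (2 * pi) * exp (- u / 2)) =
       ennreal (chi_square_density 2 u)"
      \<comment> \<open>At 0 the two densities differ: the indicator of \<open>{0..}\<close> is 1
        there, whereas \<open>chi_square_density\<close> is 0.\<close>
      using AE_lborel_singleton[of "0::real"]
    proof eventually_elim
      case (elim u)
      thus ?case
        by (auto simp: chi_square_density_def ennreal_mult[symmetric] split: split_indicator)
    qed
    show "(\<lambda>u. ennreal (chi_square_density 2 u)) \<in> borel_measurable lborel"
      unfolding chi_square_density_def by measurable
  qed auto
  finally show ?thesis by (simp add: chi_square_def)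
qed

section \<open>Convergence in probability as a filter\<close>

context prob_space
begin

text \<open>An inner probability: \<open>P\<close> only has to contain an event of large
  probability, so it may involve random shifts of which no measurability is known.\<close>

definition likely :: "real \<Rightarrow> ('a \<Rightarrow> bool) \<Rightarrow> bool" where
  "likely d P \<longleftrightarrow> (\<exists>A\<in>events. prob A \<ge> 1 - d \<and> (\<forall>\<omega>\<in>A. P \<omega>))"

text \<open>Convergence in probability is convergence along this filter, so the limit rules for filters apply to it.\<close>

definition whp :: "(nat \<times> 'a) filter" where
  "whp = Abs_filter (\<lambda>P. \<forall>d>0. \<forall>\<^sub>F n in sequentially. likely d (\<lambda>\<omega>. P (n, \<omega>)))"

definition tight_seq :: "(nat \<times> 'a \<Rightarrow> real) \<Rightarrow> bool" where
  "tight_seq T \<longleftrightarrow> (\<forall>d>0. \<exists>K. \<forall>\<^sub>F n in sequentially. likely d (\<lambda>\<omega>. \<bar>T (n, \<omega>)\<bar> \<le> K))"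

lemma likely_mono: "likely d P \<Longrightarrow> (\<And>\<omega>. P \<omega> \<Longrightarrow> Q \<omega>) \<Longrightarrow> likely d Q"
  unfolding likely_def by blast

lemma likely_space: "\<forall>\<omega>\<in>space M. P \<omega> \<Longrightarrow> d > 0 \<Longrightarrow> likely d P"
  unfolding likely_def by (intro bexI[of _ "space M"]) (auto simp: prob_space)

lemma likely_conj:
  assumes "likely (d / 2) P" "likely (d / 2) Q"
  shows "likely d (\<lambda>\<omega>. P \<omega> \<and> Q \<omega>)"
proof -
  obtain A B where AB: "A \<in> events" "B \<in> events" "prob A \<ge> 1 - d / 2" "prob B \<ge> 1 - d / 2"
    "\<forall>\<omega>\<in>A. P \<omega>" "\<forall>\<omega>\<in>B. Q \<omega>"
    using assms unfolding likely_def by blast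
  have "prob (space M - A \<inter> B) \<le> prob ((space M - A) \<union> (space M - B))"
    using AB by (intro finite_measure_mono) auto
  also have "\<dots> \<le> prob (space M - A) + prob (space M - B)"
    using AB by (intro measure_Un_le) auto
  finally have "prob (A \<inter> B) \<ge> 1 - d"
    using AB by (simp add: prob_compl)
  thus ?thesis
    unfolding likely_def using AB by (intro bexI[of _ "A \<inter> B"]) auto
qed

lemma eventually_likely_conj:
  assumes "\<forall>\<^sub>F n in F. likely (d / 2) (P n)" "\<forall>\<^sub>F n in F. likely (d / 2) (Q n)"
    and "\<And>n \<omega>. P n \<omega> \<Longrightarrow> Q n \<omega> \<Longrightarrow> R n \<omega>"
  shows "\<forall>\<^sub>F n in F. likely d (R n)"
  using assms(1,2)
proof eventually_elim
  case (elim n)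
  from likely_conj[OF this] show ?case
    by (rule likely_mono) (simp add: assms(3))
qed

text \<open>The filter axiom for intersections holds because two exceptional sets of probability
  \<open>d / 2\<close> add up to at most \<open>d\<close>.\<close>

lemma eventually_whp:
  "eventually P whp \<longleftrightarrow> (\<forall>d>0. \<forall>\<^sub>F n in sequentially. likely d (\<lambda>\<omega>. P (n, \<omega>)))"
  unfolding whp_def
proof (rule eventually_Abs_filter, rule is_filter.intro)
  show "\<forall>d>0. \<forall>\<^sub>F n in sequentially. likely d (\<lambda>\<omega>. True)"
    by (auto intro: likely_space)
next
  fix P Q :: "nat \<times> 'a \<Rightarrow> bool"
  assume P: "\<forall>d>0. \<forall>\<^sub>F n in sequentially. likely d (\<lambda>\<omega>. P (n, \<omega>))"
    and Q: "\<forall>d>0. \<forall>\<^sub>F n in sequentially. likely d (\<lambda>\<omega>. Q (n, \<omega>))"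
  show "\<forall>d>0. \<forall>\<^sub>F n in sequentially. likely d (\<lambda>\<omega>. P (n, \<omega>) \<and> Q (n, \<omega>))"
  proof (intro allI impI)
    fix d :: real assume "d > 0"
    thus "\<forall>\<^sub>F n in sequentially. likely d (\<lambda>\<omega>. P (n, \<omega>) \<and> Q (n, \<omega>))"
      by (intro eventually_likely_conj[OF P[rule_format] Q[rule_format]]) auto
  qed
next
  fix P Q :: "nat \<times> 'a \<Rightarrow> bool"
  assume "\<forall>p. P p \<longrightarrow> Q p" "\<forall>d>0. \<forall>\<^sub>F n in sequentially. likely d (\<lambda>\<omega>. P (n, \<omega>))"
  thus "\<forall>d>0. \<forall>\<^sub>F n in sequentially. likely d (\<lambda>\<omega>. Q (n, \<omega>))"
    by (blast intro: eventually_mono likely_mono)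
qed

lemma eventually_whpI:
  assumes "\<forall>\<^sub>F n in sequentially. \<forall>\<omega>\<in>space M. P (n, \<omega>)"
  shows "eventually P whp"
  unfolding eventually_whp using assms by (blast intro: eventually_mono likely_space)

text \<open>Half of \<open>d\<close> pays for the bound \<open>K\<close> and half for the claim
  under that bound. A claim about a tight sequence may thus be proved as if the sequence were
  bounded by a constant.\<close>

lemma tight_seq_eventually:
  assumes T: "tight_seq T" and P: "\<And>K. eventually (\<lambda>p. \<bar>T p\<bar> \<le> K \<longrightarrow> P p) whp"
  shows "eventually P whp"
  unfolding eventually_whp
proof (intro allI impI)
  fix d :: real assume "d > 0"
  hence d: "d / 2 > 0" by simp
  then obtain K where "\<forall>\<^sub>F n in sequentially. likely (d / 2) (\<lambda>\<omega>. \<bar>T (n, \<omega>)\<bar> \<le> K)"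
    using T unfolding tight_seq_def by blast
  thus "\<forall>\<^sub>F n in sequentially. likely d (\<lambda>\<omega>. P (n, \<omega>))"
    by (rule eventually_likely_conj[OF P[of K, unfolded eventually_whp, rule_format, OF d]]) simp
qed

lemma tight_seq_close:
  assumes T: "tight_seq T" and S: "((\<lambda>p. S p - T p) \<longlongrightarrow> c) whp"
  shows "tight_seq S"
  unfolding tight_seq_def
proof (intro allI impI)
  fix d :: real assume "d > 0"
  hence d: "d / 2 > 0" by simp
  then obtain K where K: "\<forall>\<^sub>F n in sequentially. likely (d / 2) (\<lambda>\<omega>. \<bar>T (n, \<omega>)\<bar> \<le> K)"
    using T unfolding tight_seq_def by blast
  have "\<forall>\<^sub>F n in sequentially. likely (d / 2) (\<lambda>\<omega>. dist (S (n, \<omega>) - T (n, \<omega>)) c < 1)"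
    using tendstoD[OF S zero_less_one] d unfolding eventually_whp by blast
  hence "\<forall>\<^sub>F n in sequentially. likely d (\<lambda>\<omega>. \<bar>S (n, \<omega>)\<bar> \<le> K + \<bar>c\<bar> + 1)"
    by (rule eventually_likely_conj[OF _ K]) (simp add: dist_real_def)
  thus "\<exists>K. \<forall>\<^sub>F n in sequentially. likely d (\<lambda>\<omega>. \<bar>S (n, \<omega>)\<bar> \<le> K)" by blast
qed

lemma tight_seq_mult_tendsto_0:
  assumes "tight_seq T" and R: "(R \<longlongrightarrow> 0) whp"
  shows "((\<lambda>p. T p * R p) \<longlongrightarrow> 0) whp"
proof (rule tendstoI)
  fix e :: real assume "e > 0"
  show "\<forall>\<^sub>F p in whp. dist (T p * R p) 0 < e"
  proof (rule tight_seq_eventually[OF assms(1)])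
    fix K
    have "\<forall>\<^sub>F p in whp. dist (R p) 0 < e / (\<bar>K\<bar> + 1)"
      using \<open>e > 0\<close> by (intro tendstoD[OF R]) (auto intro: divide_pos_pos)
    thus "\<forall>\<^sub>F p in whp. \<bar>T p\<bar> \<le> K \<longrightarrow> dist (T p * R p) 0 < e"
    proof eventually_elim
      case (elim p)
      show ?case
      proof
        assume "\<bar>T p\<bar> \<le> K"
        hence "\<bar>T p\<bar> * \<bar>R p\<bar> \<le> (\<bar>K\<bar> + 1) * \<bar>R p\<bar>" by (intro mult_right_mono) auto
        also have "\<dots> < e" using elim by (simp add: field_simps)
        finally show "dist (T p * R p) 0 < e" by (simp add: abs_mult)
      qed
    qed
  qed
qed

lemma prob_abs_le_ge:
  fixes f :: "'a \<Rightarrow> real"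
  assumes [measurable]: "f \<in> borel_measurable M" and "integrable M (\<lambda>\<omega>. (f \<omega>)\<^sup>2)" "K > 0"
  shows "prob {\<omega>\<in>space M. \<bar>f \<omega>\<bar> \<le> K} \<ge> 1 - expectation (\<lambda>\<omega>. (f \<omega>)\<^sup>2) / K\<^sup>2"
proof -
  have "prob {\<omega>\<in>space M. (f \<omega>)\<^sup>2 \<ge> K\<^sup>2} \<le> expectation (\<lambda>\<omega>. (f \<omega>)\<^sup>2) / K\<^sup>2"
    using assms by (intro integral_Markov_inequality_measure[where A="space M"]) auto
  moreover have "prob {\<omega>\<in>space M. \<not> \<bar>f \<omega>\<bar> \<le> K} \<le> prob {\<omega>\<in>space M. (f \<omega>)\<^sup>2 \<ge> K\<^sup>2}"
    using assms(3) by (intro finite_measure_mono) (auto simp: abs_le_square_iff[symmetric])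
  ultimately show ?thesis
    using prob_neg[of "\<lambda>\<omega>. \<bar>f \<omega>\<bar> \<le> K"] by simp
qed

lemma tendsto_whp_0_if_square:
  fixes f :: "nat \<Rightarrow> 'a \<Rightarrow> real"
  assumes f[measurable]: "\<And>n. f n \<in> borel_measurable M" and int: "\<And>n. integrable M (\<lambda>\<omega>. (f n \<omega>)\<^sup>2)"
    and lim: "(\<lambda>n. expectation (\<lambda>\<omega>. (f n \<omega>)\<^sup>2)) \<longlonglongrightarrow> 0"
  shows "((\<lambda>p. f (fst p) (snd p)) \<longlongrightarrow> 0) whp"
proof (rule tendstoI, unfold eventually_whp, intro allI impI)
  fix e d :: real assume "e > 0" "d > 0"
  \<comment> \<open>Half of \<open>e\<close>, because Chebyshev's inequality gives a weak bound and
    a strict one is wanted.\<close>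
  hence "\<forall>\<^sub>F n in sequentially. expectation (\<lambda>\<omega>. (f n \<omega>)\<^sup>2) < d * (e / 2)\<^sup>2"
    by (intro order_tendstoD(2)[OF lim]) simp
  thus "\<forall>\<^sub>F n in sequentially. likely d (\<lambda>\<omega>. dist (f (fst (n, \<omega>)) (snd (n, \<omega>))) 0 < e)"
    unfolding likely_def
  proof eventually_elim
    case (elim n)
    hence "expectation (\<lambda>\<omega>. (f n \<omega>)\<^sup>2) / (e / 2)\<^sup>2 \<le> d"
      using \<open>e > 0\<close> by (simp add: divide_le_eq)
    hence "1 - d \<le> prob {\<omega>\<in>space M. \<bar>f n \<omega>\<bar> \<le> e / 2}"
      using prob_abs_le_ge[OF f int, of "e / 2" n] \<open>e > 0\<close> by simp
    thus ?case
      using \<open>e > 0\<close> by (intro bexI[of _ "{\<omega>\<in>space M. \<bar>f n \<omega>\<bar> \<le> e / 2}"]) auto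
  qed
qed

lemma tight_seq_if_square:
  fixes f :: "nat \<Rightarrow> 'a \<Rightarrow> real"
  assumes f[measurable]: "\<And>n. f n \<in> borel_measurable M" and int: "\<And>n. integrable M (\<lambda>\<omega>. (f n \<omega>)\<^sup>2)"
    and bd: "\<And>n. expectation (\<lambda>\<omega>. (f n \<omega>)\<^sup>2) \<le> B"
  shows "tight_seq (\<lambda>p. f (fst p) (snd p))"
  unfolding tight_seq_def
proof (intro allI impI)
  fix d :: real assume "d > 0"
  \<comment> \<open>Chebyshev's bound \<open>B / K\<^sup>2\<close> is then at most \<open>d\<close>;
    the summand 1 keeps \<open>K\<close> positive.\<close>
  define K where "K = sqrt ((\<bar>B\<bar> + 1) / d)"
  have K: "K > 0" "K\<^sup>2 = (\<bar>B\<bar> + 1) / d"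
    using \<open>d > 0\<close> by (auto simp: K_def)
  have "likely d (\<lambda>\<omega>. \<bar>f n \<omega>\<bar> \<le> K)" for n
  proof -
    have "expectation (\<lambda>\<omega>. (f n \<omega>)\<^sup>2) / K\<^sup>2 \<le> d"
      proof -
      have "expectation (\<lambda>\<omega>. (f n \<omega>)\<^sup>2) \<le> \<bar>B\<bar> + 1" using bd[of n] by linarith
      thus ?thesis unfolding K(2) using \<open>d > 0\<close> by (simp add: pos_divide_le_eq)
    qed
    hence "1 - d \<le> prob {\<omega>\<in>space M. \<bar>f n \<omega>\<bar> \<le> K}"
      using prob_abs_le_ge[OF f int K(1), of n] by simp
    thus ?thesis
      unfolding likely_def by (intro bexI[of _ "{\<omega>\<in>space M. \<bar>f n \<omega>\<bar> \<le> K}"]) auto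
  qed
  thus "\<exists>K. \<forall>\<^sub>F n in sequentially. likely d (\<lambda>\<omega>. \<bar>f (fst (n, \<omega>)) (snd (n, \<omega>))\<bar> \<le> K)"
    by (intro exI[of _ K] always_eventually) simp
qed

text \<open>Monotonicity in \<open>t\<close> reduces the uniform statement on a compact interval to a finite grid.\<close>

lemma antimono_process_plug_in:
  fixes D :: "nat \<times> 'a \<Rightarrow> real \<Rightarrow> real"
  assumes mono: "\<And>p s t. s \<le> t \<Longrightarrow> D p t \<le> D p s"
    and pt: "\<And>t. ((\<lambda>p. D p t + c * t) \<longlongrightarrow> 0) whp"
    and T: "tight_seq T"
  shows "((\<lambda>p. D p (T p) + c * T p) \<longlongrightarrow> 0) whp"
proof (rule tendstoI, rule tight_seq_eventually[OF T])
  fix e K :: real assume "e > 0"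
  \<comment> \<open>On a cell of width \<open>r\<close> the linear term \<open>c * t\<close> moves
    by at most \<open>e / 4\<close>; the summand 1 covers \<open>c = 0\<close>.\<close>
  define r where "r = e / (4 * (\<bar>c\<bar> + 1))"
  have r: "r > 0" using \<open>e > 0\<close> by (simp add: r_def divide_pos_pos)
  have cr: "\<bar>c\<bar> * r \<le> e / 4"
    using \<open>e > 0\<close> by (simp add: r_def field_simps)
  \<comment> \<open>One cell in reserve, since both \<open>j\<close> and \<open>j + 1\<close> must
    lie on the grid.\<close>
  define N where "N = \<lceil>\<bar>K\<bar> / r\<rceil> + 1"
  have "\<forall>\<^sub>F p in whp. \<forall>j\<in>{-N..N}. dist (D p (of_int j * r) + c * (of_int j * r)) 0 < e / 4"
    using \<open>e > 0\<close> by (intro eventually_ball_finite ballI tendstoD[OF pt]) auto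
  thus "\<forall>\<^sub>F p in whp. \<bar>T p\<bar> \<le> K \<longrightarrow> dist (D p (T p) + c * T p) 0 < e"
  proof eventually_elim
    case (elim p)
    show ?case
    proof
      assume TK: "\<bar>T p\<bar> \<le> K"
      define j where "j = \<lfloor>T p / r\<rfloor>"
      have j: "of_int j * r \<le> T p" "T p \<le> of_int (j + 1) * r"
        using r floor_divide_lower[of r "T p"] floor_divide_upper[of r "T p"] by (auto simp: j_def)
      have "\<bar>T p / r\<bar> \<le> \<bar>K\<bar> / r"
        using TK r by (simp add: abs_divide divide_right_mono)
      hence "j \<in> {-N..N}" "j + 1 \<in> {-N..N}"
        unfolding j_def N_def by (auto; linarith)+
      hence e1: "\<bar>D p (of_int j * r) + c * (of_int j * r)\<bar> < e / 4"
        and e2: "\<bar>D p (of_int (j + 1) * r) + c * (of_int (j + 1) * r)\<bar> < e / 4"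
        using bspec[OF elim, of j] bspec[OF elim, of "j + 1"] by (simp_all only: dist_real_def diff_zero)
      have small: "\<bar>c * x\<bar> \<le> e / 4" if "\<bar>x\<bar> \<le> r" for x
        unfolding abs_mult using that by (intro order_trans[OF mult_left_mono cr]) auto
      have "\<bar>T p - of_int j * r\<bar> \<le> r" "\<bar>T p - of_int (j + 1) * r\<bar> \<le> r"
        using j by (auto simp: abs_le_iff algebra_simps)
      hence "\<bar>c * T p - c * (of_int j * r)\<bar> \<le> e / 4" "\<bar>c * T p - c * (of_int (j + 1) * r)\<bar> \<le> e / 4"
        unfolding right_diff_distrib[symmetric] by (blast intro: small)+
      \<comment> \<open>The value at \<open>T p\<close> is caught between the values at the two
        neighbouring grid points. Each of these is within \<open>e / 4\<close> of its linear term,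
        which differs from that at \<open>T p\<close> by another \<open>e / 4\<close>.\<close>
      moreover have "D p (of_int (j + 1) * r) \<le> D p (T p)" "D p (T p) \<le> D p (of_int j * r)"
        using j by (blast intro: mono)+
      ultimately show "dist (D p (T p) + c * T p) 0 < e"
        using e1 e2 \<open>e > 0\<close> unfolding dist_real_def by linarith
    qed
  qed
qed

text \<open>Slutsky's argument on characteristic functions: \<open>iexp\<close> is 1-Lipschitz and
  of modulus 1, so the integrals differ by at most \<open>d\<close> from the good event and
  \<open>2 * d\<close> from its complement.\<close>

lemma iexp_conv_if_close:
  fixes Z W :: "nat \<Rightarrow> 'a \<Rightarrow> real"
  assumes Z[measurable]: "\<And>n. Z n \<in> borel_measurable M" and W[measurable]: "\<And>n. W n \<in> borel_measurable M"
    and close: "((\<lambda>p. Z (fst p) (snd p) - W (fst p) (snd p)) \<longlongrightarrow> 0) whp"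
    and lim: "(\<lambda>n. CLINT \<omega>|M. iexp (W n \<omega>)) \<longlonglongrightarrow> l"
  shows "(\<lambda>n. CLINT \<omega>|M. iexp (Z n \<omega>)) \<longlonglongrightarrow> l"
proof -
  have "(\<lambda>n. (CLINT \<omega>|M. iexp (Z n \<omega>)) - (CLINT \<omega>|M. iexp (W n \<omega>))) \<longlonglongrightarrow> 0"
  proof (rule tendstoI)
    fix e :: real assume "e > 0"
    define d where "d = e / 4"
    have d: "d > 0" using \<open>e > 0\<close> by (simp add: d_def)
    have "\<forall>\<^sub>F n in sequentially. likely d (\<lambda>\<omega>. \<bar>Z n \<omega> - W n \<omega>\<bar> < d)"
      using tendstoD[OF close d] d unfolding eventually_whp dist_real_def by simp
    thus "\<forall>\<^sub>F n in sequentially. dist ((CLINT \<omega>|M. iexp (Z n \<omega>)) - (CLINT \<omega>|M. iexp (W n \<omega>))) 0 < e"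
    proof eventually_elim
      case (elim n)
      then obtain A where A[measurable]: "A \<in> events" and pA: "1 - d \<le> prob A" and AZ: "\<And>\<omega>. \<omega> \<in> A \<Longrightarrow> \<bar>Z n \<omega> - W n \<omega>\<bar> < d"
        unfolding likely_def by blast
      have int: "integrable M (\<lambda>\<omega>. iexp (Z n \<omega>))" "integrable M (\<lambda>\<omega>. iexp (W n \<omega>))"
        by (intro integrable_const_bound[of _ 1]; simp)+
      have bd: "norm (iexp x - iexp y) \<le> \<bar>x - y\<bar>" for x y :: real
      proof -
        have "iexp x - iexp y = iexp y * (iexp (x - y) - 1)"
          by (simp add: right_diff_distrib' exp_diff exp_not_eq_zero)
        thus ?thesis
          using iexp_approx1[of "x - y" 0] by (simp add: norm_mult)
      qed
      have pt: "norm (iexp (Z n \<omega>) - iexp (W n \<omega>)) \<le> d + 2 * indicator (space M - A) \<omega>" if "\<omega> \<in> space M" for \<omega>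
      proof (cases "\<omega> \<in> A")
        case True
        thus ?thesis using bd[of "Z n \<omega>" "W n \<omega>"] AZ[OF True] by simp
      next
        case False
        have "norm (iexp (Z n \<omega>) - iexp (W n \<omega>)) \<le> 1 + 1"
          by (intro order_trans[OF norm_triangle_ineq4] add_mono) auto
        thus ?thesis using False that d by simp
      qed
      have "norm ((CLINT \<omega>|M. iexp (Z n \<omega>)) - (CLINT \<omega>|M. iexp (W n \<omega>))) =
         norm (CLINT \<omega>|M. iexp (Z n \<omega>) - iexp (W n \<omega>))"
        using int by simp
      also have "\<dots> \<le> (\<integral>\<omega>. norm (iexp (Z n \<omega>) - iexp (W n \<omega>)) \<partial>M)"
        by (rule integral_norm_bound)
      also have "\<dots> \<le> (\<integral>\<omega>. d + 2 * indicator (space M - A) \<omega> \<partial>M)"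
        using int pt by (intro integral_mono) (auto simp: emeasure_eq_measure)
      also have "\<dots> = d + 2 * prob (space M - A)"
        by (simp add: prob_space emeasure_eq_measure Int_Diff)
      also have "\<dots> \<le> d + 2 * d"
        using pA by (simp add: prob_compl)
      finally show ?case using \<open>e > 0\<close> by (simp add: d_def)
    qed
  qed
  from tendsto_add[OF this lim] show ?thesis by simp
qed

end

section \<open>Integrals of Gamma type\<close>

lemma tendsto_at_0_seq:
  fixes f :: "real \<Rightarrow> real"
  assumes "(f \<longlongrightarrow> l) (at 0)" "u \<longlonglongrightarrow> 0" "\<And>n. u n \<noteq> 0"
  shows "(\<lambda>n. f (u n)) \<longlonglongrightarrow> l"
  using assms by (intro filterlim_compose[OF assms(1)]) (auto simp: filterlim_at)

text \<open>The open half line excludes the singularity of \<open>ln\<close> and of negative powers,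
  and the power substitution maps it onto itself.\<close>

abbreviation has_integral_pos :: "(real \<Rightarrow> real) \<Rightarrow> real \<Rightarrow> bool" where
  "has_integral_pos f I \<equiv> has_bochner_integral lborel (\<lambda>t. indicator {0<..} t * f t) I"

lemma has_bochner_integral_Gamma:
  fixes s :: real
  assumes "s > 0"
  shows "has_integral_pos (\<lambda>t. t powr (s - 1) * exp (- t)) (Gamma s)"
proof (rule has_bochner_integral_nn_integral)
  have "(\<integral>\<^sup>+t. ennreal (indicator {0<..} t * (t powr (s - 1) * exp (- t))) \<partial>lborel) =
    (\<integral>\<^sup>+t. ennreal (indicator {0..} t * t powr (s - 1) / exp t) \<partial>lborel)"
    by (intro nn_integral_cong) (auto simp: exp_minus field_simps split: split_indicator)
  thus "(\<integral>\<^sup>+t. ennreal (indicator {0<..} t * (t powr (s - 1) * exp (- t))) \<partial>lborel) = ennreal (Gamma s)"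
    using Gamma_conv_nn_integral_real[OF assms] by simp
qed (use Gamma_real_nonneg[of s] assms in auto)


section \<open>Logarithms under the Gamma integral\<close>

text \<open>Trades logarithms for powers in a majorant. For the square, \<open>r = sqrt t\<close>
  gives \<open>(2 * (1 / r + r))\<^sup>2 = 4 * (1 / t + t) + 8\<close>, and
  \<open>1 / t + t \<ge> 2\<close> turns this into the constant 8.\<close>

lemma abs_ln_power_le:
  fixes t :: real
  assumes "t > 0" "k \<le> 1"
  shows "\<bar>ln t\<bar> ^ Suc k \<le> 8 * (1 / t + t)"
proof -
  define r where "r = sqrt t"
  have r: "r > 0" "t = r\<^sup>2" using assms by (auto simp: r_def)
  have ln: "\<bar>ln x\<bar> \<le> 1 / x + x" if "x > 0" for x :: real
    proof -
    have "0 < 1 / x" using that by simp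
    moreover from this have "- ln x \<le> 1 / x - 1"
      using ln_le_minus_one[of "1 / x"] that by (simp add: ln_div)
    ultimately show ?thesis
      using ln_le_minus_one[OF that] that unfolding abs_le_iff by (intro conjI) linarith+
  qed
  consider "k = 0" | "k = 1" using assms(2) by linarith
  thus ?thesis
  proof cases
    case 1
    have "0 \<le> 1 / t + t" using assms by simp
    thus ?thesis using ln[of t] assms 1 by simp
  next
    case 2
    have "\<bar>ln t\<bar> = 2 * \<bar>ln r\<bar>"
      using r by (simp add: ln_realpow abs_mult)
    hence "\<bar>ln t\<bar>\<^sup>2 \<le> (2 * (1 / r + r))\<^sup>2"
      using ln[OF r(1)] by (intro power_mono) auto
    also have "\<dots> = 4 * (1 / t + t) + 8"
      using r by (simp add: power2_eq_square field_simps)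
    also have "\<dots> \<le> 8 * (1 / t + t)"
    proof -
      have "0 \<le> (1 / r - r)\<^sup>2" by simp
      also have "\<dots> = 1 / t + t - 2"
        using r by (simp add: power2_eq_square field_simps)
      finally show ?thesis by simp
    qed
    finally show ?thesis using 2 by (simp add: numeral_2_eq_2)
  qed
qed

text \<open>A majorant, uniform in \<open>u\<close>, for the difference quotients of
  \<open>u \<mapsto> t powr u\<close> at 0. The inequality \<open>exp x \<ge> 1 + x\<close> is used
  at \<open>- (u * ln t)\<close> for \<open>t \<ge> 1\<close>, which leaves a factor
  \<open>t powr u \<le> 1 + t\<close>, and at \<open>u * ln t\<close> for
  \<open>t < 1\<close>.\<close>

lemma abs_powr_minus_one_le:
  fixes t u :: real
  assumes "t > 0" "0 < u" "u \<le> 1"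
  shows "\<bar>(t powr u - 1) / u\<bar> \<le> \<bar>ln t\<bar> * (1 + t)"
proof -
  have tu: "t powr u \<le> 1 + t"
  proof (cases "t \<le> 1")
    case True
    thus ?thesis using powr_le1[of u t] assms by simp
  next
    case False
    thus ?thesis using powr_mono[of u 1 t] assms by simp
  qed
  have t0: "t powr u = exp (u * ln t)" using assms by (simp add: powr_def)
  have "\<bar>t powr u - 1\<bar> \<le> u * \<bar>ln t\<bar>  * (1 + t)"
  proof (cases "t \<ge> 1")
    case True
    have "exp (u * ln t) * (1 - u * ln t) \<le> exp (u * ln t) * exp (- (u * ln t))"
      using exp_ge_add_one_self[of "- (u * ln t)"] by (intro mult_left_mono) auto
    hence "t powr u - 1 \<le> u * ln t * t powr u"
      unfolding t0 by (simp add: algebra_simps flip: exp_add)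
    also have "\<dots> \<le> u * ln t * (1 + t)"
      using True assms tu by (intro mult_left_mono) auto
    finally show ?thesis using True assms by (simp add: ge_one_powr_ge_zero)
  next
    case False
    hence l: "ln t < 0" using assms by simp
    have "1 - t powr u \<le> - (u * ln t)"
      unfolding t0 using exp_ge_add_one_self[of "u * ln t"] by linarith
    also have "\<dots> \<le> - (u * ln t) * (1 + t)"
      using l assms mult_pos_neg[of u "ln t"] by (simp add: mult_le_cancel_left1 mult_nonpos_nonneg)
    finally show ?thesis
      using False l assms powr_le1[of u t] by simp
  qed
  thus ?thesis using assms by (simp add: divide_le_eq mult_ac)
qed

text \<open>Differentiating in the shape \<open>s\<close> under the integral brings down one factor
  \<open>ln t\<close>; dominated convergence runs along right-hand quotients, so the formula is
  assumed for shapes \<open>s' \<ge> s\<close>. The majorant contains \<open>t powr (s - 2)\<close>,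
  whence \<open>s > 1\<close>.\<close>

lemma has_bochner_integral_Gamma_ln_step:
  fixes s D :: real and G :: "real \<Rightarrow> real"
  assumes s: "s > 1" and k: "k \<le> 1"
    and G: "\<And>s'. s' \<ge> s \<Longrightarrow> has_integral_pos (\<lambda>t. t powr (s' - 1) * ln t ^ k * exp (- t)) (G s')"
    and D: "(G has_real_derivative D) (at s)"
  shows "has_integral_pos (\<lambda>t. t powr (s - 1) * ln t ^ Suc k * exp (- t)) D"
proof -
  define u where "u n = 1 / real (Suc n)" for n
  have u: "0 < u n" "u n \<le> 1" for n by (auto simp: u_def)
  have u0: "u \<longlonglongrightarrow> 0" unfolding u_def using LIMSEQ_Suc[OF lim_1_over_n] by simp
  define f where "f s' t = indicator {0<..} t * (t powr (s' - 1) * ln t ^ k * exp (- t))" for s' t :: real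
  define F where "F t = indicator {0<..} t * (t powr (s - 1) * ln t ^ Suc k * exp (- t))" for t :: real
  \<comment> \<open>\<open>16 = 8 * 2\<close>, with 8 from the bound on the logarithm and 2 from
    \<open>1 + t \<le> 1 / t + t\<^sup>2\<close>; the two summands carry \<open>1 / t\<close> and
    \<open>t\<^sup>2\<close>.\<close>
  define w where "w t = 16 * (indicator {0<..} t * (t powr (s - 1 - 1) * exp (- t))
      + indicator {0<..} t * (t powr (s + 2 - 1) * exp (- t)))" for t :: real
  have [measurable]: "f s' \<in> borel_measurable borel" "F \<in> borel_measurable borel" for s'
    unfolding f_def F_def by measurable
  have w_int: "integrable lborel w"
    unfolding w_def using has_bochner_integral_Gamma[of "s - 1"] has_bochner_integral_Gamma[of "s + 2"] s
    by (intro integrable_mult_right Bochner_Integration.integrable_add) (auto simp: has_bochner_integral_iff)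
  have lim: "(\<lambda>n. (f (s + u n) t - f s t) / u n) \<longlonglongrightarrow> F t" for t
  proof (cases "t > 0")
    case True
    have "((\<lambda>x. t powr x) has_real_derivative t powr (s - 1) * ln t) (at (s - 1))"
      using True by (auto intro!: derivative_eq_intros)
    hence "((\<lambda>h. (t powr (s - 1 + h) - t powr (s - 1)) / h) \<longlongrightarrow> t powr (s - 1) * ln t) (at 0)"
      by (simp add: DERIV_def)
    hence "(\<lambda>n. (t powr (s - 1 + u n) - t powr (s - 1)) / u n) \<longlonglongrightarrow> t powr (s - 1) * ln t"
      by (rule tendsto_at_0_seq[OF _ u0]) (rule u(1)[THEN less_imp_neq, symmetric])
    hence "(\<lambda>n. (t powr (s - 1 + u n) - t powr (s - 1)) / u n * (ln t ^ k * exp (- t))) \<longlonglongrightarrow> t powr (s - 1) * ln t * (ln t ^ k * exp (- t))"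
      by (intro tendsto_mult tendsto_const)
    thus ?thesis using True by (simp add: f_def F_def algebra_simps diff_divide_distrib)
  qed (simp add: f_def F_def)
  have bound: "\<bar>(f (s + u n) t - f s t) / u n\<bar> \<le> w t" for n t
  proof (cases "t > 0")
    case True
    have "(f (s + u n) t - f s t) / u n = (t powr u n - 1) / u n * (t powr (s - 1) * ln t ^ k * exp (- t))"
      using True by (simp add: f_def powr_add[symmetric] algebra_simps diff_divide_distrib)
    hence "\<bar>(f (s + u n) t - f s t) / u n\<bar> = \<bar>(t powr u n - 1) / u n\<bar> * (t powr (s - 1) * \<bar>ln t\<bar> ^ k * exp (- t))"
      using True by (simp only: abs_mult power_abs abs_of_nonneg[OF powr_ge_zero] abs_exp_cancel)
    also have "\<dots> \<le> (\<bar>ln t\<bar> * (1 + t)) * (t powr (s - 1) * \<bar>ln t\<bar> ^ k * exp (- t))"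
      using abs_powr_minus_one_le[OF True u] by (intro mult_right_mono) auto
    also have "\<dots> = \<bar>ln t\<bar> ^ Suc k * ((1 + t) * (t powr (s - 1) * exp (- t)))"
      by simp
    also have "\<dots> \<le> (8 * (1 / t + t)) * ((1 + t) * (t powr (s - 1) * exp (- t)))"
      using abs_ln_power_le[OF True k] True by (intro mult_right_mono) auto
    also have "\<dots> = 8 * ((1 / t + 1 + t + t\<^sup>2) * (t powr (s - 1) * exp (- t)))"
      using True by (simp add: field_simps power2_eq_square)
    also have "\<dots> \<le> 8 * ((2 * (1 / t + t\<^sup>2)) * (t powr (s - 1) * exp (- t)))"
    proof -
      have "1 + t \<le> 1 / t + t\<^sup>2"
      proof -
        \<comment> \<open>Division by \<open>t\<close> turns this product into
          \<open>1 / t + t\<^sup>2 - 1 - t\<close>.\<close>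
        have "0 \<le> (1 - t)\<^sup>2 * (1 + t)" using True by simp
        thus ?thesis using True by (simp add: field_simps power2_eq_square)
      qed
      thus ?thesis using True by (intro mult_left_mono mult_right_mono) auto
    qed
    also have "\<dots> = w t"
      using True powr_add[of t "s - 2" 1] powr_add[of t "s - 1" 2]
      by (simp add: w_def field_simps power2_eq_square powr_diff powr_numeral)
    finally show ?thesis .
  qed (simp add: f_def w_def)
  have fi: "integrable lborel (f s')" "integral\<^sup>L lborel (f s') = G s'" if "s' \<ge> s" for s'
    using G[OF that] unfolding f_def has_bochner_integral_iff by auto
  have int: "integrable lborel F"
  proof (rule Bochner_Integration.integrable_bound[OF w_int])
    have "\<bar>F t\<bar> \<le> w t" for t
      by (rule LIMSEQ_le_const2[OF tendsto_rabs[OF lim[of t]]]) (use bound in blast)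
    thus "AE t in lborel. norm (F t) \<le> norm (w t)"
      by (auto intro: order_trans[OF _ abs_ge_self])
  qed simp
  have "(\<lambda>n. \<integral>t. (f (s + u n) t - f s t) / u n \<partial>lborel) \<longlonglongrightarrow> integral\<^sup>L lborel F"
    by (rule integral_dominated_convergence[OF _ _ w_int]) (use lim bound in auto)
  also have "(\<lambda>n. \<integral>t. (f (s + u n) t - f s t) / u n \<partial>lborel) = (\<lambda>n. (G (s + u n) - G s) / u n)"
    using fi u by (auto simp: less_imp_le)
  finally have 1: "(\<lambda>n. (G (s + u n) - G s) / u n) \<longlonglongrightarrow> integral\<^sup>L lborel F" .
  have "((\<lambda>h. (G (s + h) - G s) / h) \<longlongrightarrow> D) (at 0)"
    using D by (simp add: DERIV_def)
  hence "(\<lambda>n. (G (s + u n) - G s) / u n) \<longlonglongrightarrow> D"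
    by (rule tendsto_at_0_seq[OF _ u0]) (rule u(1)[THEN less_imp_neq, symmetric])
  hence "integral\<^sup>L lborel F = D"
    using 1 LIMSEQ_unique by blast
  thus ?thesis using int unfolding F_def has_bochner_integral_iff by simp
qed

lemma pos_notin_nonpos_Ints: "(s :: real) > 0 \<Longrightarrow> s \<notin> \<int>\<^sub>\<le>\<^sub>0"
  by (auto elim!: nonpos_Ints_cases)

lemma has_bochner_integral_Gamma_ln:
  fixes s :: real
  assumes "s > 1"
  shows "has_integral_pos (\<lambda>t. t powr (s - 1) * ln t * exp (- t)) (Gamma s * Digamma s)"
proof -
  have "(Gamma has_real_derivative Gamma s * Digamma s) (at s)"
    using assms by (intro has_field_derivative_Gamma pos_notin_nonpos_Ints) simp
  with has_bochner_integral_Gamma_ln_step[of s 0 Gamma "Gamma s * Digamma s"] show ?thesis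
    using has_bochner_integral_Gamma assms by simp
qed

lemma has_bochner_integral_Gamma_ln_square:
  fixes s :: real
  assumes "s > 1"
  shows "has_integral_pos (\<lambda>t. t powr (s - 1) * (ln t)\<^sup>2 * exp (- t))
    (Gamma s * (Polygamma 1 s + (Digamma s)\<^sup>2))"
proof -
  have "((\<lambda>s. Gamma s * Digamma s) has_real_derivative Gamma s * (Polygamma 1 s + (Digamma s)\<^sup>2)) (at s)"
    using assms by (auto intro!: derivative_eq_intros pos_notin_nonpos_Ints simp: algebra_simps power2_eq_square)
  with has_bochner_integral_Gamma_ln_step[of s 1 "\<lambda>s. Gamma s * Digamma s", OF assms] show ?thesis
    using has_bochner_integral_Gamma_ln assms by (simp add: numeral_2_eq_2)
qed

text \<open>For \<open>t = y powr lam / lam\<close> the Jacobian \<open>y powr (lam - 1)\<close>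
  equals \<open>(lam * t) powr (1 - 1 / lam)\<close>, which cancels the power of \<open>t\<close>
  and leaves only a power of \<open>lam\<close>.\<close>

lemma has_bochner_integral_power_substitution:
  fixes F :: "real \<Rightarrow> real"
  assumes lam: "lam > 0" and F[measurable]: "F \<in> borel_measurable borel"
    and I: "has_integral_pos (\<lambda>t. F t * t powr (1 / lam - 1) * exp (- t)) I"
  shows "has_integral_pos (\<lambda>y. F (y powr lam / lam) * exp (- (y powr lam / lam)))
    (lam powr (1 / lam - 1) * I)"
proof -
  define f where "f t = F t * t powr (1 / lam - 1) * exp (- t)" for t
  define g where "g y = y powr lam / lam" for y :: real
  have g': "(g has_field_derivative y powr (lam - 1)) (at y within {0<..})" if "y \<in> {0<..}" for y
    unfolding g_def using that lam by (auto intro!: derivative_eq_intros)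
  have inj: "inj_on g {0<..}"
  proof (rule inj_onI)
    fix x y :: real assume "x \<in> {0<..}" "y \<in> {0<..}" "g x = g y"
    hence "(x powr lam) powr (1 / lam) = (y powr lam) powr (1 / lam)"
      using lam by (simp add: g_def)
    thus "x = y" using \<open>x \<in> {0<..}\<close> \<open>y \<in> {0<..}\<close> lam by (simp add: powr_powr)
  qed
  have img: "g ` {0<..} = {0<..}"
  proof -
    have "t = g ((lam * t) powr (1 / lam))" if "t > 0" for t
      using that lam by (simp add: g_def powr_powr)
    moreover have "(lam * t) powr (1 / lam) \<in> {0<..}" if "t > 0" for t
      using that lam by simp
    ultimately have "{0<..} \<subseteq> g ` {0<..}"
      using image_eqI[of _ g "(lam * _) powr (1 / lam)" "{0<..}"] by (meson greaterThan_iff subsetI)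
    moreover have "g ` {0<..} \<subseteq> {0<..}" using lam by (auto simp: g_def)
    ultimately show ?thesis by (rule equalityI[rotated])
  qed
  have [measurable]: "f \<in> borel_measurable borel" unfolding f_def by measurable
  \<comment> \<open>Bridge between the gauge integral of the change-of-variables theorem and Bochner
    integrals over \<open>lborel\<close>.\<close>
  have conv: "h absolutely_integrable_on {0<..} \<and> integral {0<..} h = J \<longleftrightarrow>
     has_bochner_integral lborel (\<lambda>x. indicator {0<..} x * h x) J"
    if [measurable]: "h \<in> borel_measurable borel" for h :: "real \<Rightarrow> real" and J
  proof -
    have a: "h absolutely_integrable_on {0<..} \<longleftrightarrow> integrable lborel (\<lambda>x. indicator {0<..} x * h x)"
      unfolding set_integrable_def by (subst integrable_completion) auto
    have "integral {0<..} h = (\<integral>x. indicator {0<..} x * h x \<partial>lborel)" if "h absolutely_integrable_on {0<..}"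
      unfolding set_lebesgue_integral_eq_integral(2)[OF that, symmetric] set_lebesgue_integral_def
      by (subst integral_completion) auto
    thus ?thesis using a by (auto simp: has_bochner_integral_iff)
  qed
  have "f absolutely_integrable_on (g ` {0<..}) \<and> integral (g ` {0<..}) f = I"
    unfolding img using I by (subst conv) (auto simp: f_def)
  hence "(\<lambda>y. \<bar>y powr (lam - 1)\<bar> * f (g y)) absolutely_integrable_on {0<..} \<and>
      integral {0<..} (\<lambda>y. \<bar>y powr (lam - 1)\<bar> * f (g y)) = I"
    using has_absolute_integral_change_of_variables_1'[OF _ g' inj] by auto
  hence "has_integral_pos (\<lambda>y. \<bar>y powr (lam - 1)\<bar> * f (g y)) I"
    by (subst (asm) conv) (auto simp: g_def)
  hence "has_bochner_integral lborel (\<lambda>y. lam powr (1 / lam - 1) * (indicator {0<..} y * (\<bar>y powr (lam - 1)\<bar> * f (g y))))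
     (lam powr (1 / lam - 1) * I)"
    by (rule has_bochner_integral_mult_right)
  moreover have "lam powr (1 / lam - 1) * (indicator {0<..} y * (\<bar>y powr (lam - 1)\<bar> * f (g y))) =
      indicator {0<..} y * (F (y powr lam / lam) * exp (- (y powr lam / lam)))" for y
  proof (cases "y > 0")
    case True
    have "(y powr lam / lam) powr (1 / lam - 1) = y powr (1 - lam) / lam powr (1 / lam - 1)"
      using True lam by (simp add: powr_divide powr_powr right_diff_distrib)
    hence "lam powr (1 / lam - 1) * (y powr (lam - 1) * (y powr lam / lam) powr (1 / lam - 1)) = 1"
      using True lam by (simp flip: powr_add)
    hence "lam powr (1 / lam - 1) * (y powr (lam - 1) * (y powr lam / lam) powr (1 / lam - 1)) * X = X" for X by simp
    from this[of "F (y powr lam / lam) * exp (- (y powr lam / lam))"] show ?thesis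
      using True by (simp add: f_def g_def mult_ac)
  qed simp
  ultimately show ?thesis by (simp only:)
qed

section \<open>The standard exponential power distribution\<close>

lemma powr_le_exp:
  fixes p c :: real
  assumes "p \<ge> 0" "c > 0"
  obtains C where "C > 0" "\<And>r. r \<ge> 0 \<Longrightarrow> r powr p \<le> C * exp (c * r)"
proof (cases "p = 0")
  case True
  show ?thesis using assms True by (intro that[of 1]) (auto simp: powr_def)
next
  case p: False
  \<comment> \<open>Chosen so that \<open>p * (r / k) = c * r\<close> in the tangent bound for
    \<open>ln (r / k)\<close>.\<close>
  define k where "k = p / c"
  have k: "k > 0" using assms p by (simp add: k_def)
  have "r powr p \<le> exp (p * ln k) * exp (c * r)" if "r \<ge> 0" for r
  proof (cases "r = 0")
    case False
    with that have r: "r > 0" by simp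
    have "ln (r / k) \<le> r / k - 1" using r k by (intro ln_le_minus_one) simp
    hence "p * ln r \<le> p * (ln k + r / k - 1)"
      using r k assms by (intro mult_left_mono) (auto simp: ln_div)
    also have "\<dots> \<le> p * ln k + c * r"
      using p k assms by (simp add: k_def algebra_simps)
    finally show ?thesis using r by (simp add: powr_def flip: exp_add)
  qed (use p in simp)
  thus ?thesis by (intro that[of "exp (p * ln k)"]) auto
qed

lemma integrable_exp_minus_abs:
  assumes "c > 0"
  shows "integrable lborel (\<lambda>y::real. exp (- (c * \<bar>y\<bar>)))"
proof -
  have 1: "integrable lborel (\<lambda>t. indicator {0<..} t * exp (- t) :: real)"
    using has_bochner_integral_Gamma[of 1]
    by (auto simp: has_bochner_integral_iff indicator_def if_distrib cong: if_cong
        elim!: Bochner_Integration.integrable_cong[THEN iffD1, rotated 2])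
  have 2: "integrable lborel (\<lambda>y. indicator {0<..} (0 + c * y) * exp (- (0 + c * y)) :: real)"
    "integrable lborel (\<lambda>y. indicator {0<..} (0 + (- c) * y) * exp (- (0 + (- c) * y)) :: real)"
    using lborel_integrable_real_affine[OF 1, of c 0] lborel_integrable_real_affine[OF 1, of "- c" 0] assms by auto
  have "AE y in lborel. indicator {0<..} (0 + c * y) * exp (- (0 + c * y)) + indicator {0<..} (0 + (- c) * y) * exp (- (0 + (- c) * y))
     = exp (- (c * \<bar>y\<bar>))"
    using AE_lborel_singleton[of "0::real"]
  proof eventually_elim
    case (elim y)
    thus ?case using assms by (cases "y > 0") (auto simp: indicator_def zero_less_mult_iff mult_less_0_iff)
  qed
  thus ?thesis
    using Bochner_Integration.integrable_add[OF 2] by (subst (asm) integrable_cong_AE) auto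
qed

lemma tendsto_divide_sqrt: "(\<lambda>n. t / sqrt (real n)) \<longlonglongrightarrow> 0"
  by (intro tendsto_divide_0[OF tendsto_const] filterlim_at_top_imp_at_infinity
      filterlim_compose[OF sqrt_at_top] filterlim_real_sequentially)

lemma abs_divide_sqrt_le: "\<bar>t / sqrt (real n)\<bar> \<le> \<bar>t\<bar>"
  by (cases "n = 0") (auto simp: abs_divide divide_le_eq mult_le_cancel_left1)

locale epd =
  fixes lam :: real
  assumes lam: "lam \<ge> 1"
begin

definition norm_const :: real where "norm_const = 1 / (2 * lam powr (1 / lam) * Gamma (1 + 1 / lam))"
definition dens :: "real \<Rightarrow> real" where "dens y = norm_const * exp (- (\<bar>y\<bar> powr lam / lam))"
definition psi :: "real \<Rightarrow> real" where "psi y = \<bar>y\<bar> powr (lam - 1) * sgn y"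
definition mean :: "(real \<Rightarrow> real) \<Rightarrow> real" where "mean f = (\<integral>y. f y * dens y \<partial>lborel)"
text \<open>The rate 1/8 leaves room: a product of two such functions grows at most like
  \<open>exp (\<bar>y\<bar> / 4)\<close>, while the density decays at least like
  \<open>exp (- \<bar>y\<bar>)\<close> and its increments like
  \<open>exp (- (7 / 8 * \<bar>y\<bar>))\<close>.\<close>

definition slow :: "(real \<Rightarrow> real) \<Rightarrow> bool" where
  "slow h \<longleftrightarrow> h \<in> borel_measurable borel \<and> (\<exists>C. \<forall>y. \<bar>h y\<bar> \<le> C * exp (\<bar>y\<bar> / 8))"

lemma dens_eq: "dens y = epd_density lam 0 1 y"
  by (simp add: dens_def epd_density_def norm_const_def)

lemma lam_pos: "lam > 0" using lam by simp

lemma norm_const_pos: "norm_const > 0"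
proof -
  have "Gamma (1 + 1 / lam) > 0" using lam by (intro Gamma_real_pos) (simp add: add_pos_nonneg)
  thus ?thesis using lam by (simp add: norm_const_def)
qed

lemma dens_pos: "dens y > 0"
  using norm_const_pos by (simp add: dens_def)

lemma dens_nonneg: "0 \<le> dens y"
  using dens_pos by (rule less_imp_le)

lemma dens_measurable [measurable]: "dens \<in> borel_measurable borel"
  unfolding dens_def by measurable

lemma psi_measurable [measurable]: "psi \<in> borel_measurable borel"
  unfolding psi_def by measurable

lemma dens_minus: "dens (- y) = dens y"
  by (simp add: dens_def)

lemma dens_abs: "dens \<bar>y\<bar> = dens y"
  by (simp add: dens_def)

text \<open>A decay rate common to all \<open>lam \<ge> 1\<close>: the convex function
  \<open>y powr lam / lam\<close> has slope 1 at \<open>y = 1\<close> and therefore lies above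
  \<open>y - 1\<close>. The offset 1 becomes the factor \<open>exp 1\<close>.\<close>

lemma dens_le: "dens y \<le> norm_const * exp 1 * exp (- \<bar>y\<bar>)"
proof -
  have key: "y - 1 \<le> y powr lam / lam" if "y > 0" for y :: real
  proof -
    have "- ln y \<le> 1 / y - 1"
      using ln_le_minus_one[of "1 / y"] that by (simp add: ln_div)
    hence l: "y * ln y \<ge> y - 1" using that by (simp add: field_simps)
    have "lam * y - (lam - 1) = y + (lam - 1) * (y - 1)" by (simp add: algebra_simps)
    also have "\<dots> \<le> y + (lam - 1) * (y * ln y)"
      using l lam by (intro add_left_mono mult_left_mono) auto
    also have "\<dots> = y * (1 + (lam - 1) * ln y)" by (simp add: algebra_simps)
    also have "\<dots> \<le> y * exp ((lam - 1) * ln y)"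
      using that by (intro mult_left_mono exp_ge_add_one_self) auto
    also have "\<dots> = y powr lam"
      using that powr_add[of y 1 "lam - 1"] by (simp add: powr_def)
    finally have "lam * (y - 1) \<le> y powr lam" using lam by (simp add: algebra_simps)
    thus ?thesis using lam_pos by (simp add: field_simps)
  qed
  have "\<bar>y\<bar> - 1 \<le> \<bar>y\<bar> powr lam / lam"
    using key[of "\<bar>y\<bar>"] lam_pos by (cases "y = 0") auto
  hence "exp (- (\<bar>y\<bar> powr lam / lam)) \<le> exp (1 + - \<bar>y\<bar>)" by simp
  also have "\<dots> = exp 1 * exp (- \<bar>y\<bar>)" by (rule exp_add)
  finally show ?thesis
    using norm_const_pos by (simp add: dens_def)
qed

lemma slowI: "h \<in> borel_measurable borel \<Longrightarrow> (\<And>y. \<bar>h y\<bar> \<le> C * exp (\<bar>y\<bar> / 8)) \<Longrightarrow> slow h"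
  unfolding slow_def by blast

lemma slow_measurable [measurable_dest]: "slow h \<Longrightarrow> h \<in> borel_measurable borel"
  unfolding slow_def by blast

lemma slowE:
  assumes "slow h"
  obtains C where "C > 0" "\<And>y. \<bar>h y\<bar> \<le> C * exp (\<bar>y\<bar> / 8)"
proof -
  obtain C where C: "\<And>y. \<bar>h y\<bar> \<le> C * exp (\<bar>y\<bar> / 8)"
    using assms unfolding slow_def by blast
  have "\<bar>h y\<bar> \<le> (\<bar>C\<bar> + 1) * exp (\<bar>y\<bar> / 8)" for y
    by (rule order_trans[OF C]) (intro mult_right_mono; simp)
  thus ?thesis by (intro that[of "\<bar>C\<bar> + 1"]) auto
qed

lemma slow_const: "slow (\<lambda>_. c)"
proof (rule slowI)
  show "\<bar>c\<bar> \<le> \<bar>c\<bar> * exp (\<bar>y\<bar> / 8)" for y :: real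
    using mult_left_mono[of 1 "exp (\<bar>y\<bar> / 8)" "\<bar>c\<bar>"] by simp
qed simp

lemma slow_add: "slow h \<Longrightarrow> slow k \<Longrightarrow> slow (\<lambda>y. h y + k y)"
proof -
  assume hk: "slow h" "slow k"
  obtain C D where C: "\<And>y. \<bar>h y\<bar> \<le> C * exp (\<bar>y\<bar> / 8)" and D: "\<And>y. \<bar>k y\<bar> \<le> D * exp (\<bar>y\<bar> / 8)"
    using slowE[OF hk(1)] slowE[OF hk(2)] by metis
  show ?thesis
  proof (rule slowI)
    show "\<bar>h y + k y\<bar> \<le> (C + D) * exp (\<bar>y\<bar> / 8)" for y
      using C[of y] D[of y] by (simp add: distrib_right)
  qed (use hk in measurable)
qed

lemma slow_cmult: "slow h \<Longrightarrow> slow (\<lambda>y. c * h y)"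
proof -
  assume h: "slow h"
  obtain C where C: "\<And>y. \<bar>h y\<bar> \<le> C * exp (\<bar>y\<bar> / 8)" using slowE[OF h] by metis
  show ?thesis
  proof (rule slowI)
    show "\<bar>c * h y\<bar> \<le> (\<bar>c\<bar> * C) * exp (\<bar>y\<bar> / 8)" for y
      using mult_left_mono[OF C abs_ge_zero, of c y] by (simp add: abs_mult mult.assoc)
  qed (use h in measurable)
qed

lemma slow_diff: "slow h \<Longrightarrow> slow k \<Longrightarrow> slow (\<lambda>y. h y - k y)"
  using slow_add[of h "\<lambda>y. - 1 * k y"] slow_cmult[of k "- 1"] by simp

lemma slow_bound: "slow k \<Longrightarrow> h \<in> borel_measurable borel \<Longrightarrow> (\<And>y. \<bar>h y\<bar> \<le> k y) \<Longrightarrow> slow h"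
  by (elim slowE, rule slowI) (auto intro: order_trans[OF _ order_trans[OF abs_ge_self]])

lemma slow_powr: "p \<ge> 0 \<Longrightarrow> slow (\<lambda>y. \<bar>y\<bar> powr p)"
proof -
  assume "p \<ge> 0"
  then obtain C where "\<And>r. r \<ge> 0 \<Longrightarrow> r powr p \<le> C * exp (1 / 8 * r)"
    using powr_le_exp[of p "1/8"] by auto
  thus ?thesis by (intro slowI[of _ C]) auto
qed

lemma slow_psi: "slow psi"
  by (rule slow_bound[OF slow_powr[of "lam - 1"]]) (use lam in \<open>auto simp: psi_def abs_mult abs_sgn_eq\<close>)

lemma integrable_dens_bound:
  assumes "f \<in> borel_measurable borel" and "\<And>y. \<bar>f y\<bar> \<le> C * exp (\<bar>y\<bar> / 2)"
  shows "integrable lborel (\<lambda>y. f y * dens y)"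
proof (rule Bochner_Integration.integrable_bound)
  show "integrable lborel (\<lambda>y. (C * norm_const * exp 1) * exp (- (1/2 * \<bar>y\<bar>)) :: real)"
    by (intro integrable_mult_right integrable_exp_minus_abs) simp
  have "\<bar>f y * dens y\<bar> \<le> (C * norm_const * exp 1) * exp (- (1/2 * \<bar>y\<bar>))" for y
  proof -
    have "\<bar>f y * dens y\<bar> \<le> (C * exp (\<bar>y\<bar> / 2)) * (norm_const * exp 1 * exp (- \<bar>y\<bar>))"
      unfolding abs_mult abs_of_pos[OF dens_pos] using order_trans[OF abs_ge_zero assms(2)] norm_const_pos
      by (intro mult_mono assms dens_le) (auto simp: dens_nonneg)
    also have "\<dots> = (C * norm_const * exp 1) * (exp (\<bar>y\<bar> / 2) * exp (- \<bar>y\<bar>))" by simp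
    also have "exp (\<bar>y\<bar> / 2) * exp (- \<bar>y\<bar>) = exp (- (1/2 * \<bar>y\<bar>))" by (simp flip: exp_add)
    finally show ?thesis .
  qed
  thus "AE y in lborel. norm (f y * dens y) \<le> norm ((C * norm_const * exp 1) * exp (- (1/2 * \<bar>y\<bar>)))"
    by (auto intro: order_trans[OF _ abs_ge_self])
qed (use assms in measurable)

lemma integrable_dens_slow_mult:
  assumes h: "slow h" and k: "slow k"
  shows "integrable lborel (\<lambda>y. h y * k y * dens y)"
proof -
  obtain C D where C: "C > 0" "\<And>y. \<bar>h y\<bar> \<le> C * exp (\<bar>y\<bar> / 8)" and D: "D > 0" "\<And>y. \<bar>k y\<bar> \<le> D * exp (\<bar>y\<bar> / 8)"
    using slowE[OF h] slowE[OF k] by metis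
  show ?thesis
  proof (rule integrable_dens_bound)
    show "\<bar>h y * k y\<bar> \<le> (C * D) * exp (\<bar>y\<bar> / 2)" for y
    proof -
      have "\<bar>h y * k y\<bar> \<le> (C * exp (\<bar>y\<bar> / 8)) * (D * exp (\<bar>y\<bar> / 8))"
        unfolding abs_mult using C(1) by (intro mult_mono C D) auto
      also have "\<dots> = (C * D) * exp (\<bar>y\<bar> / 4)" by (simp add: mult_ac flip: exp_add)
      also have "\<dots> \<le> (C * D) * exp (\<bar>y\<bar> / 2)" using C D by (intro mult_left_mono) auto
      finally show ?thesis .
    qed
  qed (use h k in measurable)
qed

lemma integrable_dens_slow: "slow h \<Longrightarrow> integrable lborel (\<lambda>y. h y * dens y)"
  using integrable_dens_slow_mult[OF _ slow_const[of 1], of h] by simp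

lemma mean_odd:
  assumes "\<And>y. f (- y) = - f y"
  shows "mean f = 0"
proof -
  have "mean f = (\<integral>y. f (0 + (-1) * y) * dens (0 + (-1) * y) \<partial>lborel)"
    unfolding mean_def by (subst lborel_integral_real_affine[where c="-1" and t=0]) auto
  also have "\<dots> = - mean f"
    by (simp add: assms dens_minus mean_def)
  finally show ?thesis by simp
qed

text \<open>At 0 the density has a kink when \<open>lam = 1\<close>. Later uses stay away from 0 or
  discard it as a null set.\<close>

lemma dens_has_derivative:
  assumes "y \<noteq> 0"
  shows "(dens has_real_derivative (- psi y * dens y)) (at y)"
proof -
  have G: "((\<lambda>r. norm_const * exp (- (r powr lam / lam))) has_real_derivative (- (\<bar>y\<bar> powr (lam - 1)) * dens y)) (at \<bar>y\<bar>)"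
    using assms lam_pos by (auto intro!: derivative_eq_intros simp: dens_def)
  have A: "((\<lambda>y. \<bar>y\<bar>) has_real_derivative sgn y) (at y)"
  proof (cases "y > 0")
    case True
    show ?thesis
      by (rule DERIV_cong[OF has_field_derivative_transform_within_open[OF DERIV_ident, where S="{0<..}"]]) (use True in auto)
  next
    case False
    have "((\<lambda>y. - y) has_real_derivative - 1) (at y)" by (auto intro!: derivative_eq_intros)
    thus ?thesis
      by (rule DERIV_cong[OF has_field_derivative_transform_within_open[where S="{..<0}"]]) (use False assms in auto)
  qed
  show ?thesis
    using DERIV_chain2[OF G A] unfolding dens_def psi_def by (simp add: mult_ac)
qed

text \<open>By symmetry \<open>y\<close> and \<open>y + u\<close> may be replaced by their absolute
  values, so the mean value theorem runs on the half line, with the kink at most at an endpoint. The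
  derivative there is of order \<open>exp (z / 8) * exp (- z)\<close>.\<close>

lemma dens_lipschitz:
  obtains C where "C > 0" "\<And>y u. \<bar>dens (y + u) - dens y\<bar> \<le> \<bar>u\<bar> * (C * exp \<bar>u\<bar> * exp (- (7 / 8 * \<bar>y\<bar>)))"
proof -
  obtain C where C: "C > 0" "\<And>r. r \<ge> 0 \<Longrightarrow> r powr (lam - 1) \<le> C * exp (1 / 8 * r)"
    using powr_le_exp[of "lam - 1" "1/8"] lam by auto
  define D where "D = C * norm_const * exp 1"
  have D: "D > 0" using C norm_const_pos by (simp add: D_def)
  have main: "\<bar>dens b - dens a\<bar> \<le> (b - a) * (D * exp (- (7 / 8 * a)))" if ab: "0 \<le> a" "a < b" for a b
  proof -
    have "\<exists>l z. a < z \<and> z < b \<and> (dens has_real_derivative l) (at z) \<and> dens b - dens a = (b - a) * l"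
    proof (rule MVT[OF ab(2)])
      have "continuous_on {a..b} (\<lambda>y. norm_const * exp (- (y powr lam / lam)))"
        using lam_pos ab by (intro continuous_intros continuous_on_powr') auto
      thus "continuous_on {a..b} dens"
        by (rule continuous_on_eq) (use ab in \<open>auto simp: dens_def\<close>)
      show "dens differentiable (at x)" if "a < x" "x < b" for x
        using dens_has_derivative[of x] that ab real_differentiable_def by fastforce
    qed
    then obtain l z where z: "a < z" "z < b" "(dens has_real_derivative l) (at z)" "dens b - dens a = (b - a) * l" by blast
    have "l = - psi z * dens z"
      using DERIV_unique[OF z(3) dens_has_derivative] z ab by auto
    hence "\<bar>l\<bar> = z powr (lam - 1) * dens z"
      using z ab dens_nonneg[of z] by (simp add: psi_def abs_mult)
    also have "\<dots> \<le> (C * exp (1 / 8 * z)) * (norm_const * exp 1 * exp (- \<bar>z\<bar>))"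
      using z ab C by (intro mult_mono C dens_le) (auto simp: dens_nonneg)
    also have "\<dots> = D * (exp (1 / 8 * z) * exp (- z))"
      using z ab by (simp add: D_def)
    also have "exp (1 / 8 * z) * exp (- z) = exp (- (7 / 8 * z))" by (simp flip: exp_add)
    also have "D * exp (- (7 / 8 * z)) \<le> D * exp (- (7 / 8 * a))" using z D by simp
    finally show ?thesis using z ab by (simp add: abs_mult)
  qed
  have "\<bar>dens (y + u) - dens y\<bar> \<le> \<bar>u\<bar> * (D * exp \<bar>u\<bar> * exp (- (7 / 8 * \<bar>y\<bar>)))" for y u
  proof -
    define a b where "a = min \<bar>y\<bar> \<bar>y + u\<bar>" and "b = max \<bar>y\<bar> \<bar>y + u\<bar>"
    have eq: "\<bar>dens (y + u) - dens y\<bar> = \<bar>dens b - dens a\<bar>"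
      unfolding a_def b_def by (auto simp: min_def max_def dens_abs abs_minus_commute)
    have bau: "b - a \<le> \<bar>u\<bar>" "0 \<le> a" "a \<le> b" "\<bar>y\<bar> - \<bar>u\<bar> \<le> a"
      unfolding a_def b_def by (auto simp: min_def max_def)
    have "\<bar>dens b - dens a\<bar> \<le> (b - a) * (D * exp (- (7 / 8 * a)))"
      using main[of a b] bau by (cases "a = b") auto
    \<comment> \<open>Since \<open>\<bar>y\<bar> - \<bar>u\<bar> \<le> a\<close>, measuring the
      decay at \<open>y\<close> instead of \<open>a\<close> costs at most a factor
      \<open>exp \<bar>u\<bar>\<close>.\<close>
    also have "\<dots> \<le> \<bar>u\<bar> * (D * exp (\<bar>u\<bar> + - (7 / 8 * \<bar>y\<bar>)))"
      using bau D by (intro mult_mono) auto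
    also have "\<dots> = \<bar>u\<bar> * (D * exp \<bar>u\<bar> * exp (- (7 / 8 * \<bar>y\<bar>)))" by (simp add: mult.assoc flip: exp_add)
    finally show ?thesis using eq by simp
  qed
  thus ?thesis using that D by blast
qed

lemma slow_shift: "slow h \<Longrightarrow> slow (\<lambda>y. h (y - u))"
proof -
  assume h: "slow h"
  obtain C where C: "C > 0" "\<And>y. \<bar>h y\<bar> \<le> C * exp (\<bar>y\<bar> / 8)" using slowE[OF h] by metis
  show ?thesis
  proof (rule slowI)
    show "\<bar>h (y - u)\<bar> \<le> (C * exp (\<bar>u\<bar> / 8)) * exp (\<bar>y\<bar> / 8)" for y
    proof -
      have "\<bar>h (y - u)\<bar> \<le> C * exp (\<bar>y - u\<bar> / 8)" by (rule C)
      also have "\<dots> \<le> C * exp (\<bar>u\<bar> / 8 + \<bar>y\<bar> / 8)" using C(1) by (intro mult_left_mono) auto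
      finally show ?thesis by (simp add: exp_add)
    qed
    show "(\<lambda>y. h (y - u)) \<in> borel_measurable borel"
      using slow_measurable[OF h] by measurable
  qed
qed

text \<open>Substitution moves the shift from \<open>h\<close> to the density, so \<open>h\<close> need not be smooth.\<close>

lemma mean_shift_derivative:
  assumes h: "slow h"
  shows "(\<lambda>n. sqrt (real n) * mean (\<lambda>y. h (y - t / sqrt (real n)) - h y)) \<longlonglongrightarrow> - t * mean (\<lambda>y. h y * psi y)"
proof (cases "t = 0")
  case False
  note [measurable] = slow_measurable[OF h]
  define u where "u n = t / sqrt (real n)" for n
  have u_le: "\<bar>u n\<bar> \<le> \<bar>t\<bar>" for n
    unfolding u_def by (rule abs_divide_sqrt_le)
  have u0: "u \<longlonglongrightarrow> 0"
    unfolding u_def by (rule tendsto_divide_sqrt)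
  have su: "sqrt (real n) * u n = t" if "n > 0" for n using that by (simp add: u_def)
  obtain C where C: "C > 0" "\<And>y. \<bar>h y\<bar> \<le> C * exp (\<bar>y\<bar> / 8)" using slowE[OF h] by metis
  obtain D where D: "D > 0" "\<And>y u. \<bar>dens (y + u) - dens y\<bar> \<le> \<bar>u\<bar> * (D * exp \<bar>u\<bar> * exp (- (7 / 8 * \<bar>y\<bar>)))"
    using dens_lipschitz by metis
  \<comment> \<open>\<open>exp (\<bar>y\<bar> / 8)\<close> from \<open>h\<close> against
    \<open>exp (- (7 / 8 * \<bar>y\<bar>))\<close> from the density leaves the exponent
    \<open>- 3/4\<close>.\<close>
  define w where "w y = (C * (\<bar>t\<bar> * (D * exp \<bar>t\<bar>))) * exp (- (3 / 4 * \<bar>y\<bar>))" for y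
  have eq: "sqrt (real n) * mean (\<lambda>y. h (y - u n) - h y) = (\<integral>y. h y * (sqrt (real n) * (dens (y + u n) - dens y)) \<partial>lborel)" for n
  proof -
    have i1: "integrable lborel (\<lambda>y. h (y - u n) * dens y)" and i2: "integrable lborel (\<lambda>y. h y * dens y)"
      by (intro integrable_dens_slow slow_shift h)+
    have i3: "integrable lborel (\<lambda>y. h y * dens (y + u n))"
      using lborel_integrable_real_affine[OF i1, of 1 "u n"] by (simp add: add.commute)
    have "mean (\<lambda>y. h (y - u n) - h y) = (\<integral>y. h (y - u n) * dens y \<partial>lborel) - (\<integral>y. h y * dens y \<partial>lborel)"
      using i1 i2 by (simp add: mean_def left_diff_distrib)
    also have "(\<integral>y. h (y - u n) * dens y \<partial>lborel) = (\<integral>y. h y * dens (y + u n) \<partial>lborel)"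
      by (subst lborel_integral_real_affine[where c=1 and t="u n"]) (auto simp: add.commute)
    also have "\<dots> - (\<integral>y. h y * dens y \<partial>lborel) = (\<integral>y. h y * (dens (y + u n) - dens y) \<partial>lborel)"
      using i2 i3 by (simp add: right_diff_distrib)
    finally have "sqrt (real n) * mean (\<lambda>y. h (y - u n) - h y) = (\<integral>y. sqrt (real n) * (h y * (dens (y + u n) - dens y)) \<partial>lborel)"
      by simp
    thus ?thesis by (simp add: mult.left_commute)
  qed
  have "(\<lambda>n. \<integral>y. h y * (sqrt (real n) * (dens (y + u n) - dens y)) \<partial>lborel) \<longlonglongrightarrow> (\<integral>y. h y * (t * (- psi y * dens y)) \<partial>lborel)"
  proof (rule integral_dominated_convergence[where w=w])
    show "integrable lborel w"
      unfolding w_def by (intro integrable_mult_right integrable_exp_minus_abs) simp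
    show "AE y in lborel. (\<lambda>n. h y * (sqrt (real n) * (dens (y + u n) - dens y))) \<longlonglongrightarrow> h y * (t * (- psi y * dens y))"
      using AE_lborel_singleton[of "0::real"]
    proof eventually_elim
      case (elim y)
      have "((\<lambda>h. (dens (y + h) - dens y) / h) \<longlongrightarrow> - psi y * dens y) (at 0)"
        using dens_has_derivative[OF elim] by (simp add: DERIV_def)
      \<comment> \<open>The index is shifted because \<open>u 0 = t / sqrt 0\<close> is 0, while the
        sequence has to avoid 0.\<close>
      hence "(\<lambda>n. (dens (y + u (Suc n)) - dens y) / u (Suc n)) \<longlonglongrightarrow> - psi y * dens y"
        by (rule tendsto_at_0_seq[OF _ LIMSEQ_Suc[OF u0]]) (use False in \<open>auto simp: u_def\<close>)
      hence "(\<lambda>n. h y * (t * ((dens (y + u (Suc n)) - dens y) / u (Suc n)))) \<longlonglongrightarrow> h y * (t * (- psi y * dens y))"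
        by (intro tendsto_mult tendsto_const)
      moreover have "t * ((dens (y + u (Suc n)) - dens y) / u (Suc n)) = sqrt (real (Suc n)) * (dens (y + u (Suc n)) - dens y)" for n
        using su[of "Suc n"] False by (auto simp: field_simps u_def simp del: of_nat_Suc)
      ultimately have "(\<lambda>n. h y * (sqrt (real (Suc n)) * (dens (y + u (Suc n)) - dens y))) \<longlonglongrightarrow> h y * (t * (- psi y * dens y))"
        by (simp only:)
      thus ?case by (rule LIMSEQ_imp_Suc)
    qed
    show "AE y in lborel. norm (h y * (sqrt (real n) * (dens (y + u n) - dens y))) \<le> w y" for n
    proof (rule AE_I2)
      fix y
      have "\<bar>sqrt (real n) * (dens (y + u n) - dens y)\<bar> \<le> sqrt (real n) * (\<bar>u n\<bar> * (D * exp \<bar>u n\<bar> * exp (- (7 / 8 * \<bar>y\<bar>))))"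
        unfolding abs_mult abs_of_nonneg[OF real_sqrt_ge_zero[OF of_nat_0_le_iff]]
        by (intro mult_left_mono D) auto
      also have "\<dots> = \<bar>sqrt (real n) * u n\<bar> * (D * exp \<bar>u n\<bar> * exp (- (7 / 8 * \<bar>y\<bar>)))"
        by (simp add: abs_mult)
      also have "\<dots> \<le> \<bar>t\<bar> * (D * exp \<bar>t\<bar> * exp (- (7 / 8 * \<bar>y\<bar>)))"
        using D u_le[of n] su[of n] by (cases "n = 0") (auto intro!: mult_mono)
      finally have "\<bar>h y * (sqrt (real n) * (dens (y + u n) - dens y))\<bar> \<le>
         (C * exp (\<bar>y\<bar> / 8)) * (\<bar>t\<bar> * (D * exp \<bar>t\<bar> * exp (- (7 / 8 * \<bar>y\<bar>))))"
        unfolding abs_mult[of "h y"] using C by (intro mult_mono C) auto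
      also have "\<dots> = (C * (\<bar>t\<bar> * (D * exp \<bar>t\<bar>))) * (exp (\<bar>y\<bar> / 8) * exp (- (7 / 8 * \<bar>y\<bar>)))" by (simp only: mult_ac)
      also have "exp (\<bar>y\<bar> / 8) * exp (- (7 / 8 * \<bar>y\<bar>)) = exp (- (3 / 4 * \<bar>y\<bar>))" by (simp flip: exp_add)
      finally show "norm (h y * (sqrt (real n) * (dens (y + u n) - dens y))) \<le> w y"
        by (simp add: w_def)
    qed
  qed measurable
  moreover have "(\<integral>y. h y * (t * (- psi y * dens y)) \<partial>lborel) = - t * mean (\<lambda>y. h y * psi y)"
  proof -
    have "h y * (t * (- psi y * dens y)) = - t * (h y * psi y * dens y)" for y by simp
    thus ?thesis by (simp only: mean_def integral_mult_right_zero)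
  qed
  ultimately show ?thesis using eq unfolding u_def by (simp only:)
qed (simp add: mean_def)

text \<open>Bounds the variance of the increments of shifted sums. Continuity off 0 suffices for
  dominated convergence, which admits the jump of \<open>psi\<close> at
  \<open>lam = 1\<close>.\<close>

lemma mean_square_shift:
  assumes h: "slow h" and cont: "\<And>y. y \<noteq> 0 \<Longrightarrow> isCont h y"
  shows "(\<lambda>n. mean (\<lambda>y. (h (y - t / sqrt (real n)) - h y)\<^sup>2)) \<longlonglongrightarrow> 0"
proof -
  note [measurable] = slow_measurable[OF h]
  define u where "u n = t / sqrt (real n)" for n
  have u_le: "\<bar>u n\<bar> \<le> \<bar>t\<bar>" for n
    unfolding u_def by (rule abs_divide_sqrt_le)
  have u0: "u \<longlonglongrightarrow> 0"
    unfolding u_def by (rule tendsto_divide_sqrt)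
  obtain C where C: "C > 0" "\<And>y. \<bar>h y\<bar> \<le> C * exp (\<bar>y\<bar> / 8)" using slowE[OF h] by metis
  define k where "k y = C * exp (\<bar>t\<bar> / 8) * exp (\<bar>y\<bar> / 8) + C * exp (\<bar>y\<bar> / 8)" for y :: real
  have k: "slow k"
    unfolding k_def using C(1) by (intro slow_add) (auto intro!: slowI)
  have bd: "\<bar>h (y - u n) - h y\<bar> \<le> k y" for y n
  proof -
    have "\<bar>h (y - u n)\<bar> \<le> C * exp (\<bar>y - u n\<bar> / 8)" by (rule C)
    also have "\<dots> \<le> C * exp (\<bar>t\<bar> / 8 + \<bar>y\<bar> / 8)"
      using C(1) u_le[of n] by (intro mult_left_mono) (auto simp: add_divide_distrib[symmetric])
    finally show ?thesis using C(2)[of y] by (simp add: k_def exp_add)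
  qed
  have "(\<lambda>n. \<integral>y. (h (y - u n) - h y)\<^sup>2 * dens y \<partial>lborel) \<longlonglongrightarrow> (\<integral>y. 0 \<partial>(lborel :: real measure))"
  proof (rule integral_dominated_convergence[where f="\<lambda>_. 0 :: real" and w="\<lambda>y. k y * k y * dens y"])
    show "integrable lborel (\<lambda>y. k y * k y * dens y)" by (rule integrable_dens_slow_mult[OF k k])
    show "AE y in lborel. (\<lambda>n. (h (y - u n) - h y)\<^sup>2 * dens y) \<longlonglongrightarrow> 0"
      using AE_lborel_singleton[of "0::real"]
    proof eventually_elim
      case (elim y)
      have "(\<lambda>n. y - u n) \<longlonglongrightarrow> y - 0" by (intro tendsto_intros u0)
      hence "(\<lambda>n. h (y - u n)) \<longlonglongrightarrow> h y"
        using isCont_tendsto_compose[OF cont[OF elim]] by simp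
      hence "(\<lambda>n. (h (y - u n) - h y)\<^sup>2 * dens y) \<longlonglongrightarrow> (h y - h y)\<^sup>2 * dens y" by (intro tendsto_intros)
      thus ?case by simp
    qed
    have "(h (y - u n) - h y)\<^sup>2 \<le> k y * k y" for y n
      using power_mono[OF bd[of y n] abs_ge_zero, of 2] by (simp add: power2_eq_square)
    thus "AE y in lborel. norm ((h (y - u n) - h y)\<^sup>2 * dens y) \<le> k y * k y * dens y" for n
      by (auto simp: dens_nonneg abs_mult intro!: mult_right_mono)
  qed measurable
  thus ?thesis by (simp add: mean_def u_def)
qed

end

section \<open>Moments through the Gamma distribution\<close>

lemma (in epd) mean_power_transform:
  fixes F :: "real \<Rightarrow> real"
  assumes [measurable]: "F \<in> borel_measurable borel"
    and I: "has_integral_pos (\<lambda>t. F t * t powr (1 / lam - 1) * exp (- t)) I"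
  shows "mean (\<lambda>y. F (\<bar>y\<bar> powr lam / lam)) = I / Gamma (1 / lam)"
proof -
  define h where "h y = indicator {0<..} y * (F (y powr lam / lam) * exp (- (y powr lam / lam)))" for y :: real
  define J where "J = lam powr (1 / lam - 1) * I"
  have 1: "has_bochner_integral lborel h J"
    unfolding h_def J_def by (rule has_bochner_integral_power_substitution[OF lam_pos _ I]) simp
  hence 2: "has_bochner_integral lborel (\<lambda>y. h (0 + (- 1) * y)) J"
    using lborel_has_bochner_integral_real_affine_iff[of "- 1" h J 0] by simp
  have "has_bochner_integral lborel (\<lambda>y. norm_const * (h y + h (0 + (- 1) * y))) (norm_const * (J + J))"
    by (intro has_bochner_integral_mult_right has_bochner_integral_add 1 2)
  hence "(\<integral>y. norm_const * (h y + h (0 + (- 1) * y)) \<partial>lborel) = norm_const * (J + J)"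
    by (rule has_bochner_integral_integral_eq)
  also have "(\<integral>y. norm_const * (h y + h (0 + (- 1) * y)) \<partial>lborel) = mean (\<lambda>y. F (\<bar>y\<bar> powr lam / lam))"
    unfolding mean_def
  proof (rule integral_cong_AE)
    show "AE y in lborel. norm_const * (h y + h (0 + (- 1) * y)) = F (\<bar>y\<bar> powr lam / lam) * dens y"
      using AE_lborel_singleton[of "0::real"]
    proof eventually_elim
      case (elim y)
      thus ?case by (cases "y > 0") (auto simp: h_def dens_def)
    qed
  qed (simp_all add: h_def)
  \<comment> \<open>The two half lines give \<open>J + J\<close>; with
    \<open>Gamma (1 + 1 / lam) = Gamma (1 / lam) / lam\<close> all powers of \<open>lam\<close>
    cancel.\<close>
  also have "norm_const * (J + J) = I / Gamma (1 / lam)"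
  proof -
    have "Gamma (1 / lam + 1) = (1 / lam) * Gamma (1 / lam)"
      using lam by (intro Gamma_plus1 pos_notin_nonpos_Ints) simp
    hence G: "Gamma (1 + 1 / lam) = Gamma (1 / lam) / lam" by (simp add: add.commute)
    define P L where "P = lam powr (1 / lam - 1)" and "L = lam powr (1 / lam)"
    have "norm_const * (J + J) = I * (P * lam) / (L * Gamma (1 / lam))"
      unfolding norm_const_def J_def G P_def[symmetric] L_def[symmetric] using lam_pos by (simp add: field_simps)
    hence "norm_const * (J + J) = I * (lam powr (1 / lam - 1) * lam) / (lam powr (1 / lam) * Gamma (1 / lam))"
      by (simp only: P_def L_def)
    also have "lam powr (1 / lam - 1) * lam = lam powr (1 / lam)"
      using lam_pos by (simp add: powr_diff)
    finally show ?thesis using lam_pos by simp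
  qed
  finally show ?thesis .
qed

lemma (in epd) mean_powr:
  assumes "p \<ge> 0"
  shows "mean (\<lambda>y. \<bar>y\<bar> powr p) = lam powr (p / lam) * Gamma ((p + 1) / lam) / Gamma (1 / lam)"
proof -
  have "has_bochner_integral lborel (\<lambda>t. lam powr (p / lam) * (indicator {0<..} t * (t powr ((p + 1) / lam - 1) * exp (- t))))
    (lam powr (p / lam) * Gamma ((p + 1) / lam))"
    using assms lam_pos by (intro has_bochner_integral_mult_right has_bochner_integral_Gamma) simp
  also have "(\<lambda>t. lam powr (p / lam) * (indicator {0<..} t * (t powr ((p + 1) / lam - 1) * exp (- t)))) =
    (\<lambda>t. indicator {0<..} t * ((lam powr (p / lam) * t powr (p / lam)) * t powr (1 / lam - 1) * exp (- t)))"
    by (simp add: fun_eq_iff add_divide_distrib powr_add[symmetric] mult_ac add_diff_eq)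
  finally have "mean (\<lambda>y. lam powr (p / lam) * (\<bar>y\<bar> powr lam / lam) powr (p / lam)) =
      lam powr (p / lam) * Gamma ((p + 1) / lam) / Gamma (1 / lam)"
    by (intro mean_power_transform) auto
  moreover have "lam powr (p / lam) * (\<bar>y\<bar> powr lam / lam) powr (p / lam) = \<bar>y\<bar> powr p" for y :: real
    using lam_pos by (simp add: powr_powr powr_divide)
  ultimately show ?thesis by simp
qed

section \<open>The limiting summands of the two statistics and their variances\<close>

context epd
begin

definition spow :: "real \<Rightarrow> real" where "spow y = \<bar>y\<bar> powr lam * sgn y"
definition plog :: "real \<Rightarrow> real" where "plog y = \<bar>y\<bar> powr lam * ln \<bar>y\<bar>"
text \<open>The Fisher information of the location family.\<close>

definition J :: real where "J = mean (\<lambda>y. psi y * psi y)"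
text \<open>The regression coefficient that makes \<open>xi\<close> orthogonal to
  \<open>psi\<close>.\<close>

definition kappa :: real where "kappa = mean (\<lambda>y. spow y * psi y) / J"
definition xi :: "real \<Rightarrow> real" where "xi y = spow y - kappa * psi y"
text \<open>With \<open>L\<close> the mean of \<open>plog\<close> and \<open>A\<close> that of
  \<open>\<bar>y\<bar> powr lam\<close>, both over the residuals, K is
  \<open>L / A - ln A / lam\<close>. Linearised at \<open>A = 1\<close> and
  \<open>L = E_K lam\<close>, the quotient contributes \<open>- E_K lam\<close> and the logarithm
  \<open>- 1 / lam\<close> per unit of \<open>A - 1\<close>; the last summand recentres.\<close>

definition eta :: "real \<Rightarrow> real" where "eta y = plog y - (E_K lam + 1 / lam) * \<bar>y\<bar> powr lam + 1 / lam"

lemma mean_add: "slow h \<Longrightarrow> slow k \<Longrightarrow> mean (\<lambda>y. h y + k y) = mean h + mean k"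
  using integrable_dens_slow by (simp add: mean_def distrib_right)

lemma mean_diff: "slow h \<Longrightarrow> slow k \<Longrightarrow> mean (\<lambda>y. h y - k y) = mean h - mean k"
  using integrable_dens_slow by (simp add: mean_def left_diff_distrib)

lemma mean_cmult: "mean (\<lambda>y. c * h y) = c * mean h"
  by (simp add: mean_def mult.assoc)

lemma psi_square: "psi y * psi y = \<bar>y\<bar> powr (2 * lam - 2)"
  by (cases "y = 0") (auto simp: psi_def sgn_if powr_add[symmetric])

lemma spow_psi: "spow y * psi y = \<bar>y\<bar> powr (2 * lam - 1)"
  by (cases "y = 0") (auto simp: psi_def spow_def sgn_if powr_add[symmetric])

lemma spow_square: "spow y * spow y = \<bar>y\<bar> powr (2 * lam)"
  by (cases "y = 0") (auto simp: psi_def spow_def sgn_if powr_add[symmetric])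

lemma J_eq: "J = lam powr (2 - 2 / lam) * Gamma (2 - 1 / lam) / Gamma (1 / lam)"
  unfolding J_def psi_square using lam by (subst mean_powr) (auto simp: diff_divide_distrib add_divide_distrib)

lemma mean_spow_psi: "mean (\<lambda>y. spow y * psi y) = lam powr (2 - 1 / lam) / Gamma (1 / lam)"
  unfolding spow_psi using lam by (subst mean_powr) (auto simp: diff_divide_distrib add_divide_distrib Gamma_numeral)

lemma Gamma_inverse_lam_pos: "Gamma (1 / lam) > 0"
  using lam by (intro Gamma_real_pos) simp

lemma J_pos: "J > 0"
proof -
  have "1 / lam \<le> 1" using lam by simp
  hence "Gamma (2 - 1 / lam) > 0" by (intro Gamma_real_pos) linarith
  thus ?thesis unfolding J_eq using Gamma_inverse_lam_pos lam_pos by simp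
qed

lemma Gamma_lam_plus1: "Gamma (1 / lam + 1) = Gamma (1 / lam) / lam"
  and Gamma_lam_plus2: "Gamma (1 / lam + 2) = (1 / lam + 1) * (Gamma (1 / lam) / lam)"
proof -
  show 1: "Gamma (1 / lam + 1) = Gamma (1 / lam) / lam"
    using lam by (subst Gamma_plus1) (auto intro!: pos_notin_nonpos_Ints)
  have "Gamma ((1 / lam + 1) + 1) = (1 / lam + 1) * Gamma (1 / lam + 1)"
    using lam by (intro Gamma_plus1 pos_notin_nonpos_Ints) (simp add: add_pos_pos)
  thus "Gamma (1 / lam + 2) = (1 / lam + 1) * (Gamma (1 / lam) / lam)"
    by (simp add: 1 add.assoc)
qed

lemma slow_spow: "slow spow"
  by (rule slow_bound[OF slow_powr[of lam]]) (use lam in \<open>auto simp: spow_def[abs_def] abs_mult abs_sgn_eq\<close>)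

lemma slow_xi: "slow xi"
  unfolding xi_def[abs_def] by (intro slow_diff slow_cmult slow_spow slow_psi)

text \<open>Up to 1, \<open>\<bar>y\<bar> powr lam \<le> \<bar>y\<bar>\<close> and
  \<open>\<bar>y\<bar> * (- ln \<bar>y\<bar>) \<le> 1\<close>; beyond 1,
  \<open>ln \<bar>y\<bar> \<le> \<bar>y\<bar>\<close> raises the power by one.\<close>

lemma slow_plog: "slow plog"
proof (rule slow_bound)
  show "slow (\<lambda>y. 1 + \<bar>y\<bar> powr (lam + 1))"
    using lam by (intro slow_add slow_const slow_powr) auto
  show "\<bar>plog y\<bar> \<le> 1 + \<bar>y\<bar> powr (lam + 1)" for y
  proof -
    consider "y = 0" | "0 < \<bar>y\<bar>" "\<bar>y\<bar> \<le> 1" | "1 < \<bar>y\<bar>" by linarith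
    thus ?thesis
    proof cases
      case 2
      have "- ln \<bar>y\<bar> \<le> 1 / \<bar>y\<bar> - 1"
        using ln_le_minus_one[of "1 / \<bar>y\<bar>"] 2 by (simp add: ln_div)
      hence "\<bar>y\<bar> * (- ln \<bar>y\<bar>) \<le> 1"
        using mult_left_mono[of "- ln \<bar>y\<bar>" "1 / \<bar>y\<bar> - 1" "\<bar>y\<bar>"] 2 by (simp add: right_diff_distrib)
      moreover have "\<bar>y\<bar> powr lam \<le> \<bar>y\<bar>"
        using powr_mono'[of 1 lam "\<bar>y\<bar>"] lam 2 by simp
      moreover have "ln \<bar>y\<bar> \<le> 0" using 2 by simp
      ultimately have "\<bar>y\<bar> powr lam * (- ln \<bar>y\<bar>) \<le> 1"
        using mult_right_mono[of "\<bar>y\<bar> powr lam" "\<bar>y\<bar>" "- ln \<bar>y\<bar>"] by linarith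
      moreover have "\<bar>plog y\<bar> = \<bar>y\<bar> powr lam * (- ln \<bar>y\<bar>)"
        using \<open>ln \<bar>y\<bar> \<le> 0\<close> by (simp add: plog_def abs_mult)
      ultimately show ?thesis by (simp add: add_increasing2)
    next
      case 3
      have "ln \<bar>y\<bar> \<le> \<bar>y\<bar>" using ln_le_minus_one[of "\<bar>y\<bar>"] 3 by linarith
      hence "\<bar>y\<bar> powr lam * ln \<bar>y\<bar> \<le> \<bar>y\<bar> powr lam * \<bar>y\<bar>" by (intro mult_left_mono) auto
      also have "\<dots> = \<bar>y\<bar> powr (lam + 1)" using 3 by (simp add: powr_add)
      finally show ?thesis using 3 by (simp add: plog_def abs_mult)
    qed (use lam in \<open>simp add: plog_def\<close>)
  qed
qed (simp add: plog_def[abs_def])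

lemma slow_eta: "slow eta"
  unfolding eta_def[abs_def] using lam
  by (intro slow_diff slow_add slow_cmult slow_plog slow_powr slow_const) auto

lemma mean_xi: "mean (\<lambda>y. xi y) = 0"
  by (rule mean_odd) (simp add: xi_def spow_def psi_def sgn_minus)

lemma mean_xi_eta: "mean (\<lambda>y. xi y * eta y) = 0"
  by (rule mean_odd) (simp add: xi_def spow_def psi_def eta_def plog_def sgn_minus algebra_simps)

lemma mean_one: "mean (\<lambda>_. 1) = 1"
proof -
  have "has_integral_pos (\<lambda>t. 1 * t powr (1 / lam - 1) * exp (- t)) (Gamma (1 / lam))"
    using has_bochner_integral_Gamma[of "1 / lam"] lam by simp
  from mean_power_transform[OF _ this] show ?thesis
    using Gamma_inverse_lam_pos by simp
qed

lemma mean_abs_powr_lam: "mean (\<lambda>y. \<bar>y\<bar> powr lam) = 1"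
proof -
  have "(lam + 1) / lam = 1 / lam + 1" using lam_pos by (simp add: field_simps)
  thus ?thesis
    using lam Gamma_inverse_lam_pos[THEN less_imp_neq]
    by (subst mean_powr) (auto simp: Gamma_lam_plus1)
qed

text \<open>Pythagoras for the projection: the second moment of \<open>spow\<close>, which is
  \<open>1 + lam\<close>, loses \<open>(mean (\<lambda>y. spow y * psi y))\<^sup>2 / J\<close>, and
  this is the Gamma quotient in \<open>V_S\<close>.\<close>

lemma mean_xi_square: "mean (\<lambda>y. (xi y)\<^sup>2) = V_S lam"
proof -
  have i: "integrable lborel (\<lambda>y. spow y * spow y * dens y)" "integrable lborel (\<lambda>y. spow y * psi y * dens y)"
    "integrable lborel (\<lambda>y. psi y * psi y * dens y)"
    by (intro integrable_dens_slow_mult slow_spow slow_psi)+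
  have "(xi y)\<^sup>2 * dens y = spow y * spow y * dens y - (2 * kappa) * (spow y * psi y * dens y) + kappa\<^sup>2 * (psi y * psi y * dens y)" for y
    by (simp add: xi_def power2_eq_square algebra_simps)
  hence "mean (\<lambda>y. (xi y)\<^sup>2) = mean (\<lambda>y. spow y * spow y) - 2 * kappa * mean (\<lambda>y. spow y * psi y) + kappa\<^sup>2 * J"
    using i by (simp add: mean_def J_def)
  also have "mean (\<lambda>y. spow y * psi y) = kappa * J"
    using J_pos by (simp add: kappa_def)
  also have "mean (\<lambda>y. spow y * spow y) - 2 * kappa * (kappa * J) + kappa\<^sup>2 * J = mean (\<lambda>y. spow y * spow y) - kappa * (kappa * J)"
    by (simp add: power2_eq_square)
  also have "kappa * (kappa * J) = (mean (\<lambda>y. spow y * psi y))\<^sup>2 / J"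
    using J_pos by (simp add: kappa_def power2_eq_square)
  also have "\<dots> = lam\<^sup>2 / (Gamma (2 - 1 / lam) * Gamma (1 / lam))"
  proof -
    have "(lam powr (2 - 1 / lam))\<^sup>2 = lam powr (2 - 2 / lam) * lam powr 2"
    proof -
      have "2 - 1 / lam + (2 - 1 / lam) = 2 - 2 / lam + 2" by simp
      thus ?thesis unfolding power2_eq_square powr_add[symmetric] by (rule arg_cong)
    qed
    also have "lam powr 2 = lam\<^sup>2"
      using lam_pos by simp
    finally have *: "(lam powr (2 - 1 / lam))\<^sup>2 = lam powr (2 - 2 / lam) * lam\<^sup>2" .
    show ?thesis
      unfolding mean_spow_psi J_eq power_divide * using Gamma_inverse_lam_pos lam_pos
      by (simp add: power2_eq_square)
  qed
  also have "mean (\<lambda>y. spow y * spow y) = 1 + lam"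
  proof -
    have eq: "(2 * lam + 1) / lam = 1 / lam + 2" "2 * lam / lam = 2" using lam_pos by (simp_all add: field_simps)
    have "mean (\<lambda>y. spow y * spow y) = lam powr 2 * ((1 / lam + 1) * (Gamma (1 / lam) / lam)) / Gamma (1 / lam)"
      using mean_powr[of "2 * lam"] lam unfolding spow_square eq Gamma_lam_plus2 by simp
    also have "\<dots> = 1 + lam"
    proof -
      have "lam powr 2 * ((1 / lam + 1) * (G / lam)) / G = 1 + lam" if "G > 0" for G
        using that lam_pos by (simp add: field_simps power2_eq_square)
      thus ?thesis using Gamma_inverse_lam_pos .
    qed
    finally show ?thesis .
  qed
  finally show ?thesis by (simp add: V_S_def)
qed

text \<open>In the Gamma variable \<open>t = \<bar>y\<bar> powr lam / lam\<close> the term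
  \<open>ln lam\<close> of \<open>E_K\<close> cancels against the one from \<open>ln t\<close>, and
  the recursion of the digamma function absorbs the summand \<open>lam\<close>.\<close>

lemma eta_eq: "eta y = (\<lambda>t. t * ln t - (Digamma (1 / lam + 1) + 1) * t + 1 / lam) (\<bar>y\<bar> powr lam / lam)"
proof -
  have D: "Digamma (1 / lam + 1) = Digamma (1 / lam) + lam"
    using lam by (subst Digamma_plus1) auto
  show ?thesis
  proof (cases "y = 0")
    case False
    hence ln: "ln (\<bar>y\<bar> powr lam / lam) = lam * ln \<bar>y\<bar> - ln lam"
      using lam_pos by (simp add: ln_div ln_powr)
    show ?thesis
      unfolding eta_def plog_def E_K_def D ln using lam_pos by (simp add: field_simps)
  qed (use lam in \<open>simp add: eta_def plog_def\<close>)
qed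

text \<open>The moments needed for \<open>eta\<close> and its square. The factors \<open>t\<close>
  and \<open>t\<^sup>2\<close> raise the shape \<open>a \<le> 1\<close> above 1, where the
  logarithmic integrals are available; the recursions then bring everything back to
  \<open>Gamma a\<close> and to polygamma values at \<open>a + 1\<close>.\<close>

lemma Gamma_integrals:
  defines "a \<equiv> 1 / lam"
  shows "has_integral_pos (\<lambda>t. t powr (a - 1) * exp (- t)) (Gamma a)" (is ?A)
    and "has_integral_pos (\<lambda>t. t * t powr (a - 1) * exp (- t)) (a * Gamma a)" (is ?B)
    and "has_integral_pos (\<lambda>t. t\<^sup>2 * t powr (a - 1) * exp (- t)) ((a + 1) * (a * Gamma a))" (is ?C)
    and "has_integral_pos (\<lambda>t. t * ln t * t powr (a - 1) * exp (- t)) (a * Gamma a * Digamma (a + 1))" (is ?D)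
    and "has_integral_pos (\<lambda>t. t\<^sup>2 * ln t * t powr (a - 1) * exp (- t))
        ((a + 1) * (a * Gamma a) * (Digamma (a + 1) + 1 / (a + 1)))" (is ?E)
    and "has_integral_pos (\<lambda>t. t\<^sup>2 * (ln t)\<^sup>2 * t powr (a - 1) * exp (- t))
        ((a + 1) * (a * Gamma a) * (Polygamma 1 (a + 1) - 1 / (a + 1)\<^sup>2 + (Digamma (a + 1) + 1 / (a + 1))\<^sup>2))" (is ?F)
proof -
  have a: "a > 0" using lam by (simp add: a_def)
  have G: "Gamma (a + 1) = a * Gamma a" "Gamma (a + 2) = (a + 1) * (a * Gamma a)"
    using Gamma_lam_plus1 Gamma_lam_plus2 by (simp_all add: a_def)
  have D: "Digamma (a + 2) = Digamma (a + 1) + 1 / (a + 1)"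
    using Digamma_plus1[of "a + 1"] a by (simp add: add.assoc)
  have P: "Polygamma 1 (a + 2) = Polygamma 1 (a + 1) - 1 / (a + 1)\<^sup>2"
    using Polygamma_plus1[of "a + 1" 1] a by (simp add: add.assoc power2_eq_square divide_inverse)
  have pw: "indicator {0<..} t * (t powr (a + 1 - 1) * c * exp (- t)) = indicator {0<..} t * (t * c * t powr (a - 1) * exp (- t))"
    "indicator {0<..} t * (t powr (a + 2 - 1) * c * exp (- t)) = indicator {0<..} t * (t\<^sup>2 * c * t powr (a - 1) * exp (- t))" for t c :: real
    using powr_add[of t 1 "a - 1"] powr_add[of t 2 "a - 1"] by (auto simp: indicator_def algebra_simps)
  have pw1: "indicator {0<..} t * (t powr (a + 1 - 1) * exp (- t)) = indicator {0<..} t * (t * t powr (a - 1) * exp (- t))"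
    "indicator {0<..} t * (t powr (a + 2 - 1) * exp (- t)) = indicator {0<..} t * (t\<^sup>2 * t powr (a - 1) * exp (- t))" for t :: real
    using pw[of t 1] by (simp_all only: mult_1_right)
  show ?A
    by (rule has_bochner_integral_Gamma[OF a])
  show ?B
    using has_bochner_integral_Gamma[of "a + 1"] a unfolding G pw1 by simp
  show ?C
    using has_bochner_integral_Gamma[of "a + 2"] a unfolding G pw1 by simp
  show ?D
    using has_bochner_integral_Gamma_ln[of "a + 1"] a unfolding G pw by simp
  show ?E
    using has_bochner_integral_Gamma_ln[of "a + 2"] a unfolding G D pw by simp
  show ?F
    using has_bochner_integral_Gamma_ln_square[of "a + 2"] a unfolding G D P pw by simp
qed

lemma mean_eta: "mean eta = 0"
  and mean_eta_square: "mean (\<lambda>y. (eta y)\<^sup>2) = V_K lam"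
proof -
  define a where "a = 1 / lam"
  define c where "c = Digamma (a + 1) + 1"
  define F where "F t = t * ln t - c * t + a" for t
  have a: "a > 0" using lam by (simp add: a_def)
  have Ga: "Gamma a > 0" using Gamma_inverse_lam_pos by (simp add: a_def)
  note GI = Gamma_integrals[folded a_def]
  have eta: "eta = (\<lambda>y. F (\<bar>y\<bar> powr lam / lam))"
    unfolding eta_eq[abs_def] F_def c_def a_def by simp
  have [measurable]: "F \<in> borel_measurable borel" unfolding F_def by measurable
  have eq: "(\<lambda>t. indicator {0<..} t * (F t * t powr (a - 1) * exp (- t))) =
     (\<lambda>t. indicator {0<..} t * (t * ln t * t powr (a - 1) * exp (- t))
      + (- c) * (indicator {0<..} t * (t * t powr (a - 1) * exp (- t)))
      + a * (indicator {0<..} t * (t powr (a - 1) * exp (- t))))"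
    by (simp add: fun_eq_iff F_def algebra_simps)
  have "has_integral_pos (\<lambda>t. F t * t powr (a - 1) * exp (- t))
    (a * Gamma a * Digamma (a + 1) + (- c) * (a * Gamma a) + a * Gamma a)"
    unfolding eq by (intro has_bochner_integral_add has_bochner_integral_mult_right GI)
  from mean_power_transform[OF _ this[unfolded a_def], folded a_def] show "mean eta = 0"
    by (simp add: eta c_def algebra_simps)
  have eq: "(\<lambda>t. indicator {0<..} t * ((F t)\<^sup>2 * t powr (a - 1) * exp (- t))) =
     (\<lambda>t. indicator {0<..} t * (t\<^sup>2 * (ln t)\<^sup>2 * t powr (a - 1) * exp (- t))
      + (- 2 * c) * (indicator {0<..} t * (t\<^sup>2 * ln t * t powr (a - 1) * exp (- t)))
      + c\<^sup>2 * (indicator {0<..} t * (t\<^sup>2 * t powr (a - 1) * exp (- t)))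
      + (2 * a) * (indicator {0<..} t * (t * ln t * t powr (a - 1) * exp (- t)))
      + (- 2 * a * c) * (indicator {0<..} t * (t * t powr (a - 1) * exp (- t)))
      + a\<^sup>2 * (indicator {0<..} t * (t powr (a - 1) * exp (- t))))"
    by (simp add: fun_eq_iff F_def algebra_simps power2_eq_square)
  define P where "P = Polygamma 1 (a + 1)"
  define D where "D = Digamma (a + 1)"
  define e where "e = 1 / (a + 1)"
  have e: "(a + 1) * e = 1" using a by (simp add: e_def)
  have e2: "1 / (a + 1)\<^sup>2 = e\<^sup>2" by (simp add: e_def power_one_over)
  define I where "I = (a + 1) * (a * Gamma a) * (P - e\<^sup>2 + (D + e)\<^sup>2)
    + (- 2 * c) * ((a + 1) * (a * Gamma a) * (D + e)) + c\<^sup>2 * ((a + 1) * (a * Gamma a))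
    + (2 * a) * (a * Gamma a * D) + (- 2 * a * c) * (a * Gamma a) + a\<^sup>2 * Gamma a"
  have "has_integral_pos (\<lambda>t. (F t)\<^sup>2 * t powr (a - 1) * exp (- t)) I"
    unfolding eq I_def P_def D_def e_def e2[unfolded e_def, symmetric]
    by (intro has_bochner_integral_add has_bochner_integral_mult_right GI)
  from mean_power_transform[OF _ this[unfolded a_def], folded a_def]
  have "mean (\<lambda>y. (eta y)\<^sup>2) = I / Gamma a"
    by (simp add: eta)
  also have "I = Gamma a * (a * (a + 1) * (P - e\<^sup>2 + (D + e)\<^sup>2 - 2 * c * (D + e) + c\<^sup>2)
     + 2 * a\<^sup>2 * D - 2 * a\<^sup>2 * c + a\<^sup>2)"
    unfolding I_def power2_eq_square by algebra
  also have "\<dots> / Gamma a = a * (a + 1) * (P - e\<^sup>2 + (D + e)\<^sup>2 - 2 * c * (D + e) + c\<^sup>2)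
     + 2 * a\<^sup>2 * D - 2 * a\<^sup>2 * c + a\<^sup>2"
    using Ga by simp
  also have "\<dots> = a * ((1 + a) * P - 1)"
  proof -
    \<comment> \<open>The digamma terms complete the square
      \<open>(D + e - c)\<^sup>2 = (e - 1)\<^sup>2\<close>, so \<open>D\<close> drops out there, and
      \<open>(a + 1) * e = 1\<close> removes \<open>e\<close>.\<close>
    have c: "c = D + 1" by (simp add: c_def D_def)
    show ?thesis using e unfolding c by algebra
  qed
  also have "\<dots> = V_K lam"
    by (simp add: V_K_def a_def P_def add.commute)
  finally show "mean (\<lambda>y. (eta y)\<^sup>2) = V_K lam" .
qed

text \<open>Read off from \<open>mean eta = 0\<close> and the unit mean of
  \<open>\<bar>y\<bar> powr lam\<close>, in place of a further integral.\<close>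

lemma mean_plog: "mean plog = E_K lam"
proof -
  define k where "k = E_K lam + 1 / lam"
  have sp: "slow (\<lambda>y. k * \<bar>y\<bar> powr lam)"
    using lam by (intro slow_cmult slow_powr) auto
  have "eta = (\<lambda>y. (plog y - k * \<bar>y\<bar> powr lam) + 1 / lam * 1)"
    by (simp add: fun_eq_iff eta_def k_def)
  hence "mean eta = mean (\<lambda>y. (plog y - k * \<bar>y\<bar> powr lam) + 1 / lam * 1)" by (rule arg_cong)
  also have "\<dots> = mean (\<lambda>y. plog y - k * \<bar>y\<bar> powr lam) + mean (\<lambda>y. 1 / lam * 1)"
    by (rule mean_add[OF slow_diff[OF slow_plog sp] slow_const])
  also have "mean (\<lambda>y. plog y - k * \<bar>y\<bar> powr lam) = mean plog - mean (\<lambda>y. k * \<bar>y\<bar> powr lam)"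
    by (rule mean_diff[OF slow_plog sp])
  finally have "0 = mean plog - k * 1 + 1 / lam * 1"
    unfolding mean_cmult mean_abs_powr_lam mean_one mean_eta .
  thus ?thesis by (simp add: k_def)
qed

lemma mean_square_pos:
  assumes f: "slow f" and N: "\<not> (AE y in lborel. f y = 0)"
  shows "mean (\<lambda>y. (f y)\<^sup>2) > 0"
proof -
  note [measurable] = slow_measurable[OF f]
  have int: "integrable lborel (\<lambda>y. (f y)\<^sup>2 * dens y)"
    using integrable_dens_slow_mult[OF f f] by (simp add: power2_eq_square)
  have "mean (\<lambda>y. (f y)\<^sup>2) \<ge> 0"
    unfolding mean_def by (intro integral_nonneg_AE) (auto simp: dens_nonneg)
  moreover have "mean (\<lambda>y. (f y)\<^sup>2) \<noteq> 0"
  proof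
    assume "mean (\<lambda>y. (f y)\<^sup>2) = 0"
    hence "AE y in lborel. (f y)\<^sup>2 * dens y = 0"
      unfolding mean_def using int by (subst (asm) integral_nonneg_eq_0_iff_AE) (auto simp: dens_nonneg)
    hence "AE y in lborel. f y = 0"
      by (rule eventually_mono) (use dens_pos[THEN less_imp_neq] in auto)
    with N show False by contradiction
  qed
  ultimately show ?thesis by linarith
qed

text \<open>Off 0, \<open>xi y\<close> is \<open>psi y\<close> times
  \<open>\<bar>y\<bar> - kappa\<close>, so \<open>xi\<close> has at most three zeros. Positivity of
  the second moment replaces an inequality between Gamma values.\<close>

lemma V_S_pos: "V_S lam > 0"
proof -
  have "{y. xi y = 0} \<subseteq> {0, kappa, - kappa}"
  proof
    fix y assume "y \<in> {y. xi y = 0}"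
    moreover have "xi y = (\<bar>y\<bar> powr (lam - 1) * sgn y) * (\<bar>y\<bar> - kappa)" if "y \<noteq> 0"
      using that powr_add[of "\<bar>y\<bar>" "lam - 1" 1] by (simp add: xi_def spow_def psi_def algebra_simps)
    ultimately show "y \<in> {0, kappa, - kappa}" by (cases "y = 0") (auto simp: sgn_if split: if_splits)
  qed
  hence "finite {y. xi y = 0}" by (rule finite_subset) simp
  hence "AE y in lborel. y \<notin> {y. xi y = 0}"
    by (rule AE_not_in[OF finite_imp_null_set_lborel])
  hence "AE y in lborel. xi y \<noteq> 0" by simp
  have "\<not> (AE y in lborel. xi y = 0)"
  proof
    assume "AE y in lborel. xi y = 0"
    with \<open>AE y in lborel. xi y \<noteq> 0\<close> have "AE y in lborel. xi y \<noteq> 0 \<and> xi y = 0" by (rule AE_conjI)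
    thus False by (simp add: eventually_False ae_filter_eq_bot_iff)
  qed
  thus ?thesis using mean_square_pos[OF slow_xi] mean_xi_square by simp
qed

text \<open>Beyond \<open>exp k\<close> the logarithm exceeds \<open>k\<close> and
  \<open>eta\<close> is positive, so \<open>eta\<close> does not vanish almost everywhere.\<close>

lemma V_K_pos: "V_K lam > 0"
proof -
  define k where "k = E_K lam + 1 / lam"
  have pos: "eta y > 0" if "y > exp k" for y
  proof -
    have y: "y > 0" using exp_gt_zero that by (rule less_trans)
    have "k \<le> ln y" using that y by (simp add: ln_ge_iff)
    hence "0 \<le> y powr lam * (ln y - k)" by simp
    moreover have "eta y = y powr lam * (ln y - k) + 1 / lam"
      using y by (simp add: eta_def plog_def k_def algebra_simps)
    ultimately show ?thesis using lam_pos by (simp add: add_nonneg_pos)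
  qed
  have "\<not> (AE y in lborel. eta y = 0)"
  proof
    assume "AE y in lborel. eta y = 0"
    hence "AE y in lborel. y \<notin> {exp k<..<exp k + 1}"
      by (rule eventually_mono) (use pos in force)
    hence "{exp k<..<exp k + 1} \<in> null_sets lborel"
      by (subst AE_iff_null_sets) auto
    thus False by (simp add: null_sets_def)
  qed
  thus ?thesis using mean_square_pos[OF slow_eta] mean_eta_square by simp
qed

end

section \<open>Expansion of shifted sums\<close>

lemma (in prob_space) tendsto_whp_fst:
  assumes "a \<longlonglongrightarrow> (c :: real)"
  shows "((\<lambda>p. a (fst p)) \<longlongrightarrow> c) whp"
proof (rule tendstoI)
  fix e :: real assume "e > 0"
  thus "\<forall>\<^sub>F p in whp. dist (a (fst p)) c < e"
    using tendstoD[OF assms \<open>e > 0\<close>] by (intro eventually_whpI) (auto elim: eventually_mono)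
qed

locale epd_sample = epd lam + prob_space M for lam :: real and M :: "'a measure" +
  fixes Y :: "nat \<Rightarrow> 'a \<Rightarrow> real"
  assumes indep: "indep_vars (\<lambda>_. borel) Y UNIV"
    and dist: "\<And>i. distributed M lborel (Y i) (\<lambda>x. ennreal (dens x))"
begin

lemma Y_measurable [measurable]: "Y i \<in> borel_measurable M"
  using indep unfolding indep_vars_def by auto

lemma expectation_Y:
  "f \<in> borel_measurable borel \<Longrightarrow> expectation (\<lambda>\<omega>. f (Y i \<omega>)) = mean f"
  using distributed_integral[OF dist, of f i] by (simp add: mean_def mult.commute dens_nonneg)

lemma integrable_Y:
  "f \<in> borel_measurable borel \<Longrightarrow> integrable M (\<lambda>\<omega>. f (Y i \<omega>)) \<longleftrightarrow> integrable lborel (\<lambda>y. f y * dens y)"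
  using distributed_integrable[OF dist, of f i] by (simp add: mult.commute dens_nonneg)

lemma expectation_centered_product:
  assumes f: "slow f" and "i \<noteq> j" and m: "mean f = 0"
  shows "expectation (\<lambda>\<omega>. f (Y i \<omega>) * f (Y j \<omega>)) = 0"
proof -
  note [measurable] = slow_measurable[OF f]
  have "indep_vars (\<lambda>_. borel) (\<lambda>k \<omega>. f (Y k \<omega>)) {i, j}"
    by (rule indep_vars_compose2[OF indep_vars_subset[OF indep]]) auto
  hence "(\<integral>\<omega>. (\<Prod>k\<in>{i, j}. f (Y k \<omega>)) \<partial>M) = (\<Prod>k\<in>{i, j}. \<integral>\<omega>. f (Y k \<omega>) \<partial>M)"
    using integrable_dens_slow[OF f] by (intro indep_vars_lebesgue_integral) (auto simp: integrable_Y)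
  thus ?thesis using assms by (simp add: expectation_Y)
qed

lemma
  assumes f: "slow f" and m: "mean f = 0"
  shows integrable_sum_square: "integrable M (\<lambda>\<omega>. (\<Sum>i<n. f (Y i \<omega>))\<^sup>2)"
    and expectation_sum_square: "expectation (\<lambda>\<omega>. (\<Sum>i<n. f (Y i \<omega>))\<^sup>2) = real n * mean (\<lambda>y. (f y)\<^sup>2)"
proof -
  note [measurable] = slow_measurable[OF f]
  have sq: "integrable M (\<lambda>\<omega>. f (Y i \<omega>) * f (Y i \<omega>))" for i
    using integrable_Y[of "\<lambda>y. f y * f y" i] integrable_dens_slow_mult[OF f f] by simp
  have pr: "integrable M (\<lambda>\<omega>. f (Y i \<omega>) * f (Y j \<omega>))" for i j
  proof (rule Bochner_Integration.integrable_bound)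
    show "integrable M (\<lambda>\<omega>. f (Y i \<omega>) * f (Y i \<omega>) + f (Y j \<omega>) * f (Y j \<omega>))"
      by (intro Bochner_Integration.integrable_add sq)
    have "\<bar>x * y\<bar> \<le> x * x + y * y" for x y :: real
    proof -
      have "0 \<le> \<bar>x\<bar> * \<bar>y\<bar>" by simp
      thus ?thesis
        using sum_squares_bound[of "\<bar>x\<bar>" "\<bar>y\<bar>"] unfolding abs_mult power2_eq_square abs_mult_self_eq by linarith
    qed
    thus "AE \<omega> in M. norm (f (Y i \<omega>) * f (Y j \<omega>)) \<le> norm (f (Y i \<omega>) * f (Y i \<omega>) + f (Y j \<omega>) * f (Y j \<omega>))"
      by (intro AE_I2) (auto intro: order_trans[OF _ abs_ge_self])
  qed measurable
  have eq: "(\<Sum>i<n. f (Y i \<omega>))\<^sup>2 = (\<Sum>i<n. \<Sum>j<n. f (Y i \<omega>) * f (Y j \<omega>))" for \<omega>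
    by (simp add: power2_eq_square sum_product)
  show "integrable M (\<lambda>\<omega>. (\<Sum>i<n. f (Y i \<omega>))\<^sup>2)"
    unfolding eq by (intro Bochner_Integration.integrable_sum pr)
  have "expectation (\<lambda>\<omega>. (\<Sum>i<n. f (Y i \<omega>))\<^sup>2) = (\<Sum>i<n. \<Sum>j<n. expectation (\<lambda>\<omega>. f (Y i \<omega>) * f (Y j \<omega>)))"
    unfolding eq by (simp add: pr Bochner_Integration.integrable_sum)
  also have "\<dots> = (\<Sum>i<n. \<Sum>j<n. if i = j then mean (\<lambda>y. f y * f y) else 0)"
    using expectation_centered_product[OF f _ m] expectation_Y[of "\<lambda>y. f y * f y"]
    by (intro sum.cong refl) auto
  also have "\<dots> = real n * mean (\<lambda>y. (f y)\<^sup>2)"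
    by (simp add: power2_eq_square)
  finally show "expectation (\<lambda>\<omega>. (\<Sum>i<n. f (Y i \<omega>))\<^sup>2) = real n * mean (\<lambda>y. (f y)\<^sup>2)" .
qed

abbreviation rt :: "nat \<times> 'a \<Rightarrow> real" where
  "rt p \<equiv> sqrt (real (fst p))"

abbreviation sample :: "nat \<times> 'a \<Rightarrow> nat \<Rightarrow> real" where
  "sample p \<equiv> (\<lambda>i. Y i (snd p))"

definition nsum :: "(real \<Rightarrow> real) \<Rightarrow> nat \<times> 'a \<Rightarrow> real" where
  "nsum f p = (\<Sum>i<fst p. f (sample p i)) / rt p"

text \<open>Since \<open>dens' = - psi * dens\<close>, this is minus the derivative of \<open>u \<mapsto> mean (\<lambda>y. h (y - u))\<close> at \<open>0\<close>.\<close>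

abbreviation slope :: "(real \<Rightarrow> real) \<Rightarrow> real" where
  "slope h \<equiv> mean (\<lambda>y. h y * psi y)"

definition incr :: "(real \<Rightarrow> real) \<Rightarrow> nat \<times> 'a \<Rightarrow> real \<Rightarrow> real" where
  "incr h p t = nsum (\<lambda>y. h (y - t / rt p) - h y) p"

lemma nsum_add: "nsum (\<lambda>y. f y + g y) p = nsum f p + nsum g p"
  by (simp add: nsum_def sum.distrib add_divide_distrib)

lemma nsum_diff: "nsum (\<lambda>y. f y - g y) p = nsum f p - nsum g p"
  by (simp add: nsum_def sum_subtractf diff_divide_distrib)

lemma nsum_cmult: "nsum (\<lambda>y. c * f y) p = c * nsum f p"
  by (simp add: nsum_def sum_distrib_left)

lemma nsum_const: "nsum (\<lambda>y. c) p = rt p * c"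
  by (cases "fst p = 0") (simp_all add: nsum_def real_div_sqrt field_simps)

lemma nsum_measurable: "f \<in> borel_measurable borel \<Longrightarrow> (\<lambda>\<omega>. nsum f (n, \<omega>)) \<in> borel_measurable M"
  unfolding nsum_def by simp

text \<open>For \<open>n = 0\<close> the sum is 0, so the second moment is bounded rather than
  computed.\<close>

lemma
  assumes "slow f" "mean f = 0"
  shows integrable_nsum_square: "integrable M (\<lambda>\<omega>. (nsum f (n, \<omega>))\<^sup>2)"
    and expectation_nsum_square_le: "expectation (\<lambda>\<omega>. (nsum f (n, \<omega>))\<^sup>2) \<le> mean (\<lambda>y. (f y)\<^sup>2)"
proof -
  have "(nsum f (n, \<omega>))\<^sup>2 = (\<Sum>i<n. f (Y i \<omega>))\<^sup>2 / real n" for \<omega>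
    by (simp add: nsum_def power_divide)
  moreover have "0 \<le> mean (\<lambda>y. (f y)\<^sup>2)"
    unfolding mean_def by (intro integral_nonneg_AE) (auto simp: dens_nonneg)
  ultimately show "integrable M (\<lambda>\<omega>. (nsum f (n, \<omega>))\<^sup>2)"
    "expectation (\<lambda>\<omega>. (nsum f (n, \<omega>))\<^sup>2) \<le> mean (\<lambda>y. (f y)\<^sup>2)"
    using integrable_sum_square[OF assms, of n] expectation_sum_square[OF assms, of n]
    by (cases "n = 0"; simp)+
qed

lemma tight_nsum:
  assumes "slow f" "mean f = 0"
  shows "tight_seq (nsum f)"
  using tight_seq_if_square[of "\<lambda>n \<omega>. nsum f (n, \<omega>)", OF nsum_measurable[OF slow_measurable[OF assms(1)]]
    integrable_nsum_square[OF assms] expectation_nsum_square_le[OF assms]] by simp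

text \<open>The increments are centred. The variance of the centred sum is at most the mean square
  of one increment, which vanishes; the centring terms converge to \<open>- slope h * t\<close> by
  differentiating the density.\<close>

lemma incr_tendsto:
  assumes h: "slow h" and cont: "\<And>y. y \<noteq> 0 \<Longrightarrow> isCont h y"
  shows "((\<lambda>p. incr h p t + slope h * t) \<longlongrightarrow> 0) whp"
proof -
  define d where "d n y = h (y - t / sqrt (real n)) - h y" for n y
  define e where "e n y = d n y - mean (d n)" for n y
  have d: "slow (d n)" for n
    unfolding d_def by (intro slow_diff slow_shift h)
  have e: "slow (e n)" for n
    unfolding e_def by (intro slow_diff d slow_const)
  have me: "mean (e n) = 0" for n
  proof -
    have "mean (e n) = mean (d n) - mean (\<lambda>_. mean (d n) * 1)"
      unfolding e_def[abs_def] by (simp add: mean_diff[OF d slow_const])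
    thus ?thesis unfolding mean_cmult mean_one by simp
  qed
  have le: "mean (\<lambda>y. (e n y)\<^sup>2) \<le> mean (\<lambda>y. (d n y)\<^sup>2)" for n
  proof -
    have "(e n y)\<^sup>2 * dens y = d n y * d n y * dens y - (2 * mean (d n)) * (d n y * dens y) + (mean (d n))\<^sup>2 * (1 * dens y)" for y
      by (simp add: e_def power2_eq_square algebra_simps)
    hence "mean (\<lambda>y. (e n y)\<^sup>2) = mean (\<lambda>y. d n y * d n y) - (2 * mean (d n)) * mean (d n) + (mean (d n))\<^sup>2 * mean (\<lambda>_. 1)"
      using integrable_dens_slow_mult[OF d d, of n n] integrable_dens_slow[OF d, of n] integrable_dens_slow[OF slow_const[of 1]]
      by (simp add: mean_def)
    thus ?thesis by (simp add: mean_one power2_eq_square)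
  qed
  have "((\<lambda>p. nsum (e (fst p)) (fst p, snd p)) \<longlongrightarrow> 0) whp"
  proof (rule tendsto_whp_0_if_square[of "\<lambda>n \<omega>. nsum (e n) (n, \<omega>)"])
    show "(\<lambda>n. expectation (\<lambda>\<omega>. (nsum (e n) (n, \<omega>))\<^sup>2)) \<longlonglongrightarrow> 0"
    proof (rule tendsto_sandwich[OF _ _ tendsto_const])
      show "(\<lambda>n. mean (\<lambda>y. (d n y)\<^sup>2)) \<longlonglongrightarrow> 0"
        unfolding d_def by (rule mean_square_shift[OF h cont])
      show "\<forall>\<^sub>F n in sequentially. 0 \<le> expectation (\<lambda>\<omega>. (nsum (e n) (n, \<omega>))\<^sup>2)"
        by (simp add: integral_nonneg_AE)
      show "\<forall>\<^sub>F n in sequentially. expectation (\<lambda>\<omega>. (nsum (e n) (n, \<omega>))\<^sup>2) \<le> mean (\<lambda>y. (d n y)\<^sup>2)"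
        using order_trans[OF expectation_nsum_square_le[OF e me] le] by (intro always_eventually allI)
    qed
  qed (intro nsum_measurable slow_measurable e integrable_nsum_square me)+
  moreover have "((\<lambda>p. rt p * mean (d (fst p)) + slope h * t) \<longlongrightarrow> - t * slope h + slope h * t) whp"
    unfolding d_def by (intro tendsto_add tendsto_const tendsto_whp_fst[OF mean_shift_derivative[OF h]])
  ultimately have "((\<lambda>p. nsum (e (fst p)) (fst p, snd p) + (rt p * mean (d (fst p)) + slope h * t)) \<longlongrightarrow> 0 + (- t * slope h + slope h * t)) whp"
    by (rule tendsto_add)
  moreover have "incr h p t = nsum (e (fst p)) (fst p, snd p) + rt p * mean (d (fst p))" for p
    unfolding incr_def d_def[symmetric] e_def by (simp add: nsum_diff nsum_const)
  ultimately show ?thesis by (simp add: add.assoc)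
qed

section \<open>Functions with a linear expansion at a random shift\<close>

text \<open>Gives the plug-in property a name, so that it passes from monotone functions to their
  linear combinations.\<close>

definition expandable :: "(real \<Rightarrow> real) \<Rightarrow> bool" where
  "expandable h \<longleftrightarrow> slow h \<and>
    (\<forall>T. tight_seq T \<longrightarrow> ((\<lambda>p. incr h p (T p) + slope h * T p) \<longlongrightarrow> 0) whp)"

lemma expandable_mono:
  assumes h: "slow h" and cont: "\<And>y. y \<noteq> 0 \<Longrightarrow> isCont h y" and "mono h"
  shows "expandable h"
  unfolding expandable_def
proof (intro conjI allI impI h)
  fix T assume T: "tight_seq T"
  show "((\<lambda>p. incr h p (T p) + slope h * T p) \<longlongrightarrow> 0) whp"
  proof (rule antimono_process_plug_in[OF _ incr_tendsto[OF h cont] T])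
    show "incr h p t \<le> incr h p s" if "s \<le> t" for p s t
      unfolding incr_def nsum_def using that
      by (intro divide_right_mono sum_mono diff_right_mono monoD[OF \<open>mono h\<close>] diff_left_mono) auto
  qed
qed

lemma slope_add: "slow h \<Longrightarrow> slow k \<Longrightarrow> slope (\<lambda>y. h y + k y) = slope h + slope k"
  using integrable_dens_slow_mult[OF _ slow_psi] by (simp add: mean_def distrib_right)

lemma expandable_add:
  assumes h: "expandable h" and k: "expandable k"
  shows "expandable (\<lambda>y. h y + k y)"
  unfolding expandable_def
proof (intro conjI allI impI)
  show "slow (\<lambda>y. h y + k y)" using h k slow_add unfolding expandable_def by blast
  fix T assume T: "tight_seq T"
  have "((\<lambda>p. (incr h p (T p) + slope h * T p) + (incr k p (T p) + slope k * T p)) \<longlongrightarrow> 0 + 0) whp"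
    using h k T unfolding expandable_def by (intro tendsto_add) auto
  moreover have "incr (\<lambda>y. h y + k y) p t = incr h p t + incr k p t" for p t
    by (simp add: incr_def nsum_add[symmetric] algebra_simps)
  moreover have "slope (\<lambda>y. h y + k y) = slope h + slope k"
    using h k unfolding expandable_def by (intro slope_add) auto
  ultimately show "((\<lambda>p. incr (\<lambda>y. h y + k y) p (T p) + slope (\<lambda>y. h y + k y) * T p) \<longlongrightarrow> 0) whp"
    by (simp add: algebra_simps)
qed

lemma expandable_cmult:
  assumes h: "expandable h"
  shows "expandable (\<lambda>y. c * h y)"
  unfolding expandable_def
proof (intro conjI allI impI)
  show "slow (\<lambda>y. c * h y)" using h slow_cmult unfolding expandable_def by blast
  fix T assume T: "tight_seq T"
  have "((\<lambda>p. c * (incr h p (T p) + slope h * T p)) \<longlongrightarrow> c * 0) whp"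
    using h T unfolding expandable_def by (intro tendsto_mult tendsto_const) auto
  moreover have "incr (\<lambda>y. c * h y) p t = c * incr h p t" for p t
    by (simp add: incr_def nsum_cmult[symmetric] right_diff_distrib)
  moreover have "slope (\<lambda>y. c * h y) = c * slope h"
    by (simp add: mean_cmult[symmetric] mult.assoc)
  ultimately show "((\<lambda>p. incr (\<lambda>y. c * h y) p (T p) + slope (\<lambda>y. c * h y) * T p) \<longlongrightarrow> 0) whp"
    by (simp add: algebra_simps)
qed

lemma expandable_const: "expandable (\<lambda>_. c)"
  by (rule expandable_mono) (auto intro: slow_const simp: mono_def)

text \<open>\<open>H \<bar>y\<bar> = H (max 0 y) + H (max 0 (- y)) - H 0\<close>, where the first
  term increases in \<open>y\<close> and the second decreases.\<close>

lemma expandable_even_mono: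
  fixes H :: "real \<Rightarrow> real"
  assumes H: "slow (\<lambda>y. H \<bar>y\<bar>)" and mono: "\<And>s t. 0 \<le> s \<Longrightarrow> s \<le> t \<Longrightarrow> H s \<le> H t"
    and cont: "\<And>s. s > 0 \<Longrightarrow> isCont H s"
  shows "expandable (\<lambda>y. H \<bar>y\<bar>)"
proof -
  obtain C where C: "C > 0" "\<And>y. \<bar>H \<bar>y\<bar>\<bar> \<le> C * exp (\<bar>y\<bar> / 8)" using slowE[OF H] by metis
  have bd: "\<bar>H (max 0 y)\<bar> \<le> (C + \<bar>H 0\<bar>) * exp (\<bar>y\<bar> / 8)" for y
  proof -
    have "\<bar>H (max 0 y)\<bar> \<le> \<bar>H \<bar>y\<bar>\<bar> + \<bar>H 0\<bar>" by (cases "y \<ge> 0") auto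
    also have "\<dots> \<le> C * exp (\<bar>y\<bar> / 8) + \<bar>H 0\<bar> * exp (\<bar>y\<bar> / 8)"
      using mult_left_mono[of 1 "exp (\<bar>y\<bar> / 8)" "\<bar>H 0\<bar>"] by (intro add_mono C(2)) auto
    finally show ?thesis by (simp add: distrib_right)
  qed
  have mono': "mono (\<lambda>y. H (max 0 y))" "mono (\<lambda>y. - H (max 0 (- y)))"
    by (auto intro!: monoI mono)
  have cont': "isCont (\<lambda>y. H (max 0 y)) y" if "y \<noteq> 0" for y
  proof (cases "y > 0")
    case True
    have "\<forall>\<^sub>F x in nhds y. H (max 0 x) = H x"
      using True by (intro eventually_nhds_in_open[of "{0<..}", THEN eventually_mono]) auto
    thus ?thesis using cont[OF True] isCont_cong by fast
  next
    case False
    have "\<forall>\<^sub>F x in nhds y. H (max 0 x) = H 0"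
      using False that by (intro eventually_nhds_in_open[of "{..<0}", THEN eventually_mono]) auto
    thus ?thesis using isCont_cong[of "\<lambda>x. H (max 0 x)" "\<lambda>_. H 0" y] by simp
  qed
  have "expandable (\<lambda>y. H (max 0 y))"
    using bd by (intro expandable_mono mono' cont' slowI borel_measurable_mono)
  moreover have "expandable (\<lambda>y. - H (max 0 (- y)))"
  proof (rule expandable_mono[OF slowI _ mono'(2)])
    show "(\<lambda>y. - H (max 0 (- y))) \<in> borel_measurable borel" by (rule borel_measurable_mono[OF mono'(2)])
    show "\<bar>- H (max 0 (- y))\<bar> \<le> (C + \<bar>H 0\<bar>) * exp (\<bar>y\<bar> / 8)" for y
      using bd[of "- y"] by simp
    show "isCont (\<lambda>y. - H (max 0 (- y))) y" if "y \<noteq> 0" for y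
      using that by (intro isCont_minus isCont_o2[OF _ cont', of _ uminus]) auto
  qed
  ultimately have "expandable (\<lambda>y. H (max 0 y) + - 1 * - H (max 0 (- y)) + - H 0)"
    by (intro expandable_add expandable_cmult expandable_const)
  moreover have "H (max 0 y) + - 1 * - H (max 0 (- y)) + - H 0 = H \<bar>y\<bar>" for y
    by (cases "y \<ge> 0") auto
  ultimately show ?thesis by simp
qed

lemma mono_signed_powr: "p \<ge> 0 \<Longrightarrow> mono (\<lambda>y::real. \<bar>y\<bar> powr p * sgn y)"
proof (rule monoI)
  fix x y :: real assume "p \<ge> 0" "x \<le> y"
  consider "0 < x" | "x \<le> 0" "0 \<le> y" | "y < 0" by linarith
  thus "\<bar>x\<bar> powr p * sgn x \<le> \<bar>y\<bar> powr p * sgn y"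
  proof cases
    case 1
    thus ?thesis using \<open>x \<le> y\<close> \<open>p \<ge> 0\<close> by (simp add: powr_mono2)
  next
    case 2
    have "\<bar>x\<bar> powr p * sgn x \<le> 0" using 2 by (simp add: mult_nonneg_nonpos sgn_if)
    also have "0 \<le> \<bar>y\<bar> powr p * sgn y" using 2 by (simp add: sgn_if)
    finally show ?thesis .
  next
    case 3
    thus ?thesis using \<open>x \<le> y\<close> \<open>p \<ge> 0\<close> powr_mono2[of p "- y" "- x"] by simp
  qed
qed

lemma isCont_signed_powr: "y \<noteq> 0 \<Longrightarrow> isCont (\<lambda>y::real. \<bar>y\<bar> powr p * sgn y) y"
  by (intro continuous_intros) auto

lemma mono_psi: "mono psi"
  using mono_signed_powr[of "lam - 1"] lam by (simp add: psi_def[abs_def])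

lemma expandable_psi: "expandable psi"
  using isCont_signed_powr[of _ "lam - 1"] by (intro expandable_mono slow_psi mono_psi) (simp add: psi_def[abs_def])

lemma expandable_spow: "expandable spow"
  using isCont_signed_powr[of _ lam] mono_signed_powr[of lam] lam by (intro expandable_mono slow_spow) (simp_all add: spow_def[abs_def])

lemma expandable_powr_lam: "expandable (\<lambda>y. \<bar>y\<bar> powr lam)"
  using lam by (intro expandable_even_mono slow_powr) (auto intro!: powr_mono2 continuous_intros)

text \<open>\<open>z \<mapsto> z ln z\<close> decreases on \<open>[0, 1/e]\<close> and increases afterwards, so \<open>plog\<close> is a sum of two monotone functions of \<open>\<bar>y\<bar>\<close>.\<close>

lemma expandable_plog: "expandable plog"
proof -
  define q where "q z = z * ln z" for z :: real
  define r where "r = exp (- 1 :: real)"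
  have r: "r > 0" "ln r = - 1" by (simp_all add: r_def)
  have q_deriv: "(q has_real_derivative (ln z + 1)) (at z)" if "z > 0" for z
    unfolding q_def using that by (auto intro!: derivative_eq_intros)
  have q_inc: "q x \<le> q y" if "r \<le> x" "x \<le> y" for x y
  proof (rule DERIV_nonneg_imp_nondecreasing[OF that(2)])
    fix z assume z: "x \<le> z" "z \<le> y"
    hence "ln r \<le> ln z" using that r(1) by simp
    thus "\<exists>d. (q has_real_derivative d) (at z) \<and> 0 \<le> d"
      using q_deriv[of z] z that r by (intro exI[of _ "ln z + 1"]) auto
  qed
  have q_dec: "q y \<le> q x" if "0 \<le> x" "x \<le> y" "y \<le> r" for x y
  proof (cases "x = 0")
    case True
    have "q y \<le> 0"
    proof (cases "y = 0")
      case False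
      hence "ln y \<le> ln r" using that True r(1) by simp
      hence "ln y \<le> 0" using r(2) by simp
      thus ?thesis using that True by (simp add: q_def mult_nonneg_nonpos)
    qed (simp add: q_def)
    thus ?thesis using True by (simp add: q_def)
  next
    case False
    show ?thesis
    proof (rule DERIV_nonpos_imp_nonincreasing[OF that(2)])
      fix z assume z: "x \<le> z" "z \<le> y"
      hence "ln z \<le> ln r" using that r(1) False by simp
      thus "\<exists>d. (q has_real_derivative d) (at z) \<and> d \<le> 0"
        using q_deriv[of z] z that r False by (intro exI[of _ "ln z + 1"]) auto
    qed
  qed
  \<comment> \<open>The argument is cut at the turning point \<open>r\<close>. One of
    \<open>max\<close> and \<open>min\<close> returns it and the other returns \<open>r\<close>, so
    \<open>H1 - H2\<close> is \<open>q (s powr lam) + q r\<close>.\<close>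
  define H1 where "H1 s = q (max (s powr lam) r)" for s
  define H2 where "H2 s = - q (min (s powr lam) r)" for s
  have q_l: "q (\<bar>y\<bar> powr lam) = lam * plog y" for y
    by (cases "y = 0") (auto simp: q_def plog_def ln_powr)
  \<comment> \<open>A common majorant: each piece takes either the value \<open>lam * plog y\<close>
    or the constant \<open>q r\<close>, up to sign.\<close>
  have sl: "slow (\<lambda>y. \<bar>lam * plog y\<bar> + \<bar>q r\<bar>)"
  proof (intro slow_add slow_const)
    obtain C where "C > 0" "\<And>y. \<bar>lam * plog y\<bar> \<le> C * exp (\<bar>y\<bar> / 8)" using slowE[OF slow_cmult[OF slow_plog]] by metis
    thus "slow (\<lambda>y. \<bar>lam * plog y\<bar>)" using slow_measurable[OF slow_plog] by (intro slowI[of _ C]) auto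
  qed
  have q_cont: "isCont q z" if "z > 0" for z
    using q_deriv[OF that] by (rule DERIV_isCont)
  have p_cont: "isCont (\<lambda>s. s powr lam) s" if "s > 0" for s :: real
    using that by (intro continuous_intros) auto
  have [measurable]: "q \<in> borel_measurable borel" unfolding q_def by measurable
  have e1: "expandable (\<lambda>y. H1 \<bar>y\<bar>)"
  proof (rule expandable_even_mono)
    show "slow (\<lambda>y. H1 \<bar>y\<bar>)"
      by (rule slow_bound[OF sl]) (auto simp: H1_def[abs_def] q_l max_def)
    show "H1 s \<le> H1 t" if "0 \<le> s" "s \<le> t" for s t
      unfolding H1_def using powr_mono2[OF _ that, of lam] lam by (intro q_inc) auto
    show "isCont H1 s" if "s > 0" for s
      unfolding H1_def using r p_cont[OF that]
      by (intro isCont_o2[OF _ q_cont]) (auto intro!: continuous_max simp: less_max_iff_disj)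
  qed
  have e2: "expandable (\<lambda>y. H2 \<bar>y\<bar>)"
  proof (rule expandable_even_mono)
    show "slow (\<lambda>y. H2 \<bar>y\<bar>)"
      by (rule slow_bound[OF sl]) (auto simp: H2_def[abs_def] q_l min_def)
    show "H2 s \<le> H2 t" if "0 \<le> s" "s \<le> t" for s t
      unfolding H2_def using powr_mono2[OF _ that, of lam] lam r by (intro le_imp_neg_le q_dec) auto
    show "isCont H2 s" if "s > 0" for s
      unfolding H2_def using r p_cont[OF that] that
      by (intro isCont_minus isCont_o2[OF _ q_cont]) (auto intro!: continuous_min)
  qed
  have "expandable (\<lambda>y. 1 / lam * (H1 \<bar>y\<bar> + - 1 * H2 \<bar>y\<bar> + - q r))"
    by (intro expandable_cmult expandable_add e1 e2 expandable_const)
  moreover have "1 / lam * (H1 \<bar>y\<bar> + - 1 * H2 \<bar>y\<bar> + - q r) = plog y" for y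
    using q_l[of y] lam_pos unfolding H1_def H2_def by (auto simp: max_def min_def)
  ultimately show ?thesis by simp
qed

lemma tight_nsum_psi: "tight_seq (\<lambda>p. nsum psi p / J + c)"
proof -
  have "mean psi = 0" by (rule mean_odd) (simp add: psi_def sgn_minus)
  hence "tight_seq (nsum (\<lambda>y. 1 / J * psi y))"
    by (intro tight_nsum slow_cmult slow_psi) (simp only: mean_cmult mult_zero_right)
  thus ?thesis
    by (rule tight_seq_close[where c=c]) (simp only: nsum_cmult, simp)
qed

text \<open>Only a sign change of the score at \<open>T p\<close> is assumed, since for the median a
  root may fail to exist or to be unique. At \<open>nsum psi p / J\<close> shifted by
  \<open>r\<close> or \<open>- r\<close> the normalised score approaches \<open>- J * r\<close> or
  \<open>J * r\<close>; the sign change lies in between.\<close>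

lemma tendsto_location_estimator:
  assumes up: "\<And>p t. t < T p \<Longrightarrow> 0 \<le> (\<Sum>i<fst p. psi (sample p i - t / rt p))"
    and low: "\<And>p t. T p < t \<Longrightarrow> (\<Sum>i<fst p. psi (sample p i - t / rt p)) \<le> 0"
  shows "((\<lambda>p. T p - nsum psi p / J) \<longlongrightarrow> 0) whp"
proof (rule tendstoI)
  fix e :: real assume "e > 0"
  define r where "r = e / 2"
  have r: "r > 0" "r < e" using \<open>e > 0\<close> by (auto simp: r_def)
  have Psi: "((\<lambda>p. nsum psi p + incr psi p (nsum psi p / J + c)) \<longlongrightarrow> - J * c) whp" for c
  proof -
    have "((\<lambda>p. incr psi p (nsum psi p / J + c) + J * (nsum psi p / J + c)) \<longlongrightarrow> 0) whp"
      using expandable_psi tight_nsum_psi[of c] unfolding expandable_def J_def by blast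
    hence "((\<lambda>p. incr psi p (nsum psi p / J + c) + J * (nsum psi p / J + c) - J * c) \<longlongrightarrow> 0 - J * c) whp"
      by (intro tendsto_diff tendsto_const)
    thus ?thesis using J_pos by (simp add: distrib_left add.commute)
  qed
  have eq: "nsum psi p + incr psi p t = (\<Sum>i<fst p. psi (sample p i - t / rt p)) / rt p" for p t
    by (simp add: incr_def nsum_add[symmetric]) (simp add: nsum_def)
  have "\<forall>\<^sub>F p in whp. nsum psi p + incr psi p (nsum psi p / J + r) < 0"
    using r J_pos by (intro order_tendstoD(2)[OF Psi]) simp
  moreover have "\<forall>\<^sub>F p in whp. nsum psi p + incr psi p (nsum psi p / J + - r) > 0"
    using r J_pos by (intro order_tendstoD(1)[OF Psi]) simp
  ultimately show "\<forall>\<^sub>F p in whp. dist (T p - nsum psi p / J) 0 < e"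
  proof eventually_elim
    case (elim p)
    have "\<not> nsum psi p / J + r < T p"
    proof
      assume "nsum psi p / J + r < T p"
      from up[OF this] have "0 \<le> nsum psi p + incr psi p (nsum psi p / J + r)"
        unfolding eq by simp
      thus False using elim by simp
    qed
    moreover have "\<not> T p < nsum psi p / J + - r"
    proof
      assume "T p < nsum psi p / J + - r"
      from low[OF this] have "nsum psi p + incr psi p (nsum psi p / J + - r) \<le> 0"
        unfolding eq by (simp add: divide_nonpos_nonneg)
      thus False using elim by simp
    qed
    ultimately show ?case using r unfolding dist_real_def by linarith
  qed
qed

end

section \<open>Estimators of location and scale\<close>

lemma sort_map_affine:
  fixes x :: "nat \<Rightarrow> real"
  assumes "d > 0"
  shows "sort (map (\<lambda>i. c + d * x i) ns) = map (\<lambda>y. c + d * y) (sort (map x ns))"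
proof (rule properties_for_sort)
  show "mset (map (\<lambda>y. c + d * y) (sort (map x ns))) = mset (map (\<lambda>i. c + d * x i) ns)"
    by (simp add: image_mset.compositionality comp_def)
  have "sorted (sort (map x ns))" by simp
  thus "sorted (map (\<lambda>y. c + d * y) (sort (map x ns)))"
    using assms by (auto simp: sorted_iff_nth_mono)
qed

lemma sample_median_affine:
  assumes "d > 0" "n > 0"
  shows "sample_median n (\<lambda>i. c + d * x i) = c + d * sample_median n x"
  using assms(2) unfolding sample_median_def sort_map_affine[OF assms(1)] Let_def
  by (auto simp: field_simps)

lemma sum_sort_nth:
  fixes x :: "nat \<Rightarrow> real" and f :: "real \<Rightarrow> real"
  shows "(\<Sum>i<n. f (x i)) = (\<Sum>j<n. f (sort (map x [0..<n]) ! j))"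
proof -
  have "(\<Sum>i<n. f (x i)) = sum_list (map f (map x [0..<n]))"
    by (simp add: sum_list_distinct_conv_sum_set atLeast0LessThan comp_def)
  also have "\<dots> = sum_mset (image_mset f (mset (map x [0..<n])))"
    by (simp only: mset_map[symmetric] sum_mset_sum_list)
  also have "\<dots> = sum_list (map f (sort (map x [0..<n])))"
    by (simp only: mset_map[symmetric] sum_mset_sum_list mset_sort[symmetric] flip: mset_map)
      (simp only: mset_map mset_sort flip: sum_mset_sum_list)
  also have "\<dots> = (\<Sum>j<n. f (sort (map x [0..<n]) ! j))"
    by (simp add: sum_list_sum_nth atLeast0LessThan)
  finally show ?thesis .
qed

text \<open>The positions \<open>(n - 1) div 2\<close> and \<open>n div 2\<close>, counted from 0,
  coincide for odd \<open>n\<close> and are the two central ones for even \<open>n\<close>, so one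
  pair of bounds serves both parities.\<close>

lemma sample_median_bounds:
  fixes x :: "nat \<Rightarrow> real"
  assumes "n > 0"
  defines "s \<equiv> sort (map x [0..<n])"
  shows "s ! ((n - 1) div 2) \<le> sample_median n x" "sample_median n x \<le> s ! (n div 2)"
proof -
  have len: "length s = n" and sorted: "sorted s" by (simp_all add: s_def)
  have "s ! ((n - 1) div 2) \<le> s ! (n div 2)"
    using sorted len assms by (intro sorted_nth_mono) auto
  moreover have "(n - 1) div 2 = n div 2" if "odd n" using that by (elim oddE) simp
  moreover have "(n - 1) div 2 = n div 2 - 1" if "even n" using that by (elim evenE) auto
  ultimately show "s ! ((n - 1) div 2) \<le> sample_median n x" "sample_median n x \<le> s ! (n div 2)"
    unfolding sample_median_def Let_def s_def[symmetric] by auto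
qed

text \<open>Only the first \<open>k\<close> terms, at most half of all, can be negative, and the
  others are 1.\<close>

lemma sum_sgn_above_nonneg:
  fixes s :: "nat \<Rightarrow> real"
  assumes "\<And>j. k \<le> j \<Longrightarrow> j < n \<Longrightarrow> t < s j" "2 * k \<le> n"
  shows "0 \<le> (\<Sum>j<n. sgn (s j - t))"
proof -
  have k: "k \<le> n" using assms(2) by simp
  have "(\<Sum>j<n. if j < k then - 1 else 1) \<le> (\<Sum>j<n. sgn (s j - t))"
    using assms(1) by (intro sum_mono) (auto simp: sgn_if)
  also have "(\<Sum>j<n. if j < k then - 1 else 1) = (\<Sum>j<k. - 1) + (\<Sum>j=k..<n. 1 :: real)"
  proof -
    have "{..<n} = {..<k} \<union> {k..<n}" using k by auto
    thus ?thesis by (simp add: sum.union_disjoint ivl_disj_int)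
  qed
  finally show ?thesis using assms(2) by (simp add: of_nat_diff k)
qed

lemma sample_median_sgn_sum:
  assumes "n > 0"
  shows "t < sample_median n x \<Longrightarrow> 0 \<le> (\<Sum>i<n. sgn (x i - t))"
    and "sample_median n x < t \<Longrightarrow> (\<Sum>i<n. sgn (x i - t)) \<le> 0"
proof -
  define s where "s = sort (map x [0..<n])"
  have len: "length s = n" and sorted: "sorted s" by (simp_all add: s_def)
  note bounds = sample_median_bounds[OF assms, of x, folded s_def]
  note sum = sum_sort_nth[of "\<lambda>y. sgn (y - t)" x n, folded s_def]
  {
    assume t: "t < sample_median n x"
    have "t < s ! j" if "n div 2 \<le> j" "j < n" for j
      using sorted_nth_mono[OF sorted that(1)] that(2) len t bounds(2) by simp
    thus "0 \<le> (\<Sum>i<n. sgn (x i - t))"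
      unfolding sum by (intro sum_sgn_above_nonneg[of "n div 2"]) auto
  next
    assume t: "sample_median n x < t"
    have lt: "s ! j < t" if "j \<le> (n - 1) div 2" for j
    proof -
      have "(n - 1) div 2 < n" using assms by simp
      thus ?thesis using sorted_nth_mono[OF sorted that] len t bounds(1) by simp
    qed
    \<comment> \<open>Reflection reduces this side to the other one. The reversed index
      \<open>n - Suc j\<close> runs over positions up to \<open>(n - 1) div 2\<close> exactly when
      \<open>j\<close> is at least \<open>n div 2\<close>.\<close>
    have "0 \<le> (\<Sum>j<n. sgn (- (s ! (n - Suc j)) - (- t)))"
    proof (rule sum_sgn_above_nonneg[of "n div 2"])
      show "- t < - (s ! (n - Suc j))" if "n div 2 \<le> j" "j < n" for j
        using lt[of "n - Suc j"] that by simp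
    qed auto
    also have "\<dots> = (\<Sum>j<n. sgn (- (s ! j) - (- t)))"
      by (rule sum.nat_diff_reindex)
    also have "\<dots> = - (\<Sum>j<n. sgn (s ! j - t))"
      unfolding sum_negf[symmetric] sgn_minus[symmetric] by simp
    finally show "(\<Sum>i<n. sgn (x i - t)) \<le> 0" unfolding sum by simp
  }
qed

text \<open>Turns an order statistic into a count of sample points, whose measurability is evident.
  Positions start at 0, hence \<open>Suc k\<close>.\<close>

lemma sort_nth_le_iff:
  fixes x :: "nat \<Rightarrow> real"
  assumes "k < n"
  shows "sort (map x [0..<n]) ! k \<le> t \<longleftrightarrow> real (Suc k) \<le> (\<Sum>i<n. indicator {..t} (x i))"
proof -
  define s where "s = sort (map x [0..<n])"
  have len: "length s = n" and sorted: "sorted s" by (simp_all add: s_def)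
  have sum: "(\<Sum>i<n. indicator {..t} (x i)) = (\<Sum>j<n. indicator {..t} (s ! j) :: real)"
    unfolding s_def by (rule sum_sort_nth)
  show ?thesis
  proof (cases "s ! k \<le> t")
    case True
    have "(\<Sum>j<Suc k. 1) \<le> (\<Sum>j<Suc k. indicator {..t} (s ! j) :: real)"
    proof (rule sum_mono)
      fix j assume "j \<in> {..<Suc k}"
      hence "s ! j \<le> s ! k" using sorted len assms by (intro sorted_nth_mono) auto
      thus "(1 :: real) \<le> indicator {..t} (s ! j)" using True by simp
    qed
    also have "\<dots> \<le> (\<Sum>j<n. indicator {..t} (s ! j) :: real)"
      using assms by (intro sum_mono2) auto
    finally show ?thesis using True sum by (simp add: s_def)
  next
    case False
    have "(\<Sum>j<n. indicator {..t} (s ! j) :: real) \<le> (\<Sum>j<n. if j < k then 1 else 0)"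
    proof (rule sum_mono)
      fix j assume j: "j \<in> {..<n}"
      show "indicator {..t} (s ! j) \<le> (if j < k then 1 else 0 :: real)"
      proof (cases "j < k")
        case jk: False
        hence "s ! k \<le> s ! j" using j sorted len by (intro sorted_nth_mono) auto
        thus ?thesis using False jk by simp
      qed simp
    qed
    also have "\<dots> = real k"
    proof -
      have "{..<n} \<inter> {j. j < k} = {..<k}" using assms by auto
      thus ?thesis by (simp add: sum.If_cases)
    qed
    finally show ?thesis using False sum by (simp add: s_def)
  qed
qed

lemma sort_nth_measurable:
  fixes X :: "nat \<Rightarrow> 'a \<Rightarrow> real"
  assumes [measurable]: "\<And>i. X i \<in> borel_measurable M" and "k < n"
  shows "(\<lambda>\<omega>. sort (map (\<lambda>i. X i \<omega>) [0..<n]) ! k) \<in> borel_measurable M"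
  unfolding borel_measurable_iff_le sort_nth_le_iff[OF assms(2)] by measurable

lemma sample_median_measurable:
  fixes X :: "nat \<Rightarrow> 'a \<Rightarrow> real"
  assumes [measurable]: "\<And>i. X i \<in> borel_measurable M" and "n > 0"
  shows "(\<lambda>\<omega>. sample_median n (\<lambda>i. X i \<omega>)) \<in> borel_measurable M"
proof -
  have "n div 2 < n" "n div 2 - 1 < n" using assms(2) by auto
  note [measurable] = this[THEN sort_nth_measurable[of X M, OF assms(1)]]
  show ?thesis unfolding sample_median_def Let_def by measurable
qed

section \<open>Score equation, equivariance and the residual form of the statistics\<close>

context epd
begin

definition score :: "nat \<Rightarrow> (nat \<Rightarrow> real) \<Rightarrow> real \<Rightarrow> real" where
  "score n x t = (\<Sum>i<n. psi (x i - t))"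

lemma psi_strict_mono: "lam > 1 \<Longrightarrow> y < z \<Longrightarrow> psi y < psi z"
proof -
  assume "lam > 1" "y < z"
  consider "0 \<le> y" | "y < 0" "0 \<le> z" | "z < 0" by linarith
  thus "psi y < psi z"
  proof cases
    case 1
    thus ?thesis using \<open>y < z\<close> \<open>lam > 1\<close> powr_less_mono2[of "lam - 1" y z] by (cases "y = 0") (auto simp: psi_def)
  next
    case 2
    have "psi y < 0" using 2 by (simp add: psi_def)
    moreover have "0 \<le> psi z" using 2 by (simp add: psi_def sgn_if)
    ultimately show ?thesis by simp
  next
    case 3
    thus ?thesis using \<open>y < z\<close> \<open>lam > 1\<close> powr_less_mono2[of "lam - 1" "- z" "- y"] by (auto simp: psi_def)
  qed
qed

lemma psi_continuous: "lam > 1 \<Longrightarrow> continuous_on A psi"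
proof -
  assume gt1: "lam > 1"
  \<comment> \<open>Writing \<open>psi\<close> with truncated powers removes the discontinuous
    factor \<open>sgn\<close>.\<close>
  have eq: "psi y = (max 0 y) powr (lam - 1) - (max 0 (- y)) powr (lam - 1)" for y
    using gt1 by (auto simp: psi_def max_def sgn_if)
  show ?thesis
    unfolding eq[abs_def] using gt1 by (intro continuous_intros continuous_on_powr') auto
qed

lemma score_strict_antimono:
  assumes "lam > 1" "n > 0" "s < t"
  shows "score n x t < score n x s"
  unfolding score_def using assms by (intro sum_strict_mono psi_strict_mono) auto

lemma psi_nonneg: "0 \<le> y \<Longrightarrow> 0 \<le> psi y"
  by (simp add: psi_def sgn_if)

lemma psi_nonpos: "y \<le> 0 \<Longrightarrow> psi y \<le> 0"
  by (simp add: psi_def sgn_if)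

lemma score_less_iff:
  assumes "lam > 1" "n > 0"
  shows "score n x t < score n x s \<longleftrightarrow> s < t"
  using score_strict_antimono[OF assms] by (cases s t rule: linorder_cases) (auto dest: less_asym')

text \<open>Gives \<open>THE\<close> in \<open>mu_hat\<close> its meaning. The score changes sign
  between the least and the greatest sample point, and its strict decrease makes the root
  unique.\<close>

lemma ex1_score_root:
  assumes "lam > 1" "n > 0"
  shows "\<exists>!m. score n x m = 0"
proof -
  define lo hi where "lo = Min (x ` {..<n})" and "hi = Max (x ` {..<n})"
  have bounds: "lo \<le> x i" "x i \<le> hi" if "i < n" for i
    using that by (auto simp: lo_def hi_def)
  have "lo \<le> hi" using bounds[of 0] assms(2) by simp
  moreover have "0 \<le> score n x lo"
    unfolding score_def using bounds by (intro sum_nonneg psi_nonneg) auto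
  moreover have "score n x hi \<le> 0"
    unfolding score_def using bounds by (intro sum_nonpos psi_nonpos) auto
  moreover have "continuous_on {lo..hi} (score n x)"
    unfolding score_def[abs_def]
    by (intro continuous_intros continuous_on_compose2[OF psi_continuous[OF assms(1), of UNIV]]) auto
  ultimately obtain m where "score n x m = 0"
    using IVT2'[of "score n x" hi 0 lo] by blast
  moreover have "m = m'" if "score n x m = 0" "score n x m' = 0" for m m'
    using score_less_iff[OF assms, of x m m'] score_less_iff[OF assms, of x m' m] that by auto
  ultimately show ?thesis by blast
qed

lemma mu_hat_eq: "lam > 1 \<Longrightarrow> mu_hat lam n x = (THE m. score n x m = 0)"
  by (simp add: mu_hat_def score_def psi_def)

lemma score_mu_hat: "lam > 1 \<Longrightarrow> n > 0 \<Longrightarrow> score n x (mu_hat lam n x) = 0"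
  unfolding mu_hat_eq by (rule theI'[OF ex1_score_root])

lemma score_one: "lam = 1 \<Longrightarrow> score n x t = (\<Sum>i<n. sgn (x i - t))"
  unfolding score_def psi_def by (intro sum.cong refl) (simp add: sgn_if)

text \<open>The sign change is what the median and the root for \<open>lam > 1\<close> have in
  common, and all that the asymptotic argument uses of the estimator.\<close>

lemma score_mu_hat_sides:
  assumes "n > 0"
  shows "t < mu_hat lam n x \<Longrightarrow> 0 \<le> score n x t" and "mu_hat lam n x < t \<Longrightarrow> score n x t \<le> 0"
proof -
  have "(t < mu_hat lam n x \<longrightarrow> 0 \<le> score n x t) \<and> (mu_hat lam n x < t \<longrightarrow> score n x t \<le> 0)"
  proof (cases "lam = 1")
    case True
    show ?thesis
      unfolding score_one[OF True] mu_hat_def using sample_median_sgn_sum[OF assms, where t=t and x=x] True by simp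
  next
    case False
    hence gt1: "lam > 1" using lam by simp
    thus ?thesis
      using score_less_iff[OF gt1 assms, of x "mu_hat lam n x" t] score_less_iff[OF gt1 assms, of x t "mu_hat lam n x"]
        score_mu_hat[OF gt1 assms, of x] by auto
  qed
  thus "t < mu_hat lam n x \<Longrightarrow> 0 \<le> score n x t" "mu_hat lam n x < t \<Longrightarrow> score n x t \<le> 0" by auto
qed

lemma mu_hat_affine:
  assumes "d > 0" "n > 0"
  shows "mu_hat lam n (\<lambda>i. c + d * x i) = c + d * mu_hat lam n x"
proof (cases "lam = 1")
  case True
  thus ?thesis using sample_median_affine[OF assms] by (simp add: mu_hat_def)
next
  case False
  hence gt1: "lam > 1" using lam by simp
  have "psi (c + d * y - (c + d * m)) = d powr (lam - 1) * psi (y - m)" for y m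
  proof -
    have "c + d * y - (c + d * m) = d * (y - m)" by (simp add: algebra_simps)
    thus ?thesis using assms(1) by (simp add: psi_def abs_mult sgn_mult powr_mult)
  qed
  hence "score n (\<lambda>i. c + d * x i) (c + d * mu_hat lam n x) = d powr (lam - 1) * score n x (mu_hat lam n x)"
    by (simp add: score_def sum_distrib_left)
  hence "score n (\<lambda>i. c + d * x i) (c + d * mu_hat lam n x) = 0"
    using score_mu_hat[OF gt1 assms(2)] by simp
  thus ?thesis
    unfolding mu_hat_eq[OF gt1, of n "\<lambda>i. c + d * x i"] by (intro the1_equality ex1_score_root gt1 assms)
qed

lemma mu_hat_measurable:
  fixes X :: "nat \<Rightarrow> 'a \<Rightarrow> real"
  assumes X[measurable]: "\<And>i. X i \<in> borel_measurable M"
  shows "(\<lambda>\<omega>. mu_hat lam n (\<lambda>i. X i \<omega>)) \<in> borel_measurable M"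
proof -
  consider "n = 0" | "n > 0" "lam = 1" | "n > 0" "lam > 1" using lam by linarith
  thus ?thesis
  proof cases
    \<comment> \<open>For the empty sample the estimator is a constant, whatever value
      \<open>THE\<close> or the empty list yields.\<close>
    case 1
    thus ?thesis by (cases "lam = 1") (simp_all add: mu_hat_def sample_median_def)
  next
    case 2
    thus ?thesis using sample_median_measurable[OF X 2(1)] by (simp add: mu_hat_def)
  next
    case 3
    \<comment> \<open>Strict decrease of the score turns sublevel sets of the estimator into events
      about the score at a fixed \<open>t\<close>.\<close>
    have iff: "mu_hat lam n x < t \<longleftrightarrow> score n x t < 0" for x t
      using score_less_iff[OF 3(2,1), of x t "mu_hat lam n x"] score_mu_hat[OF 3(2,1), of x] by simp
    show ?thesis
      unfolding borel_measurable_iff_less iff score_def by measurable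
  qed
qed

lemma Y_hat_affine:
  assumes "d > 0" "n > 0"
  shows "Y_hat lam n (\<lambda>i. c + d * x i) = Y_hat lam n x"
proof
  fix i
  have diff: "c + d * y - (c + d * m) = d * (y - m)" for y m by (simp add: algebra_simps)
  have "sigma_hat lam n (\<lambda>i. c + d * x i) = ((1 / real n) * (\<Sum>i<n. d powr lam * \<bar>x i - mu_hat lam n x\<bar> powr lam)) powr (1 / lam)"
    unfolding sigma_hat_def mu_hat_affine[OF assms] diff using assms(1) by (simp add: abs_mult powr_mult)
  also have "\<dots> = (d powr lam * ((1 / real n) * (\<Sum>i<n. \<bar>x i - mu_hat lam n x\<bar> powr lam))) powr (1 / lam)"
    by (simp add: sum_distrib_left mult.left_commute)
  also have "\<dots> = d * sigma_hat lam n x"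
  proof -
    have "(d powr lam * A) powr (1 / lam) = d * A powr (1 / lam)" if "A \<ge> 0" for A
      using assms(1) lam_pos that by (simp add: powr_mult powr_powr)
    from this[of "1 / real n * (\<Sum>i<n. \<bar>x i - mu_hat lam n x\<bar> powr lam)"]
    show ?thesis unfolding sigma_hat_def by (simp only: sum_nonneg powr_ge_zero mult_nonneg_nonneg zero_le_divide_1_iff of_nat_0_le_iff)
  qed
  finally have "sigma_hat lam n (\<lambda>i. c + d * x i) = d * sigma_hat lam n x" .
  thus "Y_hat lam n (\<lambda>i. c + d * x i) i = Y_hat lam n x i"
    unfolding Y_hat_def mu_hat_affine[OF assms] diff using assms(1) by simp
qed

lemma Z_affine:
  assumes "d > 0"
  shows "Z_S lam n (\<lambda>i. c + d * x i) = Z_S lam n x" "Z_K lam n (\<lambda>i. c + d * x i) = Z_K lam n x"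
  using Y_hat_affine[OF assms, of n c x]
  by (cases "n = 0"; simp add: Z_S_def Z_K_def S_stat_def K_stat_def)+

lemma Z_measurable:
  fixes X :: "nat \<Rightarrow> 'a \<Rightarrow> real"
  assumes X[measurable]: "\<And>i. X i \<in> borel_measurable M"
  shows "(\<lambda>\<omega>. Z_S lam n (\<lambda>i. X i \<omega>)) \<in> borel_measurable M" "(\<lambda>\<omega>. Z_K lam n (\<lambda>i. X i \<omega>)) \<in> borel_measurable M"
proof -
  note [measurable] = mu_hat_measurable[of X M n, OF X]
  show "(\<lambda>\<omega>. Z_S lam n (\<lambda>i. X i \<omega>)) \<in> borel_measurable M" "(\<lambda>\<omega>. Z_K lam n (\<lambda>i. X i \<omega>)) \<in> borel_measurable M"
    unfolding Z_S_def Z_K_def S_stat_def K_stat_def Y_hat_def sigma_hat_def by measurable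
qed

text \<open>\<open>A\<close> is the power \<open>lam\<close> of the scale estimator, so
  standardising divides powers by \<open>A\<close> and subtracts \<open>ln A / lam\<close> from
  logarithms. \<open>A > 0\<close> excludes the degenerate sample in which all points
  coincide.\<close>

lemma
  fixes n :: nat and x :: "nat \<Rightarrow> real"
  defines "m \<equiv> mu_hat lam n x"
  defines "A \<equiv> (\<Sum>i<n. \<bar>x i - m\<bar> powr lam) / real n"
  assumes "n > 0" "A > 0"
  shows S_stat_eq: "S_stat lam n x = (\<Sum>i<n. spow (x i - m)) / real n / A"
    and K_stat_eq: "K_stat lam n x = (\<Sum>i<n. plog (x i - m)) / real n / A - ln A / lam"
proof -
  have sigma: "sigma_hat lam n x = A powr (1 / lam)"
    by (simp add: sigma_hat_def A_def m_def)
  have pos: "A powr (1 / lam) > 0" using \<open>A > 0\<close> by simp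
  have Ypow: "\<bar>Y_hat lam n x i\<bar> powr lam = \<bar>x i - m\<bar> powr lam / A" for i
    unfolding Y_hat_def sigma m_def[symmetric] using pos lam_pos \<open>A > 0\<close> by (simp add: powr_divide powr_powr abs_divide)
  have sgn: "sgn (Y_hat lam n x i) = sgn (x i - m)" for i
    unfolding Y_hat_def sigma m_def[symmetric] using pos by (simp add: sgn_divide)
  show "S_stat lam n x = (\<Sum>i<n. spow (x i - m)) / real n / A"
    unfolding S_stat_def Ypow sgn spow_def by (simp add: sum_divide_distrib mult.commute)
  \<comment> \<open>If \<open>x i = m\<close>, both sides are 0 because
    \<open>0 powr lam = 0\<close>.\<close>
  have ln: "\<bar>x i - m\<bar> powr lam / A * ln \<bar>Y_hat lam n x i\<bar> = plog (x i - m) / A - \<bar>x i - m\<bar> powr lam * (ln A / lam / A)" for i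
  proof (cases "x i = m")
    case False
    hence lnY: "ln \<bar>Y_hat lam n x i\<bar> = ln \<bar>x i - m\<bar> - ln A / lam"
      unfolding Y_hat_def sigma m_def[symmetric] using pos \<open>A > 0\<close> by (simp add: abs_divide ln_div ln_powr)
    show ?thesis unfolding lnY plog_def using \<open>A > 0\<close> lam_pos by (simp add: field_simps)
  qed (simp add: plog_def)
  have "K_stat lam n x = (1 / real n) * ((\<Sum>i<n. plog (x i - m)) / A - (\<Sum>i<n. \<bar>x i - m\<bar> powr lam) * (ln A / lam / A))"
    unfolding K_stat_def Ypow ln by (simp add: sum_subtractf sum_divide_distrib sum_distrib_right)
  also have "(\<Sum>i<n. \<bar>x i - m\<bar> powr lam) = real n * A"
  proof -
    have "S = real n * (S / real n)" for S using \<open>n > 0\<close> by simp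
    thus ?thesis unfolding A_def .
  qed
  also have "(1 / real n) * ((\<Sum>i<n. plog (x i - m)) / A - real n * A * (ln A / lam / A)) = (\<Sum>i<n. plog (x i - m)) / real n / A - ln A / lam"
  proof -
    have "(1 / k) * (S / a - k * a * (c / lam / a)) = S / k / a - c / lam" if "k > 0" "a > 0" for k S a c :: real
      using that lam_pos by (simp add: field_simps)
    thus ?thesis using \<open>n > 0\<close> \<open>A > 0\<close> by simp
  qed
  finally show "K_stat lam n x = (\<Sum>i<n. plog (x i - m)) / real n / A - ln A / lam" .
qed

end

section \<open>Asymptotic linearity of the statistics\<close>

text \<open>Fills the removable singularity, so that \<open>ln x\<close> is \<open>x - 1\<close>
  times a factor close to 1, also at \<open>x = 1\<close>.\<close>

lemma isCont_ln_quotient: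
  "isCont (\<lambda>x::real. if x = 1 then 1 else ln x / (x - 1)) 1"
proof -
  have "(ln has_real_derivative 1) (at (1::real))"
    by (auto intro!: derivative_eq_intros)
  hence "((\<lambda>x. (ln x - ln 1) / (x - 1)) \<longlongrightarrow> 1) (at (1::real))"
    by (simp only: has_field_derivative_iff)
  hence "((\<lambda>x. if x = 1 then 1 else ln x / (x - 1)) \<longlongrightarrow> 1) (at (1::real))"
    by (rule Lim_transform_eventually) (auto simp: eventually_at_filter)
  thus ?thesis by (simp add: isCont_def)
qed

context epd_sample
begin

definition loc :: "nat \<times> 'a \<Rightarrow> real" where
  "loc p = mu_hat lam (fst p) (sample p)"

definition T :: "nat \<times> 'a \<Rightarrow> real" where
  "T p = rt p * loc p"

definition rsum :: "(real \<Rightarrow> real) \<Rightarrow> nat \<times> 'a \<Rightarrow> real" where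
  "rsum h p = nsum (\<lambda>y. h (y - loc p)) p"

lemma T_tendsto: "((\<lambda>p. T p - nsum psi p / J) \<longlongrightarrow> 0) whp"
proof (rule tendsto_location_estimator)
  fix p :: "nat \<times> 'a" and t :: real
  show "0 \<le> (\<Sum>i<fst p. psi (sample p i - t / rt p))" if "t < T p"
  \<comment> \<open>The empty sample has \<open>rt p = 0\<close>, so division by it is confined to
    nonempty ones.\<close>
  proof (cases "fst p = 0")
    case False
    hence "t / rt p < loc p"
      using that by (simp add: T_def pos_divide_less_eq mult.commute)
    thus ?thesis
      using score_mu_hat_sides(1)[of "fst p" _ "sample p"] False by (simp add: loc_def score_def)
  qed simp
  show "(\<Sum>i<fst p. psi (sample p i - t / rt p)) \<le> 0" if "T p < t"
  proof (cases "fst p = 0")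
    case False
    hence "loc p < t / rt p"
      using that by (simp add: T_def pos_less_divide_eq mult.commute)
    thus ?thesis
      using score_mu_hat_sides(2)[of "fst p" "sample p"] False by (simp add: loc_def score_def)
  qed simp
qed

lemma T_tight: "tight_seq T"
  using tight_seq_close[OF tight_nsum_psi[of 0]] T_tendsto by simp

lemma rsum_expansion:
  assumes "expandable h"
  shows "((\<lambda>p. rsum h p - (nsum h p - slope h * (nsum psi p / J))) \<longlongrightarrow> 0) whp"
proof -
  define c where "c = slope h"
  have "((\<lambda>p. (incr h p (T p) + c * T p) - c * (T p - nsum psi p / J)) \<longlongrightarrow> 0 - c * 0) whp"
    using assms T_tight unfolding expandable_def c_def
    by (intro tendsto_diff tendsto_mult tendsto_const T_tendsto) auto
  moreover have "(incr h p (T p) + c * T p) - c * (T p - nsum psi p / J) = rsum h p - (nsum h p - c * (nsum psi p / J))" for p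
  proof -
    \<comment> \<open>Inserting \<open>T p\<close> into the increment produces the residuals; for
      \<open>fst p = 0\<close> all sums are empty.\<close>
    have "T p / rt p = loc p \<or> fst p = 0" by (auto simp: T_def)
    hence "incr h p (T p) = rsum h p - nsum h p"
      by (auto simp: incr_def rsum_def nsum_diff) (auto simp: nsum_def)
    thus ?thesis by (simp add: algebra_simps)
  qed
  ultimately show ?thesis by (simp add: c_def)
qed

lemma rsum_spow: "((\<lambda>p. rsum spow p - nsum xi p) \<longlongrightarrow> 0) whp"
proof -
  have "nsum xi p = nsum spow p - slope spow * (nsum psi p / J)" for p
    unfolding xi_def[abs_def] nsum_diff nsum_cmult kappa_def by simp
  thus ?thesis using rsum_expansion[OF expandable_spow] by simp
qed

text \<open>\<open>h\<close> times the odd \<open>psi\<close> has mean 0, so to first order the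
  estimated location leaves the sum unchanged.\<close>

lemma rsum_even:
  assumes "expandable h" "\<And>y. h (- y) = h y" 
  shows "((\<lambda>p. (rsum h p - rt p * mean h) - nsum (\<lambda>y. h y - mean h) p) \<longlongrightarrow> 0) whp"
proof -
  have "slope h = 0"
    by (rule mean_odd) (simp add: assms psi_def sgn_minus)
  thus ?thesis using rsum_expansion[OF assms(1)] by (simp add: nsum_diff nsum_const)
qed

lemma mean_diff_mean: "slow h \<Longrightarrow> mean (\<lambda>y. h y - mean h) = 0"
proof -
  assume "slow h"
  hence "mean (\<lambda>y. h y - mean h) = mean h - mean (\<lambda>_. mean h * 1)"
    by (simp add: mean_diff slow_const)
  thus ?thesis unfolding mean_cmult mean_one by simp
qed

definition SA :: "nat \<times> 'a \<Rightarrow> real" where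
  "SA p = rsum (\<lambda>y. \<bar>y\<bar> powr lam) p - rt p"

definition SL :: "nat \<times> 'a \<Rightarrow> real" where
  "SL p = rsum plog p - rt p * E_K lam"

text \<open>The scale estimator raised to the power \<open>lam\<close>.\<close>

definition A :: "nat \<times> 'a \<Rightarrow> real" where
  "A p = (\<Sum>i<fst p. \<bar>sample p i - loc p\<bar> powr lam) / real (fst p)"

lemma SA_tendsto: "((\<lambda>p. SA p - nsum (\<lambda>y. \<bar>y\<bar> powr lam - 1) p) \<longlongrightarrow> 0) whp"
  using rsum_even[OF expandable_powr_lam] by (simp add: mean_abs_powr_lam SA_def)

lemma SL_tendsto: "((\<lambda>p. SL p - nsum (\<lambda>y. plog y - E_K lam) p) \<longlongrightarrow> 0) whp"
  using rsum_even[OF expandable_plog] by (simp add: mean_plog SL_def plog_def)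

lemma tight_rsum_spow: "tight_seq (rsum spow)"
  by (rule tight_seq_close[OF tight_nsum[OF slow_xi mean_xi] rsum_spow])

lemma tight_SA: "tight_seq SA"
proof (rule tight_seq_close[OF tight_nsum SA_tendsto])
  have s: "slow (\<lambda>y. \<bar>y\<bar> powr lam)" using lam by (intro slow_powr) simp
  show "slow (\<lambda>y. \<bar>y\<bar> powr lam - 1)" by (rule slow_diff[OF s slow_const])
  show "mean (\<lambda>y. \<bar>y\<bar> powr lam - 1) = 0" using mean_diff_mean[OF s] by (simp add: mean_abs_powr_lam)
qed

lemma eventually_pos: "\<forall>\<^sub>F p in whp. fst p > 0"
  by (intro eventually_whpI eventually_mono[OF eventually_gt_at_top[of "0::nat"]]) simp

lemma A_eq: "fst p > 0 \<Longrightarrow> A p = 1 + SA p * (1 / rt p)"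
  by (simp add: A_def SA_def rsum_def nsum_def diff_divide_distrib)

lemma A_tendsto: "(A \<longlongrightarrow> 1) whp"
proof -
  have "((\<lambda>p. SA p * (1 / rt p)) \<longlongrightarrow> 0) whp"
    by (intro tight_seq_mult_tendsto_0[OF tight_SA] tendsto_whp_fst tendsto_divide_sqrt)
  hence "((\<lambda>p. 1 + SA p * (1 / rt p)) \<longlongrightarrow> 1 + 0) whp"
    by (intro tendsto_add tendsto_const)
  hence "((\<lambda>p. 1 + SA p * (1 / rt p)) \<longlongrightarrow> 1) whp" by simp
  thus ?thesis
    by (rule Lim_transform_eventually) (use eventually_pos in eventually_elim, simp add: A_eq)
qed

text \<open>Up to the factor \<open>1 / A p\<close> the scaled statistic is the residual sum of
  \<open>spow\<close>. That sum is centred and hence tight, so replacing the factor by its limit 1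
  costs a term vanishing in probability.\<close>

lemma S_stat_tendsto:
  "((\<lambda>p. rt p * S_stat lam (fst p) (sample p) - nsum xi p) \<longlongrightarrow> 0) whp"
proof -
  have "((\<lambda>p. 1 / A p - 1) \<longlongrightarrow> 1 / 1 - 1) whp"
    by (intro tendsto_intros A_tendsto) simp
  hence "((\<lambda>p. rsum spow p * (1 / A p - 1)) \<longlongrightarrow> 0) whp"
    by (intro tight_seq_mult_tendsto_0[OF tight_rsum_spow]) simp
  hence "((\<lambda>p. (rsum spow p - nsum xi p) + rsum spow p * (1 / A p - 1)) \<longlongrightarrow> 0 + 0) whp"
    by (intro tendsto_add rsum_spow)
  hence "((\<lambda>p. (rsum spow p - nsum xi p) + rsum spow p * (1 / A p - 1)) \<longlongrightarrow> 0) whp" by simp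
  moreover have "\<forall>\<^sub>F p in whp. A p > 0"
    by (intro order_tendstoD(1)[OF A_tendsto]) simp
  with eventually_pos have "\<forall>\<^sub>F p in whp. (rsum spow p - nsum xi p) + rsum spow p * (1 / A p - 1) =
     rt p * S_stat lam (fst p) (sample p) - nsum xi p"
  proof eventually_elim
    case (elim p)
    have "S_stat lam (fst p) (sample p) = (\<Sum>i<fst p. spow (sample p i - loc p)) / real (fst p) / A p"
      using S_stat_eq[of "fst p" "sample p"] elim unfolding A_def loc_def by blast
    moreover have "sqrt k * (S / k / a) = S / sqrt k / a" if "k > 0" for k S a :: real
    proof -
      define r where "r = sqrt k"
      have r: "r > 0" "k = r * r" using that by (simp_all add: r_def)
      have "r * (S / (r * r) / a) = S / r / a" using r(1) by simp
      thus ?thesis unfolding r(2)[symmetric] by (simp only: r_def)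
    qed
    ultimately have "rt p * S_stat lam (fst p) (sample p) = rsum spow p / A p"
      using elim by (simp add: rsum_def nsum_def)
    thus ?case by (simp add: algebra_simps)
  qed
  ultimately show ?thesis by (rule Lim_transform_eventually)
qed

text \<open>Rests on the exact identity that the scaled and centred statistic equals
  \<open>R p / A p - SA p * q (A p) / lam\<close>. Both \<open>R\<close> and \<open>SA\<close> are
  tight while \<open>1 / A p\<close> and \<open>q (A p)\<close> tend to 1.\<close>

lemma K_stat_tendsto:
  "((\<lambda>p. rt p * (K_stat lam (fst p) (sample p) - E_K lam) - nsum eta p) \<longlongrightarrow> 0) whp"
proof -
  define q where "q x = (if x = 1 then 1 else ln x / (x - 1))" for x :: real
  \<comment> \<open>The numerator of \<open>L / A - E_K lam\<close> over the common denominator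
    \<open>A\<close>, where \<open>A - 1\<close> is \<open>SA p / rt p\<close>.\<close>
  define R where "R p = SL p - E_K lam * SA p" for p
  define r where "r y = (plog y - E_K lam) - E_K lam * (\<bar>y\<bar> powr lam - 1)" for y
  have q: "((\<lambda>p. q (A p)) \<longlongrightarrow> 1) whp"
    using isCont_tendsto_compose[OF isCont_ln_quotient A_tendsto] by (simp add: q_def)
  have sa: "slow (\<lambda>y. \<bar>y\<bar> powr lam)" using lam by (intro slow_powr) simp
  have "((\<lambda>p. (SL p - nsum (\<lambda>y. plog y - E_K lam) p) - E_K lam * (SA p - nsum (\<lambda>y. \<bar>y\<bar> powr lam - 1) p)) \<longlongrightarrow> 0 - E_K lam * 0) whp"
    by (intro tendsto_diff tendsto_mult tendsto_const SL_tendsto SA_tendsto)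
  moreover have "(SL p - nsum (\<lambda>y. plog y - E_K lam) p) - E_K lam * (SA p - nsum (\<lambda>y. \<bar>y\<bar> powr lam - 1) p) = R p - nsum r p" for p
    unfolding r_def[abs_def] R_def nsum_diff nsum_cmult by (simp add: algebra_simps)
  ultimately have R: "((\<lambda>p. R p - nsum r p) \<longlongrightarrow> 0) whp" by simp
  have tight_R: "tight_seq R"
  proof (rule tight_seq_close[OF tight_nsum R])
    show "slow r" unfolding r_def[abs_def] by (intro slow_diff slow_cmult slow_plog slow_const sa)
    have "mean r = mean (\<lambda>y. plog y - mean plog) - mean (\<lambda>y. E_K lam * (\<bar>y\<bar> powr lam - mean (\<lambda>y. \<bar>y\<bar> powr lam)))"
      unfolding r_def[abs_def] mean_plog mean_abs_powr_lam by (intro mean_diff slow_diff slow_cmult slow_plog slow_const sa)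
    thus "mean r = 0" unfolding mean_cmult mean_diff_mean[OF slow_plog] mean_diff_mean[OF sa] by simp
  qed
  have "((\<lambda>p. 1 / A p - 1) \<longlongrightarrow> 1 / 1 - 1) whp"
    by (intro tendsto_intros A_tendsto) simp
  hence 1: "((\<lambda>p. R p * (1 / A p - 1)) \<longlongrightarrow> 0) whp"
    by (intro tight_seq_mult_tendsto_0[OF tight_R]) simp
  have "((\<lambda>p. q (A p) - 1) \<longlongrightarrow> 1 - 1) whp"
    by (intro tendsto_intros q)
  hence 2: "((\<lambda>p. SA p * (q (A p) - 1)) \<longlongrightarrow> 0) whp"
    by (intro tight_seq_mult_tendsto_0[OF tight_SA]) simp
  have "((\<lambda>p. (R p - nsum r p) + R p * (1 / A p - 1) - 1 / lam * (SA p - nsum (\<lambda>y. \<bar>y\<bar> powr lam - 1) p)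
      - 1 / lam * (SA p * (q (A p) - 1))) \<longlongrightarrow> 0 + 0 - 1 / lam * 0 - 1 / lam * 0) whp"
    by (intro tendsto_add tendsto_diff tendsto_mult tendsto_const R 1 2 SA_tendsto)
  hence "((\<lambda>p. (R p - nsum r p) + R p * (1 / A p - 1) - 1 / lam * (SA p - nsum (\<lambda>y. \<bar>y\<bar> powr lam - 1) p)
      - 1 / lam * (SA p * (q (A p) - 1))) \<longlongrightarrow> 0) whp" by simp
  moreover have "\<forall>\<^sub>F p in whp. A p > 0"
    by (intro order_tendstoD(1)[OF A_tendsto]) simp
  with eventually_pos have "\<forall>\<^sub>F p in whp. (R p - nsum r p) + R p * (1 / A p - 1) - 1 / lam * (SA p - nsum (\<lambda>y. \<bar>y\<bar> powr lam - 1) p)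
      - 1 / lam * (SA p * (q (A p) - 1)) =
     rt p * (K_stat lam (fst p) (sample p) - E_K lam) - nsum eta p"
  proof eventually_elim
    case (elim p)
    define s where "s = rt p"
    have s: "s > 0" "real (fst p) = s * s" using elim by (auto simp: s_def)
    have K: "K_stat lam (fst p) (sample p) = (\<Sum>i<fst p. plog (sample p i - loc p)) / real (fst p) / A p - ln (A p) / lam"
      using K_stat_eq[of "fst p" "sample p"] elim unfolding A_def loc_def by blast
    have L: "(\<Sum>i<fst p. plog (sample p i - loc p)) / real (fst p) = E_K lam + SL p / s"
      using s by (simp add: SL_def rsum_def nsum_def s_def[symmetric] field_simps)
    have AS: "A p = 1 + SA p / s"
      using A_eq[of p] elim by (simp add: s_def)
    \<comment> \<open>\<open>SA p\<close> is \<open>s\<close> times \<open>A p - 1\<close>; the case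
      \<open>SA p = 0\<close> is the one where \<open>q\<close> takes its filled-in value.\<close>
    have ln: "s * ln (A p) = SA p * q (A p)"
      using s AS by (cases "SA p = 0") (auto simp: q_def)
    have "s * ((e + x / s) / a - L / lam - e) = (s * e + x) / a - (s * L) / lam - s * e" if "a > 0" for e x a L
      using s that lam_pos by (simp add: field_simps)
    hence "s * (K_stat lam (fst p) (sample p) - E_K lam) =
        (s * E_K lam + SL p) / A p - SA p * q (A p) / lam - s * E_K lam"
      unfolding K L ln[symmetric] using elim by blast
    also have "\<dots> = (s * E_K lam + SL p - s * E_K lam * A p) / A p - SA p * q (A p) / lam"
      using elim by (simp add: field_simps)
    also have "s * E_K lam + SL p - s * E_K lam * A p = R p"
      using s unfolding AS R_def by (simp add: field_simps)
    finally have K: "s * (K_stat lam (fst p) (sample p) - E_K lam) = R p / A p - SA p * q (A p) / lam" .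
    have "eta = (\<lambda>y. r y - 1 / lam * (\<bar>y\<bar> powr lam - 1))"
      by (simp add: fun_eq_iff eta_def r_def algebra_simps)
    hence "nsum eta p = nsum r p - 1 / lam * nsum (\<lambda>y. \<bar>y\<bar> powr lam - 1) p"
      by (simp only: nsum_diff nsum_cmult)
    thus ?case unfolding s_def[symmetric] K by (simp add: algebra_simps)
  qed
  ultimately show ?thesis by (rule Lim_transform_eventually)
qed

end

section \<open>Joint asymptotic normality\<close>

lemma vector_2_measurable:
  fixes u v :: "'a \<Rightarrow> real"
  assumes [measurable]: "u \<in> borel_measurable M" "v \<in> borel_measurable M"
  shows "(\<lambda>\<omega>. vector [u \<omega>, v \<omega>] :: real ^ 2) \<in> borel_measurable M"
proof (subst borel_measurable_euclidean_space, rule ballI)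
  fix i :: "real ^ 2" assume "i \<in> Basis"
  thus "(\<lambda>\<omega>. (vector [u \<omega>, v \<omega>] :: real ^ 2) \<bullet> i) \<in> borel_measurable M"
    by (auto simp: Basis_real2 inner_axis)
qed

context epd_sample
begin

text \<open>The central limit theorem normalises by the standard deviation. Evaluating the
  characteristic function at \<open>sd\<close> instead of 1 undoes that normalisation.\<close>

lemma nsum_char_tendsto:
  assumes f: "slow f" and m: "mean f = 0" and v: "mean (\<lambda>y. (f y)\<^sup>2) = v" and v_pos: "v > 0"
  shows "(\<lambda>n. CLINT \<omega>|M. iexp (nsum f (n, \<omega>))) \<longlonglongrightarrow> complex_of_real (exp (- v / 2))"
proof -
  note [measurable] = slow_measurable[OF f]
  have sq: "integrable lborel (\<lambda>y. (f y)\<^sup>2 * dens y)"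
    using integrable_dens_slow_mult[OF f f] by (simp add: power2_eq_square)
  have distr: "distr M borel (\<lambda>\<omega>. f (Y n \<omega>)) = distr (density lborel (\<lambda>x. ennreal (dens x))) borel f" for n
  proof -
    have "distr M borel (\<lambda>\<omega>. f (Y n \<omega>)) = distr (distr M lborel (Y n)) borel f"
      by (subst distr_distr) (auto simp: comp_def)
    thus ?thesis using distributed_distr_eq_density[OF dist, of n] by simp
  qed
  define sd where "sd = sqrt v"
  have sd: "sd > 0" "sd\<^sup>2 = v" using v_pos by (simp_all add: sd_def)
  define L where "L n = distr M borel (\<lambda>\<omega>. (\<Sum>i<n. f (Y i \<omega>)) / sqrt (real n * sd\<^sup>2))" for n
  have "weak_conv_m L std_normal_distribution"
    unfolding L_def
  proof (rule central_limit_theorem_zero_mean[OF _ _ sd(1) _ _ distr])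
    show "indep_vars (\<lambda>i. borel) (\<lambda>i \<omega>. f (Y i \<omega>)) UNIV"
      by (rule indep_vars_compose2[OF indep]) simp
    show e: "expectation (\<lambda>\<omega>. f (Y n \<omega>)) = 0" for n
      by (simp add: expectation_Y m)
    show "integrable M (\<lambda>\<omega>. (f (Y n \<omega>))\<^sup>2)" for n
      using integrable_Y[of "\<lambda>y. (f y)\<^sup>2" n] sq by simp
    show "variance (\<lambda>\<omega>. f (Y n \<omega>)) = sd\<^sup>2" for n
      using expectation_Y[of "\<lambda>y. (f y)\<^sup>2" n] by (simp add: e v sd)
  qed
  moreover have "real_distribution (L n)" for n
    unfolding L_def by (rule real_distribution_distr) simp
  ultimately have "(\<lambda>n. char (L n) sd) \<longlonglongrightarrow> char std_normal_distribution sd"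
    by (intro levy_continuity1 real_dist_normal_dist)
  moreover have "char (L n) sd = (CLINT \<omega>|M. iexp (nsum f (n, \<omega>)))" for n
  proof -
    have "char (L n) sd = (CLINT \<omega>|M. iexp (sd * ((\<Sum>i<n. f (Y i \<omega>)) / sqrt (real n * sd\<^sup>2))))"
      unfolding char_def L_def by (subst integral_distr) auto
    also have "\<dots> = (CLINT \<omega>|M. iexp (nsum f (n, \<omega>)))"
      using sd(1) by (simp add: nsum_def real_sqrt_mult)
    finally show ?thesis .
  qed
  ultimately show ?thesis by (simp add: char_std_normal_distribution sd)
qed

abbreviation ZS :: "nat \<Rightarrow> 'a \<Rightarrow> real" where
  "ZS n \<omega> \<equiv> Z_S lam n (\<lambda>i. Y i \<omega>)"

abbreviation ZK :: "nat \<Rightarrow> 'a \<Rightarrow> real" where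
  "ZK n \<omega> \<equiv> Z_K lam n (\<lambda>i. Y i \<omega>)"

abbreviation ZZ :: "nat \<Rightarrow> 'a \<Rightarrow> real ^ 2" where
  "ZZ n \<equiv> (\<lambda>\<omega>. vector [ZS n \<omega>, ZK n \<omega>])"

text \<open>The Cramer-Wold device: a linear combination of the two statistics is asymptotically a
  normalised sum of one function \<open>f\<close>. As \<open>xi\<close> and \<open>eta\<close> are
  uncorrelated, its variance is \<open>s\<^sup>2 + t\<^sup>2\<close>; when this is 0 the central
  limit theorem does not apply, and that case is separate.\<close>

lemma Z_char_tendsto:
  "(\<lambda>n. CLINT \<omega>|M. iexp (s * ZS n \<omega> + t * ZK n \<omega>))
    \<longlonglongrightarrow> char std_normal_distribution s * char std_normal_distribution t"
proof (cases "s = 0 \<and> t = 0")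
  case True
  thus ?thesis by (simp add: char_std_normal_distribution prob_space)
next
  case False
  hence v_pos: "s\<^sup>2 + t\<^sup>2 > 0" by (simp add: sum_power2_gt_zero_iff)
  define cS cK where "cS = V_S lam powr (- 1 / 2)" and "cK = V_K lam powr (- 1 / 2)"
  have c: "cS\<^sup>2 * V_S lam = 1" "cK\<^sup>2 * V_K lam = 1"
    using V_S_pos V_K_pos by (simp_all add: cS_def cK_def power2_eq_square powr_minus field_simps flip: powr_add)
  define f where "f y = (s * cS) * xi y + (t * cK) * eta y" for y
  have f: "slow f" unfolding f_def[abs_def] by (intro slow_add slow_cmult slow_xi slow_eta)
  have mf: "mean f = 0"
    unfolding f_def[abs_def] using mean_add[OF slow_cmult[OF slow_xi] slow_cmult[OF slow_eta], of "s * cS" "t * cK"]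
    by (simp add: mean_cmult mean_xi mean_eta)
  have vf: "mean (\<lambda>y. (f y)\<^sup>2) = s\<^sup>2 + t\<^sup>2"
  proof -
    have i: "integrable lborel (\<lambda>y. xi y * xi y * dens y)" "integrable lborel (\<lambda>y. xi y * eta y * dens y)"
      "integrable lborel (\<lambda>y. eta y * eta y * dens y)"
      by (intro integrable_dens_slow_mult slow_xi slow_eta)+
    have "(f y)\<^sup>2 * dens y = (s\<^sup>2 * cS\<^sup>2) * (xi y * xi y * dens y) + (2 * (s * cS) * (t * cK)) * (xi y * eta y * dens y)
       + (t\<^sup>2 * cK\<^sup>2) * (eta y * eta y * dens y)" for y
      by (simp add: f_def power2_eq_square algebra_simps)
    hence "mean (\<lambda>y. (f y)\<^sup>2) = (s\<^sup>2 * cS\<^sup>2) * mean (\<lambda>y. xi y * xi y) + (2 * (s * cS) * (t * cK)) * mean (\<lambda>y. xi y * eta y)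
       + (t\<^sup>2 * cK\<^sup>2) * mean (\<lambda>y. eta y * eta y)"
      using i by (simp add: mean_def)
    also have "\<dots> = s\<^sup>2 * (cS\<^sup>2 * V_S lam) + t\<^sup>2 * (cK\<^sup>2 * V_K lam)"
      using mean_xi_square mean_eta_square by (simp add: mean_xi_eta power2_eq_square)
    finally show ?thesis by (simp add: c)
  qed
  have "(\<lambda>n. CLINT \<omega>|M. iexp (s * ZS n \<omega> + t * ZK n \<omega>)) \<longlonglongrightarrow> complex_of_real (exp (- (s\<^sup>2 + t\<^sup>2) / 2))"
  proof (rule iexp_conv_if_close[OF _ _ _ nsum_char_tendsto[OF f mf vf v_pos]])
    show "(\<lambda>\<omega>. nsum f (n, \<omega>)) \<in> borel_measurable M" for n
      by (rule nsum_measurable[OF slow_measurable[OF f]])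
    show "(\<lambda>\<omega>. s * ZS n \<omega> + t * ZK n \<omega>) \<in> borel_measurable M" for n
      by (intro borel_measurable_add borel_measurable_times borel_measurable_const Z_measurable Y_measurable)
    have "((\<lambda>p. (s * cS) * (rt p * S_stat lam (fst p) (sample p) - nsum xi p)
        + (t * cK) * (rt p * (K_stat lam (fst p) (sample p) - E_K lam) - nsum eta p)) \<longlongrightarrow> (s * cS) * 0 + (t * cK) * 0) whp"
      by (intro tendsto_add tendsto_mult tendsto_const S_stat_tendsto K_stat_tendsto)
    moreover have "(s * cS) * (rt p * S_stat lam (fst p) (sample p) - nsum xi p)
        + (t * cK) * (rt p * (K_stat lam (fst p) (sample p) - E_K lam) - nsum eta p)
       = s * Z_S lam (fst p) (sample p) + t * Z_K lam (fst p) (sample p) - nsum f (fst p, snd p)" for p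
      unfolding f_def[abs_def] nsum_add nsum_cmult Z_S_def Z_K_def cS_def cK_def
      by (simp add: algebra_simps)
    ultimately show "((\<lambda>p. s * Z_S lam (fst p) (sample p) + t * Z_K lam (fst p) (sample p) - nsum f (fst p, snd p)) \<longlongrightarrow> 0) whp"
      by simp
  qed
  moreover have "exp (- (s\<^sup>2 + t\<^sup>2) / 2) = exp (- s\<^sup>2 / 2) * exp (- t\<^sup>2 / 2)"
    by (simp add: add_divide_distrib flip: exp_add)
  ultimately show ?thesis
    by (simp add: char_std_normal_distribution)
qed

lemma Z_weak_conv:
  "weak_conv_borel
     (\<lambda>n. distr M borel (ZZ n)) std_normal2"
proof (rule weak_conv_borelI_product)
  have Z[measurable]: "(ZZ n) \<in> borel_measurable M" for n
    by (intro vector_2_measurable Z_measurable Y_measurable)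
  show "prob_space (distr M borel (ZZ n))" for n
    by (rule prob_space_distr) simp
  fix f g :: "real \<Rightarrow> real" and B
  assume fg: "continuous_on UNIV f" "continuous_on UNIV g" "\<And>x. \<bar>f x\<bar> \<le> B" "\<And>x. \<bar>g x\<bar> \<le> B"
  have [measurable]: "f \<in> borel_measurable borel" "g \<in> borel_measurable borel"
    using fg by (auto intro: borel_measurable_continuous_onI)
  have "(\<lambda>n. expectation (\<lambda>\<omega>. f (ZS n \<omega>) * g (ZK n \<omega>))) \<longlonglongrightarrow>
     (\<integral>x. f x \<partial>std_normal_distribution) * (\<integral>x. g x \<partial>std_normal_distribution)"
    by (rule char_conv_imp_product_conv[OF Z_measurable(1)[OF Y_measurable] Z_measurable(2)[OF Y_measurable]
        real_dist_normal_dist real_dist_normal_dist Z_char_tendsto fg(1,3,2,4)])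
  also have "(\<integral>x. f x \<partial>std_normal_distribution) * (\<integral>x. g x \<partial>std_normal_distribution) = (\<integral>z. f (z $ 1) * g (z $ 2) \<partial>std_normal2)"
    using integral_std_normal2_product[of f B g] fg by simp
  also have "(\<lambda>n. expectation (\<lambda>\<omega>. f (ZS n \<omega>) * g (ZK n \<omega>))) =
    (\<lambda>n. \<integral>z. f (z $ 1) * g (z $ 2) \<partial>distr M borel (ZZ n))"
    by (subst integral_distr) auto
  finally show "(\<lambda>n. \<integral>z. f (z $ 1) * g (z $ 2) \<partial>distr M borel (ZZ n))
     \<longlonglongrightarrow> (\<integral>z. f (z $ 1) * g (z $ 2) \<partial>std_normal2)" .
qed (use prob_space_std_normal2 sets_std_normal2 in auto)

text \<open>Continuous mapping: composing a bounded continuous \<open>f\<close> with the squared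
  norm gives an admissible test function on the plane.\<close>

lemma Z_square_weak_conv:
  "weak_conv_m (\<lambda>n. distr M borel (\<lambda>\<omega>. (ZS n \<omega>)\<^sup>2 + (ZK n \<omega>)\<^sup>2)) (chi_square 2)"
proof (rule integral_bdd_continuous_conv_imp_weak_conv)
  have Z[measurable]: "(ZZ n) \<in> borel_measurable M" for n
    by (intro vector_2_measurable Z_measurable Y_measurable)
  note [measurable] = Z_measurable[of Y M, OF Y_measurable]
  interpret G: prob_space std_normal2 by (rule prob_space_std_normal2)
  show "real_distribution (distr M borel (\<lambda>\<omega>. (ZS n \<omega>)\<^sup>2 + (ZK n \<omega>)\<^sup>2))" for n
    by (rule real_distribution_distr) simp
  have sq[measurable]: "(\<lambda>z::real^2. z \<bullet> z) \<in> borel_measurable std_normal2"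
    by (simp add: measurable_cong_sets[OF sets_std_normal2 refl])
  show "real_distribution (chi_square 2)"
    unfolding distr_std_normal2_norm_square[symmetric] by (rule G.real_distribution_distr[OF sq])
  fix f :: "real \<Rightarrow> real"
  assume f: "\<And>x. isCont f x" "\<And>x. \<bar>f x\<bar> \<le> 1"
  have fc: "continuous_on UNIV f" using f(1) by (simp add: continuous_on_eq_continuous_at)
  hence [measurable]: "f \<in> borel_measurable borel" by (rule borel_measurable_continuous_onI)
  have "continuous_on UNIV (\<lambda>z::real^2. f (z \<bullet> z))"
    by (intro continuous_on_compose2[OF fc] continuous_intros) auto
  moreover have "bounded (range (\<lambda>z::real^2. f (z \<bullet> z)))"
    using f(2) by (intro boundedI[of _ 1]) auto
  ultimately have "(\<lambda>n. \<integral>z. f (z \<bullet> z) \<partial>distr M borel (ZZ n))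
     \<longlonglongrightarrow> (\<integral>z. f (z \<bullet> z) \<partial>std_normal2)"
    using Z_weak_conv unfolding weak_conv_borel_def by blast
  also have "(\<integral>z. f (z \<bullet> z) \<partial>std_normal2) = integral\<^sup>L (chi_square 2) f"
    unfolding distr_std_normal2_norm_square[symmetric] by (subst integral_distr[OF sq]) auto
  also have "(\<lambda>n. \<integral>z. f (z \<bullet> z) \<partial>distr M borel (ZZ n)) =
     (\<lambda>n. integral\<^sup>L (distr M borel (\<lambda>\<omega>. (ZS n \<omega>)\<^sup>2 + (ZK n \<omega>)\<^sup>2)) f)"
    by (simp add: integral_distr inner_vec_def sum_2 power2_eq_square)
  finally show "(\<lambda>n. integral\<^sup>L (distr M borel (\<lambda>\<omega>. (ZS n \<omega>)\<^sup>2 + (ZK n \<omega>)\<^sup>2)) f)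
     \<longlonglongrightarrow> integral\<^sup>L (chi_square 2) f" .
qed

end

theorem theorem3p3:
  fixes M :: "'a measure" and X :: "nat \<Rightarrow> 'a \<Rightarrow> real" and lam \<mu> \<sigma> :: real
  assumes "prob_space M"
    and "lam \<ge> 1" and "\<sigma> > 0"
    and "prob_space.indep_vars M (\<lambda>_. borel) X UNIV"
    and "\<And>i. distributed M lborel (X i) (\<lambda>x. ennreal (epd_density lam \<mu> \<sigma> x))"
  shows "weak_conv_borel
           (\<lambda>n. distr M borel (\<lambda>\<omega>. vector [Z_S lam n (\<lambda>i. X i \<omega>), Z_K lam n (\<lambda>i. X i \<omega>)] :: real ^ 2))
           (multivariate_normal (vector [0, 0]) (vector [vector [1, 0], vector [0, 1]]))
       \<and> weak_conv_m
           (\<lambda>n. distr M borel (\<lambda>\<omega>. (Z_S lam n (\<lambda>i. X i \<omega>))\<^sup>2 + (Z_K lam n (\<lambda>i. X i \<omega>))\<^sup>2))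
           (chi_square 2)"
proof -
  interpret prob_space M by (rule assms(1))
  interpret epd lam by standard (rule assms(2))
  define Y where "Y i \<omega> = - \<mu> / \<sigma> + (1 / \<sigma>) * X i \<omega>" for i \<omega>
  interpret epd_sample lam M Y
  proof
    show "indep_vars (\<lambda>_. borel) Y UNIV"
      unfolding Y_def[abs_def] by (rule indep_vars_compose2[OF assms(4)]) simp
    fix i
    show "distributed M lborel (Y i) (\<lambda>x. ennreal (dens x))"
      unfolding Y_def[abs_def]
    \<comment> \<open>The premise of the rule concerns the inversely transformed variable, which is
      \<open>X i\<close> again.\<close>
    proof (rule distributed_affineI[where c="1 / \<sigma>" and t="- \<mu> / \<sigma>"])
      have "ennreal \<bar>1 / \<sigma>\<bar> * ennreal (dens (x * (1 / \<sigma>) + - \<mu> / \<sigma>)) = ennreal (epd_density lam \<mu> \<sigma> x)" for x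
      proof -
        have "(1 / \<sigma>) * dens (x * (1 / \<sigma>) + - \<mu> / \<sigma>) = epd_density lam \<mu> \<sigma> x"
          using assms(3) by (simp add: dens_eq epd_density_def diff_divide_distrib)
        thus ?thesis using assms(3) dens_nonneg by (simp flip: ennreal_mult)
      qed
      moreover have "(- \<mu> / \<sigma> + 1 / \<sigma> * X i \<omega> - - \<mu> / \<sigma>) / (1 / \<sigma>) = X i \<omega>" for \<omega>
        using assms(3) by simp
      ultimately show "distributed M lborel (\<lambda>\<omega>. (- \<mu> / \<sigma> + 1 / \<sigma> * X i \<omega> - - \<mu> / \<sigma>) / (1 / \<sigma>))
          (\<lambda>x. ennreal \<bar>1 / \<sigma>\<bar> * ennreal (dens (x * (1 / \<sigma>) + - \<mu> / \<sigma>)))"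
        using assms(5)[of i] by (simp only:)
    qed (use assms(3) in auto)
  qed
  have X: "X i \<omega> = \<mu> + \<sigma> * Y i \<omega>" for i \<omega>
    using assms(3) by (simp add: Y_def field_simps)
  show ?thesis
    unfolding X Z_affine[OF assms(3)] using Z_weak_conv Z_square_weak_conv by blast
qed

end
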